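(* \textsc{ConsCheck: ($k$-)Path}, parameterized by $k$, does not admit a fixed-parameter algorithm unless $\mathsf{FPT}=\mathsf{W}[2]$.
   Context: \textsc{ConsCheck: ($k$-)Path}: Input: a finite vertex set $V$, labeled samples $(E_i,\lambda_i)_{i\in[t]}$ where each $G_i=(V,E_i)$ is a graph and $\lambda_i\in\{0,1\}$, and an integer $k$ (the parameter). Task: compute a set $F\subseteq\binom{V}{2}$ of size $k$ such that for each $i\in[t]$, $F$ forms a path in $G_i$ (i.e., $F\subseteq E_i$ and $F$ is the edge set of a simple path) if and only if $\lambda_i=1$, or report that none exists. A fixed-parameter algorithm runs in time $f(k)\cdot|\mathcal{I}|^{\mathcal{O}(1)}$ for a computable $f$. *)

theory Defs
  imports Main
begin

section \<open>Machine model\<close>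

text \<open>
  Jones' language WHILE over binary trees.  Every assignment is charged the size of the tree it
  stores (with unit costs, trees of exponential size could be built in linear time).  Hence after
  \<open>t\<close> units of time every register has size at most that of the input plus \<open>t\<close>, and running times
  agree with those of Turing machines up to a polynomial.
\<close>

datatype val = Atom | Cell val val

fun val_size :: "val \<Rightarrow> nat" where
  "val_size Atom = 1"
| "val_size (Cell a b) = Suc (val_size a + val_size b)"

datatype exp = Var nat | Const val | Cell_of exp exp | Hd exp | Tl exp | Eq exp exp

datatype cmd = Skip | Assign nat exp | Seq cmd cmd | Cond exp cmd cmd | While exp cmd

type_synonym state = "nat \<Rightarrow> val"

fun hd_val :: "val \<Rightarrow> val" where
  "hd_val Atom = Atom"
| "hd_val (Cell a b) = a"

fun tl_val :: "val \<Rightarrow> val" where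
  "tl_val Atom = Atom"
| "tl_val (Cell a b) = b"

text \<open>\<open>Atom\<close> is the only value that counts as false.\<close>

definition bool_val :: "bool \<Rightarrow> val" where
  "bool_val b = (if b then Cell Atom Atom else Atom)"

fun eval :: "exp \<Rightarrow> state \<Rightarrow> val" where
  "eval (Var x) s = s x"
| "eval (Const v) s = v"
| "eval (Cell_of e e') s = Cell (eval e s) (eval e' s)"
| "eval (Hd e) s = hd_val (eval e s)"
| "eval (Tl e) s = tl_val (eval e s)"
| "eval (Eq e e') s = bool_val (eval e s = eval e' s)"

inductive exec :: "cmd \<Rightarrow> state \<Rightarrow> nat \<Rightarrow> state \<Rightarrow> bool" where
  Skip: "exec Skip s 1 s"
| Assign: "exec (Assign x e) s (Suc (val_size (eval e s))) (s(x := eval e s))"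
| Seq: "exec c s t s' \<Longrightarrow> exec c' s' t' s'' \<Longrightarrow> exec (Seq c c') s (t + t') s''"
| CondTrue: "eval e s \<noteq> Atom \<Longrightarrow> exec c s t s' \<Longrightarrow> exec (Cond e c c') s (Suc t) s'"
| CondFalse: "eval e s = Atom \<Longrightarrow> exec c' s t s' \<Longrightarrow> exec (Cond e c c') s (Suc t) s'"
| WhileFalse: "eval e s = Atom \<Longrightarrow> exec (While e c) s 1 s"
| WhileTrue: "eval e s \<noteq> Atom \<Longrightarrow> exec c s t s' \<Longrightarrow> exec (While e c) s' t' s'' \<Longrightarrow>
    exec (While e c) s (Suc (t + t')) s''"

text \<open>Register 0 holds the input at the start and the output at the end.\<close>

definition runs :: "cmd \<Rightarrow> val \<Rightarrow> nat \<Rightarrow> val \<Rightarrow> bool" where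
  "runs P input t output \<longleftrightarrow> (\<exists>s. exec P ((\<lambda>_. Atom)(0 := input)) t s \<and> s 0 = output)"

lemma exec_deterministic:
  "exec c s t s' \<Longrightarrow> exec c s u s'' \<Longrightarrow> u = t \<and> s'' = s'"
proof (induction arbitrary: u s'' rule: exec.induct)
  case (Seq c s t s' c' t' s2)
  from Seq.prems show ?case
    by (cases rule: exec.cases) (use Seq.IH in blast)+
next
  case (WhileTrue e s c t s' t' s2)
  from WhileTrue.prems show ?case
    by (cases rule: exec.cases) (use WhileTrue.hyps WhileTrue.IH in blast)+
qed (erule exec.cases; force)+


section \<open>Encodings\<close>

definition list_val :: "val list \<Rightarrow> val" where
  "list_val vs = foldr Cell vs Atom"

text \<open>Numbers are written in unary.  Apart from the parameter, this is only applied to numbers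
  that are at most the number of vertices or gates of the encoded object, so instance sizes are those of a binary encoding
  up to a polynomial.\<close>

definition nat_val :: "nat \<Rightarrow> val" where
  "nat_val n = list_val (replicate n Atom)"

type_synonym word = "bool list"

definition word_val :: "word \<Rightarrow> val" where
  "word_val w = list_val (map bool_val w)"

text \<open>Prefix code of a tree as a bit string.\<close>

fun val_word :: "val \<Rightarrow> word" where
  "val_word Atom = [False]"
| "val_word (Cell a b) = True # val_word a @ val_word b"

definition instance_val :: "word \<Rightarrow> nat \<Rightarrow> val" where
  "instance_val x k = Cell (word_val x) (nat_val k)"

lemma list_val_eq_iff [simp]: "list_val vs = list_val ws \<longleftrightarrow> vs = ws"
proof (induction vs arbitrary: ws)
  case Nil
  then show ?case by (cases ws) (auto simp: list_val_def)
next
  case (Cons v vs)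
  then show ?case by (cases ws) (auto simp: list_val_def)
qed

lemma nat_val_eq_iff [simp]: "nat_val m = nat_val n \<longleftrightarrow> m = n"
  by (auto simp: nat_val_def dest: arg_cong[where f = length])

lemma bool_val_eq_iff [simp]: "bool_val a = bool_val b \<longleftrightarrow> a = b"
  by (auto simp: bool_val_def)

lemma word_val_eq_iff [simp]: "word_val v = word_val w \<longleftrightarrow> v = w"
  by (auto simp: word_val_def inj_map_eq_map inj_def)

lemma val_word_append_eq_iff: "val_word a @ xs = val_word b @ ys \<longleftrightarrow> a = b \<and> xs = ys"
proof (induction a arbitrary: b xs ys)
  case Atom
  then show ?case by (cases b) auto
next
  case (Cell a1 a2)
  then show ?case by (cases b) auto
qed

lemma val_word_eq_iff [simp]: "val_word a = val_word b \<longleftrightarrow> a = b"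
  using val_word_append_eq_iff[of a "[]" b "[]"] by simp


section \<open>Fixed-parameter algorithms\<close>

definition computable :: "(nat \<Rightarrow> nat) \<Rightarrow> bool" where
  "computable f \<longleftrightarrow> (\<exists>P. \<forall>n. \<exists>t. runs P (nat_val n) t (nat_val (f n)))"

text \<open>
  \<open>I\<close> is a set of instances, \<open>code\<close> and \<open>par\<close> give the encoding and the parameter of an instance,
  and \<open>correct i\<close> is the set of admissible outputs on \<open>i\<close>.
\<close>

definition fpt_computable ::
    "'i set \<Rightarrow> ('i \<Rightarrow> word) \<Rightarrow> ('i \<Rightarrow> nat) \<Rightarrow> ('i \<Rightarrow> val \<Rightarrow> bool) \<Rightarrow> bool" where
  "fpt_computable I code par correct \<longleftrightarrow>
     (\<exists>P f c. computable f \<and>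
        (\<forall>i\<in>I. \<exists>t output. runs P (instance_val (code i) (par i)) t output \<and>
           t \<le> f (par i) * Suc (length (code i)) ^ c \<and> correct i output))"

type_synonym parameterized_problem = "(word \<times> nat) set"

definition FPT :: "parameterized_problem set" where
  "FPT = {L. fpt_computable UNIV fst snd (\<lambda>i output. output \<noteq> Atom \<longleftrightarrow> i \<in> L)}"


section \<open>Circuits and the W-hierarchy\<close>

text \<open>
  A circuit is a list of gates in topological order; gates refer to their predecessors by position,
  and the last gate is the output.
\<close>

datatype gate = Input | NotG nat | AndG "nat list" | OrG "nat list"

type_synonym circuit = "gate list"

fun preds :: "gate \<Rightarrow> nat list" where
  "preds Input = []"
| "preds (NotG j) = [j]"
| "preds (AndG js) = js"
| "preds (OrG js) = js"

definition circuit :: "circuit \<Rightarrow> bool" where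
  "circuit C \<longleftrightarrow> C \<noteq> [] \<and>
     (\<forall>i<length C. distinct (preds (C ! i)) \<and> (\<forall>j\<in>set (preds (C ! i)). j < i) \<and>
        (C ! i \<noteq> Input \<longrightarrow> preds (C ! i) \<noteq> []))"

definition input_gates :: "circuit \<Rightarrow> nat set" where
  "input_gates C = {i. i < length C \<and> C ! i = Input}"

text \<open>The tests \<open>j < i\<close> serve termination only; they hold in every circuit.\<close>

fun gate_value :: "circuit \<Rightarrow> nat set \<Rightarrow> nat \<Rightarrow> bool" where
  "gate_value C A i =
     (case C ! i of
        Input \<Rightarrow> i \<in> A
      | NotG j \<Rightarrow> (if j < i then \<not> gate_value C A j else False)
      | AndG js \<Rightarrow> (\<forall>j\<in>set js. if j < i then gate_value C A j else False)
      | OrG js \<Rightarrow> (\<exists>j\<in>set js. if j < i then gate_value C A j else False))"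

declare gate_value.simps [simp del]

definition weighted_satisfiable :: "circuit \<Rightarrow> nat \<Rightarrow> bool" where
  "weighted_satisfiable C k \<longleftrightarrow>
     (\<exists>A \<subseteq> input_gates C. card A = k \<and> gate_value C A (length C - 1))"

definition circuit_path :: "circuit \<Rightarrow> nat list \<Rightarrow> bool" where
  "circuit_path C p \<longleftrightarrow> p \<noteq> [] \<and> set p \<subseteq> {..<length C} \<and>
     hd p \<in> input_gates C \<and> last p = length C - 1 \<and>
     (\<forall>i. Suc i < length p \<longrightarrow> p ! i \<in> set (preds (C ! (p ! Suc i))))"

definition large :: "gate \<Rightarrow> bool" where
  "large g \<longleftrightarrow> length (preds g) > 2"

text \<open>Circuits of weft at most \<open>t\<close> and depth at most \<open>d\<close>.\<close>

definition weft_depth_circuits :: "nat \<Rightarrow> nat \<Rightarrow> circuit set" where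
  "weft_depth_circuits t d =
     {C. circuit C \<and>
         (\<forall>p. circuit_path C p \<longrightarrow>
            length (filter (\<lambda>i. large (C ! i)) p) \<le> t \<and> length p - 1 \<le> d)}"

fun gate_code :: "gate \<Rightarrow> val" where
  "gate_code Input = Cell (nat_val 0) Atom"
| "gate_code (NotG j) = Cell (nat_val 1) (nat_val j)"
| "gate_code (AndG js) = Cell (nat_val 2) (list_val (map nat_val js))"
| "gate_code (OrG js) = Cell (nat_val 3) (list_val (map nat_val js))"

definition circuit_code :: "circuit \<Rightarrow> word" where
  "circuit_code C = val_word (list_val (map gate_code C))"

lemma gate_code_eq_iff [simp]: "gate_code g = gate_code h \<longleftrightarrow> g = h"
  by (cases g; cases h) (auto simp: inj_map_eq_map inj_def)

lemma circuit_code_eq_iff [simp]: "circuit_code C = circuit_code D \<longleftrightarrow> C = D"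
  by (auto simp: circuit_code_def inj_map_eq_map inj_def)

text \<open>
  Parameterized many-one reducibility of \<open>L\<close> to weighted satisfiability of circuits from \<open>\<C>\<close>.
  The reduction maps every instance to (the code of) a circuit in \<open>\<C>\<close>.
\<close>

definition fpt_reducible_WCS :: "parameterized_problem \<Rightarrow> circuit set \<Rightarrow> bool" where
  "fpt_reducible_WCS L \<C> \<longleftrightarrow>
     (\<exists>g. computable g \<and>
        fpt_computable UNIV fst snd
          (\<lambda>i output. \<exists>C k'. output = instance_val (circuit_code C) k' \<and> C \<in> \<C> \<and>
             k' \<le> g (snd i) \<and> (i \<in> L \<longleftrightarrow> weighted_satisfiable C k')))"

definition W :: "nat \<Rightarrow> parameterized_problem set" where
  "W t = {L. \<exists>d\<ge>1. fpt_reducible_WCS L (weft_depth_circuits t d)}"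


section \<open>Consistency checking for paths\<close>

definition path_edges :: "'a list \<Rightarrow> 'a set set" where
  "path_edges p = {{p ! i, p ! Suc i} | i. Suc i < length p}"

definition forms_path :: "'a set \<Rightarrow> 'a set set \<Rightarrow> 'a set set \<Rightarrow> bool" where
  "forms_path V E F \<longleftrightarrow> F \<subseteq> E \<and>
     (\<exists>p. p \<noteq> [] \<and> distinct p \<and> set p \<subseteq> V \<and> F = path_edges p)"

definition path_consistent ::
    "'a set \<Rightarrow> ('a set set \<times> bool) list \<Rightarrow> nat \<Rightarrow> 'a set set \<Rightarrow> bool" where
  "path_consistent V S k F \<longleftrightarrow> F \<subseteq> {e. e \<subseteq> V \<and> card e = 2} \<and> card F = k \<and>
     (\<forall>(E, l)\<in>set S. forms_path V E F \<longleftrightarrow> l)"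

text \<open>For the input of an algorithm, the vertex set is \<open>{..<n}\<close> and a set of edges is given by a
  list of its elements, the edge \<open>{u, v}\<close> with \<open>u < v\<close> being written as \<open>(u, v)\<close>.\<close>

type_synonym edge_list = "(nat \<times> nat) list"

definition edge_list :: "nat \<Rightarrow> edge_list \<Rightarrow> bool" where
  "edge_list n es \<longleftrightarrow> distinct es \<and> (\<forall>(u, v)\<in>set es. u < v \<and> v < n)"

definition edge_set :: "edge_list \<Rightarrow> nat set set" where
  "edge_set es = (\<lambda>(u, v). {u, v}) ` set es"

type_synonym cc_instance = "nat \<times> (edge_list \<times> bool) list \<times> nat"

definition cc_instances :: "cc_instance set" where
  "cc_instances = {(n, S, k). \<forall>(es, l)\<in>set S. edge_list n es}"

definition edge_list_val :: "edge_list \<Rightarrow> val" where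
  "edge_list_val es = list_val (map (\<lambda>(u, v). Cell (nat_val u) (nat_val v)) es)"

fun cc_code :: "cc_instance \<Rightarrow> word" where
  "cc_code (n, S, k) =
     val_word (Cell (nat_val n)
       (list_val (map (\<lambda>(es, l). Cell (edge_list_val es) (bool_val l)) S)))"

fun cc_par :: "cc_instance \<Rightarrow> nat" where
  "cc_par (n, S, k) = k"

fun cc_solution :: "cc_instance \<Rightarrow> nat set set \<Rightarrow> bool" where
  "cc_solution (n, S, k) F \<longleftrightarrow>
     path_consistent {..<n} (map (\<lambda>(es, l). (edge_set es, l)) S) k F"

text \<open>The output \<open>Atom\<close> reports that there is no solution.\<close>

definition cc_correct :: "cc_instance \<Rightarrow> val \<Rightarrow> bool" where
  "cc_correct i output \<longleftrightarrow>
     (if \<exists>F. cc_solution i F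
      then \<exists>es. edge_list (fst i) es \<and> cc_solution i (edge_set es) \<and>
             output = Cell Atom (edge_list_val es)
      else output = Atom)"

lemma edge_list_val_eq_iff [simp]: "edge_list_val es = edge_list_val es' \<longleftrightarrow> es = es'"
  unfolding edge_list_val_def list_val_eq_iff
  by (rule inj_map_eq_map) (auto simp: inj_def)

lemma cc_code_par_inj: "cc_code i = cc_code j \<Longrightarrow> cc_par i = cc_par j \<Longrightarrow> i = j"
proof -
  have "inj (\<lambda>(es, l). Cell (edge_list_val es) (bool_val l))"
    by (auto simp: inj_def)
  then show "cc_code i = cc_code j \<Longrightarrow> cc_par i = cc_par j \<Longrightarrow> i = j"
    by (cases i; cases j) (simp add: inj_map_eq_map val_word_append_eq_iff)
qed

end

theory Submission
  imports Defs
begin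

text \<open>
  Suppose consistency checking for paths is fixed-parameter tractable.  By distributing small gates, a
  circuit of weft two and bounded depth becomes a disjunction of polynomially many formulas, each of
  which is a conjunction of disjunctions of terms with at most \<open>m\<close> literals, where \<open>m\<close> depends on the depth
  only.  Each of these formulas is turned into one query to the path algorithm.

  An assignment of weight \<open>k\<close> is given by its \<open>k + 1\<close> gaps, the pairs of consecutive true variables; a
  literal of either sign is witnessed by one gap, so a term is witnessed by \<open>m\<close> gaps.  The graph of the query has
  one layer for every \<open>m\<close>-tuple of gap positions, whose vertices are the possible values of these gaps,
  and a positive sample makes the solution a path that meets every layer once.  A negative sample given
  by an induced subgraph forces the path to leave a set of vertices.  Such samples express both that any
  two vertices on the path agree on the gaps and that every disjunction has a witnessed term.
\<close>

section \<open>Timed computation\<close>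

text \<open>A negative sample is a weak tool: next to the positive one it only says that some vertex
  of the path lies outside a given set, a disjunction of conditions on single vertices. So a whole
  term must be checkable at one vertex. If vertices carried true variables only, this would fail for
  negative literals, since the falsity of a variable depends on all \<open>k\<close> choices; a gap
  makes it local. One layer for each of the \<open>(k + 1) ^ m\<close> tuples of positions ensures
  that, whichever gaps witness a term, some vertex of the path shows all of them at once. For
  circuits of depth at most \<open>d\<close> the proof takes \<open>m = 2 ^ d\<close>, so the new
  parameter depends on the old one only. The outermost disjunction is resolved by separate calls.
  Hence the reduction is a Turing reduction, and running times are summed over all calls. Much of
  the remaining effort is due to the machine model: reduction and calls have to be assembled into
  one WHILE program whose charged time is bounded. For this purpose a calculus of timed programs and
  polynomial-time functions is set up.\<close>

lemma exec_size: "exec c s t s' \<Longrightarrow> s' x = s x \<or> val_size (s' x) \<le> t"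
  by (induction rule: exec.induct) auto

text \<open>The final state differs from the initial one in register 0 only: the scratch registers
  below \<open>N\<close> are \<open>Atom\<close> again, and larger registers keep arbitrary
  contents. Such programs can be run one after the other, and a caller can store values above
  \<open>N\<close>.\<close>

definition computes :: "cmd \<Rightarrow> nat \<Rightarrow> val \<Rightarrow> nat \<Rightarrow> val \<Rightarrow> bool" where
  "computes P N v T w \<longleftrightarrow>
     (\<forall>s. s 0 = v \<longrightarrow> (\<forall>i. 0 < i \<and> i < N \<longrightarrow> s i = Atom) \<longrightarrow> (\<exists>t\<le>T. exec P s t (s(0 := w))))"

text \<open>The domain \<open>D\<close> allows for programs that halt on some inputs only, such as
  oracles. The bound \<open>T\<close> depends on the value and not just on its size, so that it can
  contain the running time of another program.\<close>

definition timed :: "val set \<Rightarrow> (val \<Rightarrow> val) \<Rightarrow> (val \<Rightarrow> nat) \<Rightarrow> bool" where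
  "timed D f T \<longleftrightarrow> (\<exists>P N. 0 < N \<and> (\<forall>v\<in>D. computes P N v (T v) (f v)))"

lemma computes_size: "computes P N v T w \<Longrightarrow> val_size w \<le> val_size v + T"
proof -
  assume "computes P N v T w"
  then obtain t where "t \<le> T" "exec P ((\<lambda>_. Atom)(0 := v)) t ((\<lambda>_. Atom)(0 := v, 0 := w))"
    unfolding computes_def by (auto dest!: spec[of _ "(\<lambda>_. Atom)(0 := v)"])
  with exec_size[OF this(2), of 0] show ?thesis by auto
qed

lemma computesD:
  "computes P N v T w \<Longrightarrow> s 0 = v \<Longrightarrow> (\<And>i. 0 < i \<Longrightarrow> i < N \<Longrightarrow> s i = Atom) \<Longrightarrow>
    \<exists>t\<le>T. exec P s t (s(0 := w))"
  unfolding computes_def by blast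

lemma computes_mono: "computes P N v T w \<Longrightarrow> N \<le> M \<Longrightarrow> T \<le> U \<Longrightarrow> computes P M v U w"
  unfolding computes_def by (blast intro: order_trans order_less_le_trans)

lemma timed_size: "timed D f T \<Longrightarrow> v \<in> D \<Longrightarrow> val_size (f v) \<le> val_size v + T v"
  unfolding timed_def using computes_size by blast

lemma timed_mono:
  "timed D f T \<Longrightarrow> E \<subseteq> D \<Longrightarrow> (\<And>v. v \<in> E \<Longrightarrow> g v = f v) \<Longrightarrow> (\<And>v. v \<in> E \<Longrightarrow> T v \<le> U v) \<Longrightarrow> timed E g U"
  unfolding timed_def by (metis computes_mono order_refl subsetD)

lemma timed_expr:
  assumes "\<And>v s. s 0 = v \<Longrightarrow> eval e s = f v"
  shows "timed D f (\<lambda>v. Suc (val_size (f v)))"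
proof -
  have "computes (Assign 0 e) 1 v (Suc (val_size (f v))) (f v)" for v
    unfolding computes_def using exec.Assign[of 0 e] assms by (metis order_refl)
  then show ?thesis unfolding timed_def by (metis zero_less_one)
qed

lemma timed_comp:
  assumes "timed D f T" "timed E g U" "\<And>v. v \<in> D \<Longrightarrow> f v \<in> E"
  shows "timed D (\<lambda>v. g (f v)) (\<lambda>v. T v + U (f v))"
proof -
  obtain P N where P: "0 < N" "\<And>v. v \<in> D \<Longrightarrow> computes P N v (T v) (f v)"
    using assms(1) unfolding timed_def by blast
  obtain Q M where Q: "0 < M" "\<And>v. v \<in> E \<Longrightarrow> computes Q M v (U v) (g v)"
    using assms(2) unfolding timed_def by blast
  have "computes (Seq P Q) (max N M) v (T v + U (f v)) (g (f v))" if v: "v \<in> D" for v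
    unfolding computes_def
  proof (intro allI impI)
    fix s :: state
    assume s: "s 0 = v" "\<forall>i. 0 < i \<and> i < max N M \<longrightarrow> s i = Atom"
    obtain t where t: "t \<le> T v" "exec P s t (s(0 := f v))"
      using P(2)[OF v] s unfolding computes_def by auto
    obtain u where u: "u \<le> U (f v)" "exec Q (s(0 := f v)) u ((s(0 := f v))(0 := g (f v)))"
      using Q(2)[OF assms(3)[OF v]] s unfolding computes_def
      by (metis fun_upd_other fun_upd_same less_irrefl less_max_iff_disj)
    show "\<exists>t\<le>T v + U (f v). exec (Seq P Q) s t (s(0 := g (f v)))"
      using exec.Seq[OF t(2) u(2)] t(1) u(1) by (metis add_mono fun_upd_upd)
  qed
  then show ?thesis unfolding timed_def using P(1) by (metis less_max_iff_disj)
qed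

text \<open>Both programs read register 0, so the input is saved in register \<open>K\<close>, above
  the scratch space of both, and the first result in register \<open>Suc K\<close>. The factor 5 is
  slack for the copies.\<close>

lemma timed_pair:
  assumes "timed D f T" "timed D g U"
  shows "timed D (\<lambda>v. Cell (f v) (g v)) (\<lambda>v. 5 * (T v + U v + val_size v + 2))"
proof -
  obtain P N where P: "0 < N" "\<And>v. v \<in> D \<Longrightarrow> computes P N v (T v) (f v)"
    using assms(1) unfolding timed_def by blast
  obtain Q M where Q: "0 < M" "\<And>v. v \<in> D \<Longrightarrow> computes Q M v (U v) (g v)"
    using assms(2) unfolding timed_def by blast
  define K where "K = max N M"
  define R where "R = Seq (Assign K (Var 0)) (Seq P (Seq (Assign (Suc K) (Var 0)) (Seq (Assign 0 (Var K))
     (Seq (Assign K (Const Atom)) (Seq Q (Seq (Assign 0 (Cell_of (Var (Suc K)) (Var 0))) (Assign (Suc K) (Const Atom))))))))"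
  have K: "0 < K" "N \<le> K" "M \<le> K" using P Q by (auto simp: K_def)
  have "computes R (K + 2) v (5 * (T v + U v + val_size v + 2)) (Cell (f v) (g v))" if v: "v \<in> D" for v
    unfolding computes_def
  proof (intro allI impI)
    fix s :: state
    assume s: "s 0 = v" "\<forall>i. 0 < i \<and> i < K + 2 \<longrightarrow> s i = Atom"
    define s1 where "s1 = s(K := v)"
    define s2 where "s2 = s1(0 := f v)"
    define s3 where "s3 = s2(Suc K := f v)"
    define s4 where "s4 = s3(0 := v)"
    define s5 where "s5 = s4(K := Atom)"
    define s6 where "s6 = s5(0 := g v)"
    define s7 where "s7 = s6(0 := Cell (f v) (g v))"
    define s8 where "s8 = s7(Suc K := Atom)"
    have 1: "exec (Assign K (Var 0)) s (Suc (val_size v)) s1"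
      using exec.Assign[of K "Var 0" s] s by (simp add: s1_def)
    obtain t where t: "t \<le> T v" "exec P s1 t s2"
    proof -
      have "s1 0 = v" "\<forall>i. 0 < i \<and> i < N \<longrightarrow> s1 i = Atom" using s K by (auto simp: s1_def)
      then show ?thesis using that P(2)[OF v] unfolding computes_def s2_def by blast
    qed
    have 3: "exec (Assign (Suc K) (Var 0)) s2 (Suc (val_size (f v))) s3"
      using exec.Assign[of "Suc K" "Var 0" s2] by (simp add: s3_def s2_def)
    have 4: "exec (Assign 0 (Var K)) s3 (Suc (val_size v)) s4"
      using exec.Assign[of 0 "Var K" s3] K by (simp add: s4_def s3_def s2_def s1_def)
    have 5: "exec (Assign K (Const Atom)) s4 2 s5"
      using exec.Assign[of K "Const Atom" s4] by (simp add: s5_def numeral_2_eq_2)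
    obtain u where u: "u \<le> U v" "exec Q s5 u s6"
    proof -
      have "s5 0 = v" "\<forall>i. 0 < i \<and> i < M \<longrightarrow> s5 i = Atom"
        using s K by (auto simp: s5_def s4_def s3_def s2_def s1_def)
      then show ?thesis using that Q(2)[OF v] unfolding computes_def s6_def by blast
    qed
    have 7: "exec (Assign 0 (Cell_of (Var (Suc K)) (Var 0))) s6 (Suc (val_size (Cell (f v) (g v)))) s7"
      using exec.Assign[of 0 "Cell_of (Var (Suc K)) (Var 0)" s6] K
      by (simp add: s7_def s6_def s5_def s4_def s3_def)
    have 8: "exec (Assign (Suc K) (Const Atom)) s7 2 s8"
      using exec.Assign[of "Suc K" "Const Atom" s7] by (simp add: s8_def numeral_2_eq_2)
    have "s8 = s(0 := Cell (f v) (g v))"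
      using s K by (auto simp: fun_eq_iff s8_def s7_def s6_def s5_def s4_def s3_def s2_def s1_def)
    moreover have "exec R s (Suc (val_size v) + (t + (Suc (val_size (f v)) + (Suc (val_size v) + (2 + (u +
        (Suc (val_size (Cell (f v) (g v))) + 2))))))) s8"
      unfolding R_def by (intro exec.Seq[OF 1] exec.Seq[OF t(2)] exec.Seq[OF 3] exec.Seq[OF 4]
          exec.Seq[OF 5] exec.Seq[OF u(2)] exec.Seq[OF 7] 8)
    moreover have "val_size (f v) \<le> val_size v + T v" "val_size (g v) \<le> val_size v + U v"
      using timed_size assms v by auto
    ultimately show "\<exists>t\<le>5 * (T v + U v + val_size v + 2). exec R s t (s(0 := Cell (f v) (g v)))"
      using t(1) u(1) by (intro exI conjI) (auto)
  qed
  then show ?thesis unfolding timed_def using K by (metis add_gr_0)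
qed

text \<open>The outcome of the test travels in the head of the value. Only the chosen program has to
  be defined on the tail, hence the conditional domain.\<close>

lemma timed_branch:
  assumes "timed D f T" "timed E g U"
  shows "timed {v. if hd_val v \<noteq> Atom then tl_val v \<in> D else tl_val v \<in> E}
    (\<lambda>v. if hd_val v \<noteq> Atom then f (tl_val v) else g (tl_val v))
    (\<lambda>v. 2 + val_size (tl_val v) + (if hd_val v \<noteq> Atom then T (tl_val v) else U (tl_val v)))"
proof -
  have *: "timed UNIV tl_val (\<lambda>v. Suc (val_size (tl_val v)))"
    by (rule timed_expr[of "Tl (Var 0)"]) simp
  have "timed {v. tl_val v \<in> D} (\<lambda>v. f (tl_val v)) (\<lambda>v. Suc (val_size (tl_val v)) + T (tl_val v))"
    by (rule timed_comp[OF timed_mono[OF *] assms(1)]) auto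
  then obtain P N where P: "0 < N" "\<And>v. tl_val v \<in> D \<Longrightarrow> computes P N v (Suc (val_size (tl_val v)) + T (tl_val v)) (f (tl_val v))"
    unfolding timed_def by auto
  have "timed {v. tl_val v \<in> E} (\<lambda>v. g (tl_val v)) (\<lambda>v. Suc (val_size (tl_val v)) + U (tl_val v))"
    by (rule timed_comp[OF timed_mono[OF *] assms(2)]) auto
  then obtain Q M where Q: "0 < M" "\<And>v. tl_val v \<in> E \<Longrightarrow> computes Q M v (Suc (val_size (tl_val v)) + U (tl_val v)) (g (tl_val v))"
    unfolding timed_def by auto
  have "computes (Cond (Hd (Var 0)) P Q) (max N M) v
      (2 + val_size (tl_val v) + (if hd_val v \<noteq> Atom then T (tl_val v) else U (tl_val v)))
      (if hd_val v \<noteq> Atom then f (tl_val v) else g (tl_val v))"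
    if dom: "if hd_val v \<noteq> Atom then tl_val v \<in> D else tl_val v \<in> E" for v
    unfolding computes_def
  proof (intro allI impI)
    fix s :: state
    assume s: "s 0 = v" "\<forall>i. 0 < i \<and> i < max N M \<longrightarrow> s i = Atom"
    show "\<exists>t\<le>2 + val_size (tl_val v) + (if hd_val v \<noteq> Atom then T (tl_val v) else U (tl_val v)).
      exec (Cond (Hd (Var 0)) P Q) s t (s(0 := if hd_val v \<noteq> Atom then f (tl_val v) else g (tl_val v)))"
    proof (cases "hd_val v = Atom")
      case True
      then obtain t where "t \<le> Suc (val_size (tl_val v)) + U (tl_val v)" "exec Q s t (s(0 := g (tl_val v)))"
        using computesD[OF Q(2)[of v], of s] dom s by (metis less_max_iff_disj)
      then show ?thesis using exec.CondFalse[of "Hd (Var 0)" s Q t] True s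
        by (intro exI[of _ "Suc t"]) simp
    next
      case False
      then obtain t where "t \<le> Suc (val_size (tl_val v)) + T (tl_val v)" "exec P s t (s(0 := f (tl_val v)))"
        using computesD[OF P(2)[of v], of s] dom s by (metis less_max_iff_disj)
      then show ?thesis using exec.CondTrue[of "Hd (Var 0)" s P t] False s
        by (intro exI[of _ "Suc t"]) simp
    qed
  qed
  then show ?thesis unfolding timed_def using P(1)
    by (intro exI[of _ "Cond (Hd (Var 0)) P Q"] exI[of _ "max N M"]) simp
qed

text \<open>The loop condition is kept in the head of register 0, so running the loop amounts to
  iterating \<open>g\<close>; the number \<open>n v\<close> of rounds may depend on the
  input.\<close>

lemma timed_while:
  assumes g: "timed D g T"
    and n: "\<And>v i. v \<in> E \<Longrightarrow> i < n v \<Longrightarrow> (g ^^ i) v \<in> D \<and> hd_val ((g ^^ i) v) \<noteq> Atom"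
    and stop: "\<And>v. v \<in> E \<Longrightarrow> hd_val ((g ^^ n v) v) = Atom"
  shows "timed E (\<lambda>v. (g ^^ n v) v) (\<lambda>v. Suc (\<Sum>i<n v. Suc (T ((g ^^ i) v))))"
proof -
  obtain P N where P: "0 < N" "\<And>v. v \<in> D \<Longrightarrow> computes P N v (T v) (g v)"
    using g unfolding timed_def by blast
  have *: "computes (While (Hd (Var 0)) P) N v (Suc (\<Sum>i<m. Suc (T ((g ^^ i) v)))) ((g ^^ m) v)"
    if "\<And>i. i < m \<Longrightarrow> (g ^^ i) v \<in> D \<and> hd_val ((g ^^ i) v) \<noteq> Atom" "hd_val ((g ^^ m) v) = Atom" for m v
    using that
  proof (induction m arbitrary: v)
    case 0
    have "exec (While (Hd (Var 0)) P) s 1 (s(0 := v))" if "s 0 = v" for s :: state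
      using exec.WhileFalse[of "Hd (Var 0)" s P] 0 that by (metis eval.simps(1,4) fun_upd_triv funpow_0)
    then show ?case unfolding computes_def by auto
  next
    case (Suc m)
    have v: "v \<in> D" "hd_val v \<noteq> Atom" using Suc.prems(1)[of 0] by auto
    have IH: "computes (While (Hd (Var 0)) P) N (g v) (Suc (\<Sum>i<m. Suc (T ((g ^^ i) (g v))))) ((g ^^ m) (g v))"
    proof (rule Suc.IH)
      show "(g ^^ i) (g v) \<in> D \<and> hd_val ((g ^^ i) (g v)) \<noteq> Atom" if "i < m" for i
        using Suc.prems(1)[of "Suc i"] that by (simp add: funpow_swap1)
      show "hd_val ((g ^^ m) (g v)) = Atom" using Suc.prems(2) by (simp add: funpow_swap1)
    qed
    show ?case unfolding computes_def
    proof (intro allI impI)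
      fix s :: state
      assume s: "s 0 = v" "\<forall>i. 0 < i \<and> i < N \<longrightarrow> s i = Atom"
      obtain t where t: "t \<le> T v" "exec P s t (s(0 := g v))"
        using P(2)[OF v(1)] s unfolding computes_def by auto
      obtain u where u: "u \<le> Suc (\<Sum>i<m. Suc (T ((g ^^ i) (g v))))"
        "exec (While (Hd (Var 0)) P) (s(0 := g v)) u ((s(0 := g v))(0 := (g ^^ m) (g v)))"
        using computesD[OF IH, of "s(0 := g v)"] s by auto
      have "exec (While (Hd (Var 0)) P) s (Suc (t + u)) (s(0 := (g ^^ Suc m) v))"
        using exec.WhileTrue[OF _ t(2) u(2)] v s by (simp del: funpow.simps add: funpow_Suc_right)
      moreover have "Suc (t + u) \<le> Suc (\<Sum>i<Suc m. Suc (T ((g ^^ i) v)))"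
        using t(1) u(1) by (simp add: sum.lessThan_Suc_shift funpow_Suc_right del: sum.lessThan_Suc funpow.simps)
      ultimately show "\<exists>t\<le>Suc (\<Sum>i<Suc m. Suc (T ((g ^^ i) v))).
         exec (While (Hd (Var 0)) P) s t (s(0 := (g ^^ Suc m) v))" by blast
    qed
  qed
  show ?thesis unfolding timed_def
  proof (intro exI conjI ballI)
    show "0 < N" by (rule P(1))
    show "computes (While (Hd (Var 0)) P) N v (Suc (\<Sum>i<n v. Suc (T ((g ^^ i) v)))) ((g ^^ n v) v)"
      if "v \<in> E" for v
      by (rule *) (use n[OF that] stop[OF that] in auto)
  qed
qed

section \<open>Values read as lists, and loops over lists\<close>

fun elems :: "val \<Rightarrow> val list" where
  "elems Atom = []"
| "elems (Cell a b) = a # elems b"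

lemma list_val_simps [simp]: "list_val [] = Atom" "list_val (a # l) = Cell a (list_val l)"
  by (auto simp: list_val_def)

lemma elems_list_val [simp]: "elems (list_val l) = l"
  by (induction l) auto

lemma list_val_elems [simp]: "list_val (elems v) = v"
  by (induction v) auto

lemma elems_eq_Nil [simp]: "elems v = [] \<longleftrightarrow> v = Atom"
  by (cases v) auto

lemma val_size_pos [simp]: "0 < val_size v"
  by (cases v) auto

lemma hd_val_size: "val_size (hd_val v) \<le> val_size v"
  by (cases v) auto

lemma tl_val_size: "val_size (tl_val v) \<le> val_size v"
  by (cases v) auto

lemma val_size_list_val: "val_size (list_val l) = Suc (\<Sum>x\<leftarrow>l. Suc (val_size x))"
  by (induction l) auto

lemma length_elems_less: "length (elems v) < val_size v"
  by (induction v) auto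

lemma val_size_elem: "y \<in> set (elems v) \<Longrightarrow> val_size y < val_size v"
  by (induction v) auto

text \<open>The loop state is the remaining list, paired with the input and the accumulator; the
  remaining list doubles as the loop condition. \<open>B\<close> bounds all sizes and costs, so
  there are at most \<open>B\<close> rounds of cost linear in \<open>B\<close>, hence the square.
  The factor 1000 is slack.\<close>

lemma timed_fold:
  assumes f: "timed D (\<lambda>p. f (hd_val p) (hd_val (tl_val p)) (tl_val (tl_val p))) T"
    and L: "timed E L TL" and S: "timed E S TS"
    and dom: "\<And>v i. v \<in> E \<Longrightarrow> i < length (elems (L v)) \<Longrightarrow>
      Cell v (Cell (elems (L v) ! i) (fold (f v) (take i (elems (L v))) (S v))) \<in> D \<and>
      T (Cell v (Cell (elems (L v) ! i) (fold (f v) (take i (elems (L v))) (S v)))) \<le> B v"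
    and B: "\<And>v. v \<in> E \<Longrightarrow> val_size v \<le> B v \<and> val_size (L v) \<le> B v \<and> TL v \<le> B v \<and> TS v \<le> B v"
    and Bs: "\<And>v i. v \<in> E \<Longrightarrow> i \<le> length (elems (L v)) \<Longrightarrow> val_size (fold (f v) (take i (elems (L v))) (S v)) \<le> B v"
  shows "timed E (\<lambda>v. fold (f v) (elems (L v)) (S v)) (\<lambda>v. 1000 * Suc (B v) ^ 2)"
proof -
  define arg where "arg p = Cell (hd_val (tl_val p)) (Cell (hd_val (hd_val p)) (tl_val (tl_val p)))" for p
  define F where "F p = f (hd_val p) (hd_val (tl_val p)) (tl_val (tl_val p))" for p
  define g where "g p = Cell (tl_val (hd_val p)) (Cell (hd_val (tl_val p)) (F (arg p)))" for p
  define D' where "D' = {p. arg p \<in> D}"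
  have szarg: "val_size (arg p) \<le> 3 * val_size p + 2" for p
    using hd_val_size[of "tl_val p"] hd_val_size[of "hd_val p"] tl_val_size[of "tl_val p"]
      hd_val_size[of p] tl_val_size[of p] by (auto simp: arg_def)
  have "timed D' arg (\<lambda>p. Suc (val_size (arg p)))"
    by (rule timed_expr[of "Cell_of (Hd (Tl (Var 0))) (Cell_of (Hd (Hd (Var 0))) (Tl (Tl (Var 0))))"])
      (simp add: arg_def)
  from timed_comp[OF this f[folded F_def]]
  have 1: "timed D' (\<lambda>p. F (arg p)) (\<lambda>p. Suc (val_size (arg p)) + T (arg p))"
    by (auto simp: D'_def)
  have 2: "timed D' (\<lambda>p. hd_val (tl_val p)) (\<lambda>p. Suc (val_size (hd_val (tl_val p))))"
    by (rule timed_expr[of "Hd (Tl (Var 0))"]) simp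
  have 3: "timed D' (\<lambda>p. tl_val (hd_val p)) (\<lambda>p. Suc (val_size (tl_val (hd_val p))))"
    by (rule timed_expr[of "Tl (Hd (Var 0))"]) simp
  have G: "timed D' g (\<lambda>p. 200 * (val_size p + T (arg p) + 1))"
    unfolding g_def
  proof (rule timed_mono[OF timed_pair[OF 3 timed_pair[OF 2 1]] order_refl refl])
    fix v
    have "val_size (hd_val (tl_val v)) \<le> val_size v" "val_size (tl_val (hd_val v)) \<le> val_size v"
      using hd_val_size tl_val_size order_trans by metis+
    then show "5 * (Suc (val_size (tl_val (hd_val v))) +
          5 * (Suc (val_size (hd_val (tl_val v))) + (Suc (val_size (arg v)) + T (arg v)) + val_size v + 2) +
          val_size v + 2) \<le> 200 * (val_size v + T (arg v) + 1)"
      using szarg[of v] by simp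
  qed
  define n where "n p = length (elems (hd_val p))" for p
  define E' where "E' = (\<lambda>v. Cell (L v) (Cell v (S v))) ` E"
  define st where "st v i = Cell (list_val (drop i (elems (L v)))) (Cell v (fold (f v) (take i (elems (L v))) (S v)))" for v i
  have it: "(g ^^ i) (Cell (L v) (Cell v (S v))) = st v i" if "i \<le> length (elems (L v))" for v i
    using that
  proof (induction i)
    case 0
    then show ?case by (simp add: st_def)
  next
    case (Suc i)
    then have "drop i (elems (L v)) = elems (L v) ! i # drop (Suc i) (elems (L v))"
      by (simp add: Cons_nth_drop_Suc)
    with Suc show ?case by (simp add: st_def g_def F_def arg_def take_Suc_conv_app_nth)
  qed
  have argst: "arg (st v i) = Cell v (Cell (elems (L v) ! i) (fold (f v) (take i (elems (L v))) (S v)))"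
    if "i < length (elems (L v))" for v i
    using that by (simp add: arg_def st_def Cons_nth_drop_Suc[symmetric])
  have "timed E' (\<lambda>v. (g ^^ n v) v) (\<lambda>v. Suc (\<Sum>i<n v. Suc (200 * (val_size ((g ^^ i) v) + T (arg ((g ^^ i) v)) + 1))))"
  proof (rule timed_while[OF G])
    fix w i assume "w \<in> E'" "i < n w"
    then obtain v where v: "v \<in> E" "w = Cell (L v) (Cell v (S v))" "i < length (elems (L v))"
      by (auto simp: E'_def n_def)
    then have "(g ^^ i) w = st v i" using it[of i v] by simp
    moreover have "st v i \<in> D'" using dom[OF v(1,3)] argst[OF v(3)] by (simp add: D'_def)
    moreover have "hd_val (st v i) \<noteq> Atom"
      using v(3) by (simp add: st_def Cons_nth_drop_Suc[symmetric])
    ultimately show "(g ^^ i) w \<in> D' \<and> hd_val ((g ^^ i) w) \<noteq> Atom" by simp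
  next
    fix w assume "w \<in> E'"
    then show "hd_val ((g ^^ n w) w) = Atom" using it by (auto simp: E'_def n_def st_def)
  qed
  then have W: "timed E' (\<lambda>v. (g ^^ n v) v) (\<lambda>w. Suc (n w * (801 * Suc (B (hd_val (tl_val w))))))"
  proof (rule timed_mono[OF _ order_refl refl])
    fix w assume "w \<in> E'"
    then obtain v where v: "v \<in> E" "w = Cell (L v) (Cell v (S v))" by (auto simp: E'_def)
    have "Suc (200 * (val_size ((g ^^ i) w) + T (arg ((g ^^ i) w)) + 1)) \<le> 801 * Suc (B v)" if "i < n w" for i
    proof -
      have i: "i < length (elems (L v))" using that v by (simp add: n_def)
      have "val_size (list_val (drop i (elems (L v)))) \<le> val_size (list_val (take i (elems (L v)) @ drop i (elems (L v))))"
        unfolding val_size_list_val by (simp del: append_take_drop_id)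
      then have "val_size (list_val (drop i (elems (L v)))) \<le> B v" using B[OF v(1)] by simp
      then have "val_size (st v i) \<le> 3 * B v + 2"
        using Bs[OF v(1), of i] i B[OF v(1)] by (simp add: st_def)
      moreover have "T (arg (st v i)) \<le> B v" using dom[OF v(1) i] argst[OF i] by simp
      ultimately show ?thesis using it[of i v] i v(2) by simp
    qed
    then have "(\<Sum>i<n w. Suc (200 * (val_size ((g ^^ i) w) + T (arg ((g ^^ i) w)) + 1))) \<le> (\<Sum>i<n w. 801 * Suc (B v))"
      by (intro sum_mono) auto
    then show "Suc (\<Sum>i<n w. Suc (200 * (val_size ((g ^^ i) w) + T (arg ((g ^^ i) w)) + 1)))
       \<le> Suc (n w * (801 * Suc (B (hd_val (tl_val w)))))"
      using v by simp
  qed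
  have I: "timed E (\<lambda>v. Cell (L v) (Cell v (S v))) (\<lambda>v. 85 * Suc (B v))"
  proof (rule timed_mono[OF timed_pair[OF L timed_pair[OF timed_expr[of "Var 0" "\<lambda>v. v"] S]] order_refl refl])
    fix v assume "v \<in> E"
    then show "5 * (TL v + 5 * (Suc (val_size v) + TS v + val_size v + 2) + val_size v + 2) \<le> 85 * Suc (B v)"
      using B[of v] by auto
  qed simp
  have X: "timed UNIV (\<lambda>p. tl_val (tl_val p)) (\<lambda>p. Suc (val_size (tl_val (tl_val p))))"
    by (rule timed_expr[of "Tl (Tl (Var 0))"]) simp
  show ?thesis
  proof (rule timed_mono[OF timed_comp[OF I timed_comp[OF W X]] order_refl])
    fix v assume v: "v \<in> E"
    show "Cell (L v) (Cell v (S v)) \<in> E'" using v by (simp add: E'_def)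
    have r: "(g ^^ n (Cell (L v) (Cell v (S v)))) (Cell (L v) (Cell v (S v))) = st v (length (elems (L v)))"
      using it[of "length (elems (L v))" v] by (simp add: n_def)
    then show "fold (f v) (elems (L v)) (S v) =
         tl_val (tl_val ((g ^^ n (Cell (L v) (Cell v (S v)))) (Cell (L v) (Cell v (S v)))))"
      by (simp add: st_def)
    have "val_size (fold (f v) (elems (L v)) (S v)) \<le> B v" using Bs[OF v order_refl] by simp
    moreover have "length (elems (L v)) \<le> B v"
      using length_elems_less[of "L v"] B[OF v] by simp
    then have "length (elems (L v)) * (801 * Suc (B v)) \<le> Suc (B v) * (801 * Suc (B v))"
      by (intro mult_right_mono) auto
    moreover have "85 * b + (Suc l + Suc c) \<le> 1000 * b ^ 2" if "l \<le> b * (801 * b)" "c < b" for b c l :: nat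
    proof -
      have "85 * b + (Suc l + Suc c) \<le> 88 * b + 801 * (b * b)" using that by (simp add: mult.left_commute)
      also have "88 * b \<le> 88 * (b * b)" by simp
      finally show ?thesis by (simp add: power2_eq_square)
    qed
    ultimately show "85 * Suc (B v) + (Suc (n (Cell (L v) (Cell v (S v))) *
          (801 * Suc (B (hd_val (tl_val (Cell (L v) (Cell v (S v)))))))) +
          Suc (val_size (tl_val (tl_val ((g ^^ n (Cell (L v) (Cell v (S v)))) (Cell (L v) (Cell v (S v))))))))
         \<le> 1000 * Suc (B v) ^ 2"
      unfolding r by (simp only: n_def st_def hd_val.simps tl_val.simps take_all[OF order_refl] less_Suc_eq_le)
  qed (rule UNIV_I)
qed

section \<open>Polynomial bounds and polynomial-time functions\<close>

definition poly_bounded :: "(nat \<Rightarrow> nat) \<Rightarrow> bool" where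
  "poly_bounded p \<longleftrightarrow> (\<exists>c. \<forall>n. p n \<le> (n + 2) ^ c)"

text \<open>The base \<open>n + 2\<close> is at least 2, so \<open>c < 2 ^ c\<close> absorbs a
  constant into the exponent even for small \<open>n\<close>.\<close>

lemma poly_bounded_const: "poly_bounded (\<lambda>n. c)"
proof -
  have "c \<le> (n + 2) ^ c" for n :: nat
    using less_exp[of c] power_mono[of 2 "n + 2" c] by simp
  then show ?thesis unfolding poly_bounded_def by blast
qed

lemma poly_bounded_id: "poly_bounded (\<lambda>n. n)"
  unfolding poly_bounded_def by (rule exI[of _ 1]) simp

lemma poly_bounded_mult: "poly_bounded p \<Longrightarrow> poly_bounded q \<Longrightarrow> poly_bounded (\<lambda>n. p n * q n)"
  unfolding poly_bounded_def by (metis mult_le_mono power_add)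

lemma poly_bounded_add:
  assumes "poly_bounded p" "poly_bounded q" shows "poly_bounded (\<lambda>n. p n + q n)"
proof -
  obtain a b where ab: "\<And>n. p n \<le> (n + 2) ^ a" "\<And>n. q n \<le> (n + 2) ^ b"
    using assms unfolding poly_bounded_def by blast
  have "p n + q n \<le> (n + 2) ^ Suc (a + b)" for n
  proof -
    have "p n \<le> (n + 2) ^ (a + b)" using ab(1)[of n] power_increasing[of a "a + b" "n + 2"] by linarith
    moreover have "q n \<le> (n + 2) ^ (a + b)" using ab(2)[of n] power_increasing[of b "a + b" "n + 2"] by linarith
    ultimately have "p n + q n \<le> 2 * (n + 2) ^ (a + b)" by simp
    also have "\<dots> \<le> (n + 2) ^ Suc (a + b)" by simp
    finally show ?thesis .
  qed
  then show ?thesis unfolding poly_bounded_def by blast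
qed

lemma poly_bounded_Suc: "poly_bounded p \<Longrightarrow> poly_bounded (\<lambda>n. Suc (p n))"
  using poly_bounded_add[OF poly_bounded_const[of 1]] by simp

lemma poly_bounded_power: "poly_bounded p \<Longrightarrow> poly_bounded (\<lambda>n. p n ^ c)"
  by (induction c) (auto intro: poly_bounded_const poly_bounded_mult)

lemmas poly_bounded_intros = poly_bounded_const poly_bounded_id poly_bounded_add poly_bounded_mult
  poly_bounded_power poly_bounded_Suc

definition polytime :: "(val \<Rightarrow> val) \<Rightarrow> bool" where
  "polytime f \<longleftrightarrow> (\<exists>p. poly_bounded p \<and> timed UNIV f (\<lambda>v. p (val_size v)))"

lemma polytimeI:
  "timed UNIV f T \<Longrightarrow> poly_bounded p \<Longrightarrow> (\<And>v. T v \<le> p (val_size v)) \<Longrightarrow> polytime f"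
  unfolding polytime_def by (metis timed_mono subset_refl)

lemma polytimeE:
  assumes "polytime f"
  obtains c where "timed UNIV f (\<lambda>v. (val_size v + 2) ^ c)" "\<And>v. val_size (f v) \<le> (val_size v + 2) ^ Suc c"
proof -
  obtain p c where p: "timed UNIV f (\<lambda>v. p (val_size v))" "\<And>n. p n \<le> (n + 2) ^ c"
    using assms unfolding polytime_def poly_bounded_def by blast
  have t: "timed UNIV f (\<lambda>v. (val_size v + 2) ^ c)"
    by (rule timed_mono[OF p(1)]) (auto simp: p(2) simp del: add_2_eq_Suc')
  have "val_size (f v) \<le> (val_size v + 2) ^ Suc c" for v
  proof -
    have "val_size (f v) \<le> val_size v + (val_size v + 2) ^ c" using timed_size[OF t] by simp
    also have "\<dots> \<le> (val_size v + 2) ^ c + val_size v * (val_size v + 2) ^ c + (val_size v + 2) ^ c"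
      by (simp add: trans_le_add2)
    also have "\<dots> = (val_size v + 2) ^ Suc c" by (simp add: algebra_simps)
    finally show ?thesis .
  qed
  with t that show thesis by blast
qed

lemma polytime_expr:
  assumes "\<And>v s. s 0 = v \<Longrightarrow> eval e s = f v" "poly_bounded p" "\<And>v. val_size (f v) \<le> p (val_size v)"
  shows "polytime f"
  by (rule polytimeI[OF timed_expr[OF assms(1)], where p = "\<lambda>n. Suc (p n)"])
    (auto intro: poly_bounded_Suc assms)

lemma polytime_comp:
  assumes "polytime f" "polytime g" shows "polytime (\<lambda>x. g (f x))"
proof -
  obtain a where a: "timed UNIV f (\<lambda>v. (val_size v + 2) ^ a)" "\<And>v. val_size (f v) \<le> (val_size v + 2) ^ Suc a"
    using assms(1) polytimeE by blast
  obtain b where b: "timed UNIV g (\<lambda>v. (val_size v + 2) ^ b)" using assms(2) polytimeE by blast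
  show ?thesis
  proof (rule polytimeI[OF timed_comp[OF a(1) b]])
    show "poly_bounded (\<lambda>n. (n + 2) ^ a + ((n + 2) ^ Suc a + 2) ^ b)" by (intro poly_bounded_intros)
    show "(val_size v + 2) ^ a + (val_size (f v) + 2) ^ b \<le>
       (val_size v + 2) ^ a + ((val_size v + 2) ^ Suc a + 2) ^ b" for v
      by (intro add_mono power_mono a(2) order_refl) auto
  qed auto
qed

lemma polytime_id: "polytime (\<lambda>x. x)"
  by (rule polytime_expr[of "Var 0" _ "\<lambda>n. n"]) (auto intro: poly_bounded_intros)

lemma polytime_const: "polytime (\<lambda>x. c)"
  by (rule polytime_expr[of "Const c" _ "\<lambda>n. val_size c"]) (auto intro: poly_bounded_intros)

lemma polytime_hd: "polytime f \<Longrightarrow> polytime (\<lambda>x. hd_val (f x))"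
  by (erule polytime_comp, rule polytime_expr[of "Hd (Var 0)" _ "\<lambda>n. n"])
    (auto intro: poly_bounded_intros hd_val_size)

lemma polytime_tl: "polytime f \<Longrightarrow> polytime (\<lambda>x. tl_val (f x))"
  by (erule polytime_comp, rule polytime_expr[of "Tl (Var 0)" _ "\<lambda>n. n"])
    (auto intro: poly_bounded_intros tl_val_size)

lemma polytime_Cell:
  assumes "polytime f" "polytime g" shows "polytime (\<lambda>x. Cell (f x) (g x))"
proof -
  obtain a where a: "timed UNIV f (\<lambda>v. (val_size v + 2) ^ a)" using assms(1) polytimeE by blast
  obtain b where b: "timed UNIV g (\<lambda>v. (val_size v + 2) ^ b)" using assms(2) polytimeE by blast
  show ?thesis
    by (rule polytimeI[OF timed_pair[OF a b], of "\<lambda>n. 5 * ((n + 2) ^ a + (n + 2) ^ b + n + 2)"])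
      (intro poly_bounded_intros order_refl)+
qed

lemma polytime_eq:
  assumes "polytime f" "polytime g" shows "polytime (\<lambda>x. bool_val (f x = g x))"
proof -
  have "polytime (\<lambda>p. bool_val (hd_val p = tl_val p))"
    by (rule polytime_expr[of "Eq (Hd (Var 0)) (Tl (Var 0))" _ "\<lambda>n. 3"])
      (auto intro: poly_bounded_intros simp: bool_val_def)
  from polytime_comp[OF polytime_Cell[OF assms] this] show ?thesis by simp
qed

lemma polytime_if:
  assumes "polytime (\<lambda>x. bool_val (P x))" "polytime f" "polytime g"
  shows "polytime (\<lambda>x. if P x then f x else g x)"
proof -
  obtain a where a: "timed UNIV f (\<lambda>v. (val_size v + 2) ^ a)" using assms(2) polytimeE by blast
  obtain b where b: "timed UNIV g (\<lambda>v. (val_size v + 2) ^ b)" using assms(3) polytimeE by blast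
  have "polytime (\<lambda>v. if hd_val v \<noteq> Atom then f (tl_val v) else g (tl_val v))"
  proof (rule polytimeI[OF timed_mono[OF timed_branch[OF a b] _ refl order_refl]])
    show "poly_bounded (\<lambda>n. 2 + n + (n + 2) ^ a + (n + 2) ^ b)" by (intro poly_bounded_intros)
    fix v
    show "2 + val_size (tl_val v) + (if hd_val v \<noteq> Atom then (val_size (tl_val v) + 2) ^ a else (val_size (tl_val v) + 2) ^ b)
       \<le> 2 + val_size v + (val_size v + 2) ^ a + (val_size v + 2) ^ b"
      using tl_val_size[of v] power_mono[of "val_size (tl_val v) + 2" "val_size v + 2" a]
        power_mono[of "val_size (tl_val v) + 2" "val_size v + 2" b] by auto
  qed auto
  from polytime_comp[OF polytime_Cell[OF assms(1) polytime_id] this]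
  show ?thesis by (rule back_subst[where P = polytime]) (auto simp: bool_val_def)
qed

lemma polytime_not: "polytime (\<lambda>x. bool_val (P x)) \<Longrightarrow> polytime (\<lambda>x. bool_val (\<not> P x))"
  using polytime_if[of P "\<lambda>_. bool_val False" "\<lambda>_. bool_val True"] polytime_const
  by (simp add: if_distrib[of bool_val, symmetric] cong: if_cong) (metis (mono_tags, lifting) polytime_const)

lemma polytime_and:
  assumes "polytime (\<lambda>x. bool_val (P x))" "polytime (\<lambda>x. bool_val (Q x))"
  shows "polytime (\<lambda>x. bool_val (P x \<and> Q x))"
proof -
  have "polytime (\<lambda>x. if P x then bool_val (Q x) else bool_val False)"
    by (intro polytime_if assms polytime_const)
  then show ?thesis by (rule back_subst[where P = polytime]) (auto simp: fun_eq_iff)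
qed

lemma polytime_or:
  assumes "polytime (\<lambda>x. bool_val (P x))" "polytime (\<lambda>x. bool_val (Q x))"
  shows "polytime (\<lambda>x. bool_val (P x \<or> Q x))"
proof -
  have "polytime (\<lambda>x. if P x then bool_val True else bool_val (Q x))"
    by (intro polytime_if assms polytime_const)
  then show ?thesis by (rule back_subst[where P = polytime]) (auto simp: fun_eq_iff)
qed

lemma polytime_imp:
  "polytime (\<lambda>x. bool_val (P x)) \<Longrightarrow> polytime (\<lambda>x. bool_val (Q x)) \<Longrightarrow>
    polytime (\<lambda>x. bool_val (P x \<longrightarrow> Q x))"
  unfolding imp_conv_disj by (intro polytime_or polytime_not)

text \<open>A polynomial-time step may square the size of the accumulator, and iterating such a step
  leaves polynomial time. Therefore all intermediate accumulators have to be bounded in terms of the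
  original input.\<close>

lemma polytime_fold_bounded:
  assumes f: "polytime (\<lambda>p. f (hd_val p) (hd_val (tl_val p)) (tl_val (tl_val p)))"
    and L: "polytime L" and S: "polytime S"
    and bound: "\<And>x i. i \<le> length (elems (L x)) \<Longrightarrow> val_size (fold (f x) (take i (elems (L x))) (S x)) \<le> q (val_size x)"
    and q: "poly_bounded q"
  shows "polytime (\<lambda>x. fold (f x) (elems (L x)) (S x))"
proof -
  obtain a where a: "timed UNIV L (\<lambda>v. (val_size v + 2) ^ a)" "\<And>v. val_size (L v) \<le> (val_size v + 2) ^ Suc a"
    using L polytimeE by blast
  obtain b where b: "timed UNIV S (\<lambda>v. (val_size v + 2) ^ b)"
    using S polytimeE by blast
  obtain c where c: "timed UNIV (\<lambda>p. f (hd_val p) (hd_val (tl_val p)) (tl_val (tl_val p))) (\<lambda>v. (val_size v + 2) ^ c)"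
    using f polytimeE by blast
  define B where "B n = n + (n + 2) ^ Suc a + (n + 2) ^ a + (n + 2) ^ b + q n + (n + (n + 2) ^ Suc a + q n + 4) ^ c" for n
  show ?thesis
  proof (rule polytimeI[OF timed_fold[OF c a(1) b, of "\<lambda>v. B (val_size v)"]])
    show "poly_bounded (\<lambda>n. 1000 * Suc (B n) ^ 2)"
      unfolding B_def by (intro poly_bounded_intros q)
    fix v
    show "val_size v \<le> B (val_size v) \<and> val_size (L v) \<le> B (val_size v) \<and> (val_size v + 2) ^ a \<le> B (val_size v) \<and>
         (val_size v + 2) ^ b \<le> B (val_size v)"
      using a(2)[of v] unfolding B_def by linarith
    fix i
    show "i \<le> length (elems (L v)) \<Longrightarrow> val_size (fold (f v) (take i (elems (L v))) (S v)) \<le> B (val_size v)"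
      using bound[of i v] unfolding B_def by linarith
    assume i: "i < length (elems (L v))"
    then have "val_size (elems (L v) ! i) \<le> (val_size v + 2) ^ Suc a"
      using val_size_elem[of "elems (L v) ! i" "L v"] a(2)[of v] nth_mem[OF i] by linarith
    moreover have "val_size (fold (f v) (take i (elems (L v))) (S v)) \<le> q (val_size v)"
      using bound[of i v] i by simp
    ultimately have "(val_size (Cell v (Cell (elems (L v) ! i) (fold (f v) (take i (elems (L v))) (S v)))) + 2) ^ c
      \<le> (val_size v + (val_size v + 2) ^ Suc a + q (val_size v) + 4) ^ c"
      by (intro power_mono) auto
    then show "Cell v (Cell (elems (L v) ! i) (fold (f v) (take i (elems (L v))) (S v))) \<in> UNIV \<and>
        (val_size (Cell v (Cell (elems (L v) ! i) (fold (f v) (take i (elems (L v))) (S v)))) + 2) ^ c \<le> B (val_size v)"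
      unfolding B_def by (intro conjI UNIV_I) linarith
  qed (rule order_refl)
qed

text \<open>The growth in one round is bounded independently of the accumulator, so over
  polynomially many rounds it adds up to a polynomial.\<close>

lemma polytime_fold:
  assumes f: "polytime (\<lambda>p. f (hd_val p) (hd_val (tl_val p)) (tl_val (tl_val p)))"
    and L: "polytime L" and S: "polytime S"
    and grow: "\<And>x y s. val_size (f x y s) \<le> val_size s + (val_size x + val_size y + e) ^ d"
  shows "polytime (\<lambda>x. fold (f x) (elems (L x)) (S x))"
proof -
  obtain a where a: "\<And>v. val_size (L v) \<le> (val_size v + 2) ^ a"
    using L polytimeE by metis
  obtain b where b: "\<And>v. val_size (S v) \<le> (val_size v + 2) ^ b"
    using S polytimeE by metis
  show ?thesis
  proof (rule polytime_fold_bounded[OF f L S])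
    show "poly_bounded (\<lambda>n. (n + 2) ^ b + (n + 2) ^ a * (n + (n + 2) ^ a + e) ^ d)"
      by (intro poly_bounded_intros)
    fix x i assume i: "i \<le> length (elems (L x))"
    have "val_size (fold (f x) (take i (elems (L x))) (S x)) \<le> (val_size x + 2) ^ b + i * (val_size x + (val_size x + 2) ^ a + e) ^ d"
      using i
    proof (induction i)
      case 0
      then show ?case using b by simp
    next
      case (Suc i)
      let ?y = "elems (L x) ! i"
      have "val_size ?y \<le> (val_size x + 2) ^ a"
        using val_size_elem[of ?y "L x"] a[of x] nth_mem[of i "elems (L x)"] Suc.prems by linarith
      then have "(val_size x + val_size ?y + e) ^ d \<le> (val_size x + (val_size x + 2) ^ a + e) ^ d"
        by (intro power_mono) auto
      then show ?case using Suc grow[of x ?y "fold (f x) (take i (elems (L x))) (S x)"]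
        by (simp add: take_Suc_conv_app_nth)
    qed
    moreover have "i \<le> (val_size x + 2) ^ a" using i length_elems_less[of "L x"] a[of x] by linarith
    ultimately show "val_size (fold (f x) (take i (elems (L x))) (S x)) \<le>
      (val_size x + 2) ^ b + (val_size x + 2) ^ a * (val_size x + (val_size x + 2) ^ a + e) ^ d"
      by (meson add_left_mono mult_le_mono1 order_trans)
  qed
qed

section \<open>Polynomial-time operations on lists\<close>

definition vrev :: "val \<Rightarrow> val" where "vrev l = list_val (rev (elems l))"
definition vappend :: "val \<Rightarrow> val \<Rightarrow> val" where "vappend l m = list_val (elems l @ elems m)"
definition vbind :: "val \<Rightarrow> (val \<Rightarrow> val) \<Rightarrow> val" where
  "vbind l f = list_val (concat (map (\<lambda>y. elems (f y)) (elems l)))"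
definition vmap :: "(val \<Rightarrow> val) \<Rightarrow> val \<Rightarrow> val" where "vmap f l = list_val (map f (elems l))"
definition vfilter :: "(val \<Rightarrow> bool) \<Rightarrow> val \<Rightarrow> val" where "vfilter P l = list_val (filter P (elems l))"
definition venum :: "val \<Rightarrow> val" where
  "venum l = list_val (map (\<lambda>(i, y). Cell (nat_val i) y) (enumerate 0 (elems l)))"
definition num :: "val \<Rightarrow> nat" where "num v = length (elems v)"
definition vnth :: "val \<Rightarrow> val \<Rightarrow> val" where "vnth l i = hd_val (list_val (drop (num i) (elems l)))"

lemma elems_ops [simp]:
  "elems (vrev l) = rev (elems l)" "elems (vappend l m) = elems l @ elems m"
  "elems (vbind l f) = concat (map (\<lambda>y. elems (f y)) (elems l))"
  "elems (vmap f l) = map f (elems l)" "elems (vfilter P l) = filter P (elems l)"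
  "elems (venum l) = map (\<lambda>(i, y). Cell (nat_val i) y) (enumerate 0 (elems l))"
  by (auto simp: vrev_def vappend_def vbind_def vmap_def vfilter_def venum_def)

lemma num_nat_val [simp]: "num (nat_val n) = n"
  by (simp add: num_def nat_val_def)

lemma nat_val_0 [simp]: "nat_val 0 = Atom" and nat_val_Suc: "nat_val (Suc n) = Cell Atom (nat_val n)"
  by (simp_all add: nat_val_def)

lemma vnth_eq: "i < length (elems l) \<Longrightarrow> vnth l (nat_val i) = elems l ! i"
  by (simp add: vnth_def Cons_nth_drop_Suc[symmetric])

lemma fold_Cell: "fold Cell ys s = list_val (rev ys @ elems s)"
  by (induction ys arbitrary: s) auto

lemma val_size_fold_Cell: "val_size (fold Cell (elems l) s) < val_size s + val_size l"
proof (induction l arbitrary: s)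
  case (Cell l m)
  then show ?case using Cell(2)[of "Cell l s"] by simp
qed simp

lemma polytime_fold_Cell: "polytime L \<Longrightarrow> polytime S \<Longrightarrow> polytime (\<lambda>x. fold Cell (elems (L x)) (S x))"
  by (rule polytime_fold[where f = "\<lambda>_. Cell" and e = 1 and d = 1])
    (auto intro!: polytime_Cell polytime_hd polytime_tl polytime_id)

lemma polytime_vrev: "polytime L \<Longrightarrow> polytime (\<lambda>x. vrev (L x))"
  using polytime_fold_Cell[of L "\<lambda>_. Atom"] by (simp add: vrev_def fold_Cell polytime_const)

lemma polytime_vappend: "polytime L \<Longrightarrow> polytime M \<Longrightarrow> polytime (\<lambda>x. vappend (L x) (M x))"
  using polytime_fold_Cell[of "\<lambda>x. vrev (L x)" M] by (simp add: vappend_def fold_Cell polytime_vrev)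

text \<open>The elements of each list are pushed onto a stack, which grows by the size of that list
  only; a final reversal restores the order.\<close>

lemma polytime_vbind:
  assumes f: "polytime (\<lambda>p. f (hd_val p) (tl_val p))" and L: "polytime L"
  shows "polytime (\<lambda>x. vbind (L x) (f x))"
proof -
  obtain c where c: "\<And>v. val_size (f (hd_val v) (tl_val v)) \<le> (val_size v + 2) ^ c" using polytimeE[OF f] by metis
  have "polytime (\<lambda>x. fold (\<lambda>y s. fold Cell (elems (f x y)) s) (elems (L x)) Atom)"
  proof (rule polytime_fold[OF _ L polytime_const])
    have "polytime (\<lambda>p. f (hd_val p) (hd_val (tl_val p)))"
      using polytime_comp[OF polytime_Cell[OF polytime_hd polytime_hd] f, OF polytime_id polytime_tl[OF polytime_id]]
      by simp
    then show "polytime (\<lambda>p. fold Cell (elems (f (hd_val p) (hd_val (tl_val p)))) (tl_val (tl_val p)))"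
      by (intro polytime_fold_Cell polytime_tl polytime_id)
    show "val_size (fold Cell (elems (f x y)) s) \<le> val_size s + (val_size x + val_size y + 3) ^ c" for x y s
      using val_size_fold_Cell[of "f x y" s] c[of "Cell x y"] by (simp add: numeral_3_eq_3)
  qed
  then have "polytime (\<lambda>x. vrev (fold (\<lambda>y s. fold Cell (elems (f x y)) s) (elems (L x)) Atom))"
    by (rule polytime_vrev)
  moreover have "fold (\<lambda>y s. fold Cell (elems (f x y)) s) l s = list_val (rev (concat (map (\<lambda>y. elems (f x y)) l)) @ elems s)" for x l s
    by (induction l arbitrary: s) (auto simp: fold_Cell)
  ultimately show ?thesis by (simp add: vrev_def vbind_def)
qed

lemma vmap_vbind: "vmap f l = vbind l (\<lambda>y. Cell (f y) Atom)"
  by (simp add: vmap_def vbind_def)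

lemma vfilter_vbind: "vfilter P l = vbind l (\<lambda>y. if P y then Cell y Atom else Atom)"
proof -
  have "filter P m = concat (map (\<lambda>y. elems (if P y then Cell y Atom else Atom)) m)" for m
    by (induction m) auto
  then show ?thesis by (simp add: vfilter_def vbind_def)
qed

lemma polytime_vmap:
  "polytime (\<lambda>p. f (hd_val p) (tl_val p)) \<Longrightarrow> polytime L \<Longrightarrow> polytime (\<lambda>x. vmap (f x) (L x))"
  unfolding vmap_vbind by (intro polytime_vbind polytime_Cell polytime_const)

lemma polytime_vfilter:
  "polytime (\<lambda>p. bool_val (P (hd_val p) (tl_val p))) \<Longrightarrow> polytime L \<Longrightarrow> polytime (\<lambda>x. vfilter (P x) (L x))"
  unfolding vfilter_vbind by (intro polytime_vbind polytime_if polytime_Cell polytime_tl polytime_const polytime_id)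

lemma polytime_bex:
  assumes "polytime (\<lambda>p. bool_val (P (hd_val p) (tl_val p)))" "polytime L"
  shows "polytime (\<lambda>x. bool_val (\<exists>y\<in>set (elems (L x)). P x y))"
proof -
  have "polytime (\<lambda>x. bool_val (vfilter (P x) (L x) \<noteq> Atom))"
    by (intro polytime_not polytime_eq polytime_vfilter assms polytime_const)
  moreover have "vfilter (P x) (L x) \<noteq> Atom \<longleftrightarrow> (\<exists>y\<in>set (elems (L x)). P x y)" for x
    by (metis (mono_tags, lifting) elems_eq_Nil elems_ops(5) filter_empty_conv)
  ultimately show ?thesis by simp
qed

lemma polytime_ball:
  assumes "polytime (\<lambda>p. bool_val (P (hd_val p) (tl_val p)))" "polytime L"
  shows "polytime (\<lambda>x. bool_val (\<forall>y\<in>set (elems (L x)). P x y))"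
proof -
  have "polytime (\<lambda>x. bool_val (\<not> (\<exists>y\<in>set (elems (L x)). \<not> P x y)))"
    by (intro polytime_not polytime_bex assms)
  then show ?thesis by simp
qed

lemma fold_tl_val: "fold (\<lambda>_. tl_val) ys s = list_val (drop (length ys) (elems s))"
proof (induction ys arbitrary: s)
  case (Cons y ys)
  then show ?case by (cases s) auto
qed simp

lemma polytime_drop: "polytime L \<Longrightarrow> polytime I \<Longrightarrow> polytime (\<lambda>x. list_val (drop (num (I x)) (elems (L x))))"
  using polytime_fold[of "\<lambda>_ _. tl_val" I L 0 0]
  by (simp add: fold_tl_val num_def polytime_tl polytime_id le_SucI tl_val_size)

lemma polytime_vnth: "polytime L \<Longrightarrow> polytime I \<Longrightarrow> polytime (\<lambda>x. vnth (L x) (I x))"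
  unfolding vnth_def by (intro polytime_hd polytime_drop)

lemma polytime_less:
  assumes "polytime L" "polytime I" shows "polytime (\<lambda>x. bool_val (num (L x) < num (I x)))"
proof -
  have "polytime (\<lambda>x. bool_val (\<not> list_val (drop (num (L x)) (elems (I x))) = Atom))"
    by (intro polytime_not polytime_eq polytime_drop assms polytime_const)
  moreover have "\<not> list_val (drop (num l) (elems i)) = Atom \<longleftrightarrow> num l < num i" for l i
    by (metis drop_eq_Nil elems.simps(1) elems_eq_Nil elems_list_val linorder_not_le num_def)
  ultimately show ?thesis by simp
qed

lemma val_size_nat_val: "val_size (nat_val n) = Suc (2 * n)"
  by (induction n) (auto simp: nat_val_Suc)

text \<open>The accumulator holds the next index and the reversed output. Each round copies the
  index, so the growth depends on the accumulator and \<open>polytime_fold\<close> does not apply;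
  the sizes are bounded directly.\<close>

lemma polytime_venum:
  assumes "polytime L" shows "polytime (\<lambda>x. venum (L x))"
proof -
  let ?f = "\<lambda>x y s. Cell (Cell Atom (hd_val s)) (Cell (Cell (hd_val s) y) (tl_val s))"
  have e: "fold (?f x) ys (Cell (nat_val i) s) = Cell (nat_val (i + length ys))
      (list_val (rev (map (\<lambda>(i, y). Cell (nat_val i) y) (enumerate i ys)) @ elems s))" for x ys i s
    by (induction ys arbitrary: i s) (auto simp flip: nat_val_Suc)
  have e0: "fold (?f x) ys (Cell Atom Atom) = Cell (nat_val (length ys))
      (list_val (rev (map (\<lambda>(i, y). Cell (nat_val i) y) (enumerate 0 ys))))" for x ys
    using e[of ys 0 Atom] by simp
  obtain a where a: "\<And>v. val_size (L v) \<le> (val_size v + 2) ^ a"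
    using assms polytimeE by metis
  have "polytime (\<lambda>x. fold (?f x) (elems (L x)) (Cell Atom Atom))"
  proof (rule polytime_fold_bounded[OF _ assms polytime_const])
    show "polytime (\<lambda>p. ?f (hd_val p) (hd_val (tl_val p)) (tl_val (tl_val p)))"
      by (intro polytime_Cell polytime_const polytime_hd polytime_tl polytime_id)
    let ?q = "\<lambda>n. 3 + 2 * (n + 2) ^ a + (n + 2) ^ a * (3 + 3 * (n + 2) ^ a)"
    show "poly_bounded ?q" by (intro poly_bounded_intros)
    fix x i assume i: "i \<le> length (elems (L x))"
    let ?l = "map (\<lambda>(i, y). Cell (nat_val i) y) (enumerate 0 (take i (elems (L x))))"
    define A where "A = (val_size x + 2) ^ a"
    have iA: "i \<le> A" using i length_elems_less[of "L x"] a[of x] unfolding A_def by linarith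
    have "Suc (val_size z) \<le> 3 + 3 * A" if z: "z \<in> set ?l" for z
    proof -
      obtain j y where jy: "z = Cell (nat_val j) y" "j < i" "y \<in> set (elems (L x))"
        using z by (fastforce simp: in_set_enumerate_eq)
      have "val_size y \<le> A" using val_size_elem[OF jy(3)] a[of x] unfolding A_def by linarith
      with jy iA show ?thesis by (simp add: val_size_nat_val)
    qed
    then have "(\<Sum>z\<leftarrow>?l. Suc (val_size z)) \<le> (\<Sum>z\<leftarrow>?l. 3 + 3 * A)"
      by (intro sum_list_mono) auto
    also have "\<dots> = min (length (elems (L x))) i * (3 + 3 * A)" by (simp only: sum_list_triv) simp
    also have "\<dots> \<le> A * (3 + 3 * A)" using iA by (intro mult_right_mono) auto
    finally have "val_size (list_val (rev ?l)) \<le> Suc (A * (3 + 3 * A))"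
      by (simp add: val_size_list_val rev_map[symmetric])
    then show "val_size (fold (?f x) (take i (elems (L x))) (Cell Atom Atom)) \<le> ?q (val_size x)"
      unfolding e0 A_def[symmetric] using iA i by (simp add: val_size_nat_val)
  qed
  then have "polytime (\<lambda>x. vrev (tl_val (fold (?f x) (elems (L x)) (Cell Atom Atom))))"
    by (intro polytime_vrev polytime_tl)
  then show ?thesis unfolding e0 by (simp add: vrev_def venum_def)
qed

lemmas polytime_intros = polytime_id polytime_const polytime_hd polytime_tl polytime_Cell polytime_eq
  polytime_if polytime_not polytime_and polytime_or polytime_imp polytime_vrev polytime_vappend polytime_vbind
  polytime_vmap polytime_vfilter polytime_bex polytime_ball polytime_vnth polytime_less polytime_venum

text \<open>Reduces the claim to the projections of a pair, so that the definition of
  \<open>f\<close> can be unfolded without duplicating \<open>g\<close> and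
  \<open>h\<close>.\<close>

lemma polytime2:
  "polytime (\<lambda>p. f (hd_val p) (tl_val p)) \<Longrightarrow> polytime g \<Longrightarrow> polytime h \<Longrightarrow> polytime (\<lambda>x. f (g x) (h x))"
  using polytime_comp[of "\<lambda>x. Cell (g x) (h x)" "\<lambda>p. f (hd_val p) (tl_val p)"] polytime_Cell[of g h] by simp

lemma polytime3:
  "polytime (\<lambda>p. f (hd_val p) (hd_val (tl_val p)) (tl_val (tl_val p))) \<Longrightarrow> polytime g \<Longrightarrow> polytime h \<Longrightarrow>
    polytime k \<Longrightarrow> polytime (\<lambda>x. f (g x) (h x) (k x))"
  using polytime_comp[of "\<lambda>x. Cell (g x) (Cell (h x) (k x))"
      "\<lambda>p. f (hd_val p) (hd_val (tl_val p)) (tl_val (tl_val p))"]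
    polytime_Cell[of g "\<lambda>x. Cell (h x) (k x)"] polytime_Cell[of h k] by simp

section \<open>Arbitrary programs as subroutines\<close>

fun exp_bound :: "exp \<Rightarrow> nat" where
  "exp_bound (Var x) = Suc x"
| "exp_bound (Const v) = 0"
| "exp_bound (Cell_of e e') = max (exp_bound e) (exp_bound e')"
| "exp_bound (Hd e) = exp_bound e"
| "exp_bound (Tl e) = exp_bound e"
| "exp_bound (Eq e e') = max (exp_bound e) (exp_bound e')"

fun cmd_bound :: "cmd \<Rightarrow> nat" where
  "cmd_bound Skip = 0"
| "cmd_bound (Assign x e) = max (Suc x) (exp_bound e)"
| "cmd_bound (Seq c c') = max (cmd_bound c) (cmd_bound c')"
| "cmd_bound (Cond e c c') = max (exp_bound e) (max (cmd_bound c) (cmd_bound c'))"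
| "cmd_bound (While e c) = max (exp_bound e) (cmd_bound c)"

lemma eval_cong: "(\<And>i. i < exp_bound e \<Longrightarrow> s i = r i) \<Longrightarrow> eval e s = eval e r"
  by (induction e) auto

text \<open>A program neither sees nor changes registers that it does not mention. This transfers a
  run from the particular initial state in \<open>runs\<close> to any state that agrees with it on
  the mentioned registers.\<close>

lemma exec_frame:
  assumes "exec c s t s'" "cmd_bound c \<le> N" "\<And>i. i < N \<Longrightarrow> r i = s i"
  shows "\<exists>r'. exec c r t r' \<and> (\<forall>i<N. r' i = s' i) \<and> (\<forall>i\<ge>N. r' i = r i)"
  using assms
proof (induction arbitrary: r rule: exec.induct)
  case (Skip s)
  then show ?case using exec.Skip[of r] by auto
next
  case (Assign x e s)
  have e: "eval e s = eval e r" using Assign by (intro eval_cong) auto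
  show ?case
  proof (intro exI conjI)
    show "exec (Assign x e) r (Suc (val_size (eval e s))) (r(x := eval e r))"
      unfolding e by (rule exec.Assign)
  qed (use Assign e in auto)
next
  case (Seq c s t s' c' t' s'')
  have b: "cmd_bound c \<le> N" "cmd_bound c' \<le> N" using Seq.prems(1) by auto
  obtain r1 where r1: "exec c r t r1" "\<forall>i<N. r1 i = s' i" "\<forall>i\<ge>N. r1 i = r i"
    using Seq.IH(1)[OF b(1) Seq.prems(2)] by blast
  obtain r2 where r2: "exec c' r1 t' r2" "\<forall>i<N. r2 i = s'' i" "\<forall>i\<ge>N. r2 i = r1 i"
    using Seq.IH(2)[OF b(2), of r1] r1 by blast
  show ?case using exec.Seq[OF r1(1) r2(1)] r1 r2 by (intro exI[of _ r2]) auto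
next
  case (CondTrue e s c t s' c')
  have b: "cmd_bound c \<le> N" using CondTrue.prems(1) by auto
  have "eval e r = eval e s" using CondTrue.prems by (intro eval_cong) auto
  with CondTrue.IH[OF b CondTrue.prems(2)] CondTrue.hyps show ?case
    by (metis exec.CondTrue)
next
  case (CondFalse e s c' t s' c)
  have b: "cmd_bound c' \<le> N" using CondFalse.prems(1) by auto
  have "eval e r = eval e s" using CondFalse.prems by (intro eval_cong) auto
  with CondFalse.IH[OF b CondFalse.prems(2)] CondFalse.hyps show ?case
    by (metis exec.CondFalse)
next
  case (WhileFalse e s c)
  have "eval e r = eval e s" using WhileFalse.prems by (intro eval_cong) auto
  with WhileFalse show ?case by (metis exec.WhileFalse)
next
  case (WhileTrue e s c t s' t' s'')
  have b: "cmd_bound c \<le> N" using WhileTrue.prems(1) by auto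
  have e: "eval e r = eval e s" using WhileTrue.prems by (intro eval_cong) auto
  obtain r1 where r1: "exec c r t r1" "\<forall>i<N. r1 i = s' i" "\<forall>i\<ge>N. r1 i = r i"
    using WhileTrue.IH(1)[OF b WhileTrue.prems(2)] by blast
  obtain r2 where r2: "exec (While e c) r1 t' r2" "\<forall>i<N. r2 i = s'' i" "\<forall>i\<ge>N. r2 i = r1 i"
    using WhileTrue.IH(2)[OF WhileTrue.prems(1), of r1] r1 by blast
  show ?case using exec.WhileTrue[OF _ r1(1) r2(1)] e WhileTrue.hyps r1 r2 by (intro exI[of _ r2]) auto
qed

primrec clear :: "nat \<Rightarrow> cmd" where
  "clear 0 = Skip"
| "clear (Suc n) = Seq (clear n) (Assign (Suc n) (Const Atom))"

lemma exec_clear: "exec (clear n) s (1 + 2 * n) (\<lambda>i. if 0 < i \<and> i \<le> n then Atom else s i)"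
proof (induction n)
  case 0
  have "(\<lambda>i. if 0 < i \<and> i \<le> 0 then Atom else s i) = s" by auto
  then show ?case using exec.Skip[of s] by simp
next
  case (Suc n)
  let ?r = "\<lambda>i. if 0 < i \<and> i \<le> n then Atom else s i"
  have "?r(Suc n := Atom) = (\<lambda>i. if 0 < i \<and> i \<le> Suc n then Atom else s i)" by auto
  with exec.Seq[OF Suc exec.Assign[of "Suc n" "Const Atom" ?r]] show ?case by simp
qed

text \<open>Programs supplied by a hypothesis leave garbage behind. Clearing the registers they
  mention, except for register 0, costs the constant \<open>c\<close> and makes them usable as
  subroutines.\<close>

lemma runs_computes:
  "\<exists>Q M c. 0 < M \<and> (\<forall>v t w. runs P v t w \<longrightarrow> computes Q M v (t + c) w)"
proof -
  let ?N = "Suc (cmd_bound P)"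
  have "computes (Seq P (clear (cmd_bound P))) ?N v (t + (1 + 2 * cmd_bound P)) w" if "runs P v t w" for v t w
    unfolding computes_def
  proof (intro allI impI)
    fix r :: state
    assume r: "r 0 = v" "\<forall>i. 0 < i \<and> i < ?N \<longrightarrow> r i = Atom"
    obtain s where s: "exec P ((\<lambda>_. Atom)(0 := v)) t s" "s 0 = w" using \<open>runs P v t w\<close> unfolding runs_def by blast
    obtain r' where r': "exec P r t r'" "\<forall>i<?N. r' i = s i" "\<forall>i\<ge>?N. r' i = r i"
      using exec_frame[OF s(1), of ?N r] r by fastforce
    have "exec (Seq P (clear (cmd_bound P))) r (t + (1 + 2 * cmd_bound P))
       (\<lambda>i. if 0 < i \<and> i \<le> cmd_bound P then Atom else r' i)"
      by (intro exec.Seq[OF r'(1)] exec_clear)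
    moreover have "(\<lambda>i. if 0 < i \<and> i \<le> cmd_bound P then Atom else r' i) = r(0 := w)"
      using r r' s by (auto simp: fun_eq_iff)
    ultimately show "\<exists>t'\<le>t + (1 + 2 * cmd_bound P). exec (Seq P (clear (cmd_bound P))) r t' (r(0 := w))"
      by auto
  qed
  then show ?thesis by (intro exI[of _ "Seq P (clear (cmd_bound P))"] exI[of _ ?N] exI[of _ "1 + 2 * cmd_bound P"]) blast
qed

lemma computes_runs: "computes P N v T w \<Longrightarrow> \<exists>t\<le>T. runs P v t w"
  using computesD[of P N v T w "(\<lambda>_. Atom)(0 := v)"] unfolding runs_def by fastforce

text \<open>Where only termination matters, the sum of all sizes and costs along the fold can serve
  as \<open>B\<close>.\<close>

lemma timed_fold_total:
  assumes f: "timed D (\<lambda>p. f (hd_val p) (hd_val (tl_val p)) (tl_val (tl_val p))) T"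
    and L: "timed E L TL" and S: "timed E S TS"
    and dom: "\<And>v i. v \<in> E \<Longrightarrow> i < length (elems (L v)) \<Longrightarrow>
      Cell v (Cell (elems (L v) ! i) (fold (f v) (take i (elems (L v))) (S v))) \<in> D"
  shows "\<exists>U. timed E (\<lambda>v. fold (f v) (elems (L v)) (S v)) U"
proof -
  let ?s = "\<lambda>v i. fold (f v) (take i (elems (L v))) (S v)"
  let ?t = "\<lambda>v i. T (Cell v (Cell (elems (L v) ! i) (?s v i)))"
  define B where "B v = val_size v + val_size (L v) + TL v + TS v +
    (\<Sum>i\<le>length (elems (L v)). val_size (?s v i)) + (\<Sum>i\<le>length (elems (L v)). ?t v i)" for v
  have 1: "?t v i \<le> B v" if "i \<le> length (elems (L v))" for v i
    using member_le_sum[of i "{..length (elems (L v))}" "?t v"] that by (simp add: B_def)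
  have 2: "val_size (?s v i) \<le> B v" if "i \<le> length (elems (L v))" for v i
    using member_le_sum[of i "{..length (elems (L v))}" "\<lambda>i. val_size (?s v i)"] that by (simp add: B_def)
  show ?thesis
    by (rule exI, rule timed_fold[OF f L S, of B]) (use 1 2 dom in \<open>auto simp: B_def\<close>)
qed

section \<open>Computable functions\<close>

lemma computable_iff:
  "computable f \<longleftrightarrow> (\<exists>F T. timed (range nat_val) F T \<and> (\<forall>n. F (nat_val n) = nat_val (f n)))"
proof
  assume "computable f"
  then obtain P where "\<forall>n. \<exists>t. runs P (nat_val n) t (nat_val (f n))" unfolding computable_def by blast
  then obtain t where t: "\<And>n. runs P (nat_val n) (t n) (nat_val (f n))" by metis
  obtain Q M c where Q: "0 < M" "\<And>v t w. runs P v t w \<Longrightarrow> computes Q M v (t + c) w"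
    using runs_computes by metis
  have "timed (range nat_val) (\<lambda>v. nat_val (f (num v))) (\<lambda>v. t (num v) + c)"
    unfolding timed_def using Q t by (intro exI[of _ Q] exI[of _ M]) auto
  then show "\<exists>F T. timed (range nat_val) F T \<and> (\<forall>n. F (nat_val n) = nat_val (f n))"
    by (intro exI conjI) auto
next
  assume "\<exists>F T. timed (range nat_val) F T \<and> (\<forall>n. F (nat_val n) = nat_val (f n))"
  then obtain F T P N where "\<And>n. computes P N (nat_val n) (T (nat_val n)) (F (nat_val n))" "\<And>n. F (nat_val n) = nat_val (f n)"
    unfolding timed_def by blast
  then show "computable f" unfolding computable_def using computes_runs by metis
qed

lemma polytime_timed: "polytime f \<Longrightarrow> \<exists>T. timed D f T"
  unfolding polytime_def by (metis timed_mono order_refl subset_UNIV)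

lemma computable_const: "computable (\<lambda>_. c)"
  unfolding computable_iff using polytime_timed[OF polytime_const] by blast

lemma computable_id: "computable (\<lambda>n. n)"
  unfolding computable_iff using polytime_timed[OF polytime_id] by blast

lemma computable_comp:
  assumes "computable f" "computable g" shows "computable (\<lambda>n. g (f n))"
proof -
  obtain F T where F: "timed (range nat_val) F T" "\<And>n. F (nat_val n) = nat_val (f n)"
    using assms(1) unfolding computable_iff by blast
  obtain G U where G: "timed (range nat_val) G U" "\<And>n. G (nat_val n) = nat_val (g n)"
    using assms(2) unfolding computable_iff by blast
  show ?thesis unfolding computable_iff using timed_comp[OF F(1) G(1)] F(2) G(2) by fastforce
qed

lemma computable_binop:
  assumes "computable f" "computable g" "polytime (\<lambda>p. h (hd_val p) (tl_val p))"
    and h: "\<And>m n. h (nat_val m) (nat_val n) = nat_val (H m n)"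
  shows "computable (\<lambda>n. H (f n) (g n))"
proof -
  obtain F T where F: "timed (range nat_val) F T" "\<And>n. F (nat_val n) = nat_val (f n)"
    using assms(1) unfolding computable_iff by blast
  obtain G U where G: "timed (range nat_val) G U" "\<And>n. G (nat_val n) = nat_val (g n)"
    using assms(2) unfolding computable_iff by blast
  obtain V where V: "timed UNIV (\<lambda>p. h (hd_val p) (tl_val p)) V"
    using polytime_timed[OF assms(3)] by blast
  show ?thesis unfolding computable_iff
    using timed_comp[OF timed_pair[OF F(1) G(1)] V] F(2) G(2) h by fastforce
qed

lemma vappend_nat_val: "vappend (nat_val m) (nat_val n) = nat_val (m + n)"
  by (simp add: vappend_def nat_val_def replicate_add)

lemma vbind_nat_val: "vbind (nat_val m) (\<lambda>_. nat_val n) = nat_val (m * n)"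
proof -
  have "concat (replicate m (replicate n Atom)) = replicate (m * n) Atom"
    by (induction m) (auto simp: replicate_add)
  then show ?thesis by (simp add: vbind_def nat_val_def map_replicate_const)
qed

lemma computable_add: "computable f \<Longrightarrow> computable g \<Longrightarrow> computable (\<lambda>n. f n + g n)"
  by (rule computable_binop[of f g vappend]) (auto intro!: polytime_intros vappend_nat_val)

lemma computable_mult: "computable f \<Longrightarrow> computable g \<Longrightarrow> computable (\<lambda>n. f n * g n)"
  by (rule computable_binop[of f g "\<lambda>u v. vbind u (\<lambda>_. v)"]) (auto intro!: polytime_intros vbind_nat_val)

lemma computable_power: "computable f \<Longrightarrow> computable (\<lambda>n. f n ^ c)"
  by (induction c) (auto intro: computable_const computable_mult)

text \<open>Such a sum is a computable upper bound for all values of \<open>f\<close> below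
  \<open>n\<close>, whether or not \<open>f\<close> is monotone. The unary numeral itself is the
  list over which the loop runs; its elements are ignored, and the accumulator holds a counter and
  the partial sum.\<close>

lemma computable_sum:
  assumes "computable f" shows "computable (\<lambda>n. \<Sum>j<n. f j)"
proof -
  obtain F T where F: "timed (range nat_val) F T" "\<And>n. F (nat_val n) = nat_val (f n)"
    using assms unfolding computable_iff by blast
  define h where "h x y s = Cell (Cell Atom (hd_val s)) (vappend (F (hd_val s)) (tl_val s))" for x y s :: val
  \<comment> \<open>\<open>F\<close> is known to be correct on numerals only, so the counter in the
    accumulator has to be one.\<close>
  define D where "D = {p. hd_val (tl_val (tl_val p)) \<in> range nat_val}"
  have "(h x y ^^ i) (Cell Atom Atom) = Cell (nat_val i) (nat_val (\<Sum>j<i. f j))" for x y i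
    by (induction i) (auto simp: h_def F(2) vappend_nat_val nat_val_Suc add.commute)
  then have s: "fold (h x) (take i (elems (nat_val n))) (Cell Atom Atom) = Cell (nat_val i) (nat_val (\<Sum>j<i. f j))"
    if "i \<le> n" for x i n
    using that by (simp add: nat_val_def[of n] min_absorb2 min_absorb1)
  have 1: "\<exists>T. timed D (\<lambda>p. F (hd_val (tl_val (tl_val p)))) T"
  proof -
    obtain T' where "timed D (\<lambda>p. hd_val (tl_val (tl_val p))) T'"
      using polytime_timed[OF polytime_hd[OF polytime_tl[OF polytime_tl[OF polytime_id]]]] by blast
    from timed_comp[OF this F(1)] show ?thesis by (auto simp: D_def)
  qed
  then obtain T1 where 1: "timed D (\<lambda>p. F (hd_val (tl_val (tl_val p)))) T1" by blast
  obtain T2 where 2: "timed D (\<lambda>p. p) T2" using polytime_timed[OF polytime_id] by blast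
  have "polytime (\<lambda>q. Cell (Cell Atom (hd_val (tl_val (tl_val (tl_val q)))))
      (vappend (hd_val q) (tl_val (tl_val (tl_val (tl_val q))))))"
    by (intro polytime_intros)
  then obtain T3 where 3: "timed UNIV (\<lambda>q. Cell (Cell Atom (hd_val (tl_val (tl_val (tl_val q)))))
      (vappend (hd_val q) (tl_val (tl_val (tl_val (tl_val q)))))) T3"
    using polytime_timed by blast
  have 4: "\<exists>T. timed D (\<lambda>p. h (hd_val p) (hd_val (tl_val p)) (tl_val (tl_val p))) T"
    using timed_comp[OF timed_pair[OF 1 2] 3] by (auto simp: h_def)
  then obtain T4 where 4: "timed D (\<lambda>p. h (hd_val p) (hd_val (tl_val p)) (tl_val (tl_val p))) T4" by blast
  obtain T5 where 5: "timed (range nat_val) (\<lambda>v. v) T5" using polytime_timed[OF polytime_id] by blast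
  obtain T6 where 6: "timed (range nat_val) (\<lambda>v. Cell Atom Atom) T6" using polytime_timed[OF polytime_const] by blast
  have "\<exists>U. timed (range nat_val) (\<lambda>v. fold (h v) (elems v) (Cell Atom Atom)) U"
  proof (rule timed_fold_total[OF 4 5 6])
    fix v i assume "v \<in> range nat_val" "i < length (elems v)"
    then show "Cell v (Cell (elems v ! i) (fold (h v) (take i (elems v)) (Cell Atom Atom))) \<in> D"
      using s by (auto simp: D_def num_nat_val[unfolded num_def])
  qed
  then obtain U where U: "timed (range nat_val) (\<lambda>v. fold (h v) (elems v) (Cell Atom Atom)) U" by blast
  obtain T7 where 7: "timed UNIV tl_val T7" using polytime_timed[OF polytime_tl[OF polytime_id]] by blast
  have "fold (h v) (elems (nat_val n)) (Cell Atom Atom) = Cell (nat_val n) (nat_val (\<Sum>j<n. f j))" for v n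
    using s[of n n v] num_nat_val[of n, unfolded num_def] by simp
  with timed_comp[OF U 7] show ?thesis unfolding computable_iff by fastforce
qed

section \<open>Paths in layered graphs\<close>

text \<open>Each edge is listed once, starting from the smaller identifier, as
  \<open>edge_list\<close> demands.\<close>

definition layer_edges :: "('v \<Rightarrow> nat) \<Rightarrow> ('v \<Rightarrow> nat) \<Rightarrow> 'v list \<Rightarrow> edge_list" where
  "layer_edges idn lay X = concat (map (\<lambda>y. map (\<lambda>z. (idn y, idn z))
     (filter (\<lambda>z. idn y < idn z \<and> (lay z = Suc (lay y) \<or> lay y = Suc (lay z))) X)) X)"

lemma set_layer_edges:
  "set (layer_edges idn lay X) = {(idn y, idn z) | y z. y \<in> set X \<and> z \<in> set X \<and> idn y < idn z \<and>
     (lay z = Suc (lay y) \<or> lay y = Suc (lay z))}"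
  unfolding layer_edges_def by auto

lemma distinct_layer_edges:
  assumes "distinct X" "inj_on idn (set X)"
  shows "distinct (layer_edges idn lay X)"
proof -
  have "distinct (concat (map (\<lambda>y. map (\<lambda>z. (idn y, idn z)) (filter (Q y) X)) V))"
    if "distinct V" "set V \<subseteq> set X" for V Q
    using that
  proof (induction V)
    case (Cons v V)
    then show ?case using assms by (auto simp: distinct_map inj_on_def)
  qed simp
  from this[OF assms(1) subset_refl] show ?thesis unfolding layer_edges_def .
qed

lemma edge_set_layer_edges:
  assumes "inj_on idn (set X)"
  shows "edge_set (layer_edges idn lay X) = {{idn y, idn z} | y z. y \<in> set X \<and> z \<in> set X \<and>
     (lay z = Suc (lay y) \<or> lay y = Suc (lay z))}" (is "_ = ?R")
proof
  show "edge_set (layer_edges idn lay X) \<subseteq> ?R"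
    unfolding edge_set_def set_layer_edges by fastforce
  show "?R \<subseteq> edge_set (layer_edges idn lay X)"
  proof
    fix e assume "e \<in> ?R"
    then obtain y z where yz: "e = {idn y, idn z}" "y \<in> set X" "z \<in> set X" "lay z = Suc (lay y) \<or> lay y = Suc (lay z)"
      by blast
    then have "idn y \<noteq> idn z" using assms by (metis inj_on_contraD n_not_Suc_n)
    then have "(idn y, idn z) \<in> set (layer_edges idn lay X) \<or> (idn z, idn y) \<in> set (layer_edges idn lay X)"
      unfolding set_layer_edges using yz by (smt (verit) mem_Collect_eq nat_neq_iff)
    then show "e \<in> edge_set (layer_edges idn lay X)"
      unfolding edge_set_def yz by (auto simp: insert_commute intro: rev_image_eqI)
  qed
qed

lemma path_edges_image: "path_edges p = (\<lambda>i. {p ! i, p ! Suc i}) ` {..<length p - 1}"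
  unfolding path_edges_def by (auto simp: image_iff)

lemma card_path_edges: "distinct p \<Longrightarrow> card (path_edges p) = length p - 1"
proof -
  assume d: "distinct p"
  have "inj_on (\<lambda>i. {p ! i, p ! Suc i}) {..<length p - 1}"
    using d by (auto simp: inj_on_def doubleton_eq_iff nth_eq_iff_index_eq)
  then show ?thesis unfolding path_edges_image by (simp add: card_image)
qed

lemma unit_steps_bounded:
  fixes a :: "nat \<Rightarrow> nat"
  assumes "\<And>i. i < L \<Longrightarrow> a (Suc i) = Suc (a i) \<or> a i = Suc (a (Suc i))"
  shows "i + d \<le> L \<Longrightarrow> a (i + d) \<le> a i + d \<and> a i \<le> a (i + d) + d"
proof (induction d)
  case (Suc d)
  then show ?case using assms[of "i + d"] by auto
qed simp

text \<open>Positions with values 0 and \<open>L\<close> are at least \<open>L\<close> steps apart,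
  so they are the two ends and no step in between can turn back. The direction remains open.\<close>

lemma unit_steps_end_to_end:
  fixes a :: "nat \<Rightarrow> nat"
  assumes step: "\<And>i. i < L \<Longrightarrow> a (Suc i) = Suc (a i) \<or> a i = Suc (a (Suc i))"
    and i: "i \<le> L" "a i = 0" and j: "j \<le> L" "a j = L"
  shows "(\<forall>s\<le>L. a s = s) \<or> (\<forall>s\<le>L. a (L - s) = s)"
proof (cases "i \<le> j")
  case True
  have "L \<le> j - i" using unit_steps_bounded[of L a i "j - i", OF step] True i j by simp
  then have ij: "i = 0" "j = L" using i j True by auto
  have "a s = s" if "s \<le> L" for s
    using unit_steps_bounded[of L a 0 s, OF step] unit_steps_bounded[of L a s "L - s", OF step] i j that
    unfolding ij by simp linarith
  then show ?thesis by blast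
next
  case False
  have "L \<le> i - j" using unit_steps_bounded[of L a j "i - j", OF step] False i j by simp
  then have ij: "j = 0" "i = L" using i j False by auto
  have "a (L - s) = s" if "s \<le> L" for s
    using unit_steps_bounded[of L a 0 "L - s", OF step] unit_steps_bounded[of L a "L - s" s, OF step] i j that
    unfolding ij by simp linarith
  then show ?thesis by blast
qed

text \<open>A path with \<open>L\<close> edges that meets the first and the last layer meets every layer once; a
  negative sample induced by \<open>X\<close> then says that the path leaves \<open>X\<close>.\<close>

definition layered_instance :: "('v \<Rightarrow> nat) \<Rightarrow> ('v \<Rightarrow> nat) \<Rightarrow> 'v list \<Rightarrow> 'v list list \<Rightarrow> nat \<Rightarrow> cc_instance" where
  "layered_instance idn lay V Ws L =
     (length V, (layer_edges idn lay V, True) # map (\<lambda>X. (layer_edges idn lay X, False)) Ws, L)"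

text \<open>A path of layer edges lies in the subgraph induced by \<open>X\<close> exactly if all
  its vertices lie in \<open>X\<close>; here \<open>0 < L\<close> guarantees that each vertex is on
  an edge. The two sets that omit the first and the last layer turn a path with \<open>L\<close>
  edges into a choice of one vertex \<open>c s\<close> per layer.\<close>

lemma layered_instance:
  assumes ids: "map idn V = [0..<length V]" and L: "0 < L"
    and Ws: "\<And>X. X \<in> set Ws \<Longrightarrow> set X \<subseteq> set V \<and> distinct X"
    and first: "filter (\<lambda>y. lay y \<noteq> 0) V \<in> set Ws" and last: "filter (\<lambda>y. lay y \<noteq> L) V \<in> set Ws"
  shows "layered_instance idn lay V Ws L \<in> cc_instances"
    and "(\<exists>F. cc_solution (layered_instance idn lay V Ws L) F) \<longleftrightarrow>
      (\<exists>c. (\<forall>s\<le>L. c s \<in> set V \<and> lay (c s) = s) \<and> (\<forall>X\<in>set Ws. \<exists>s\<le>L. c s \<notin> set X))"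
proof -
  let ?n = "length V" and ?E = "\<lambda>X. edge_set (layer_edges idn lay X)"
  have dV: "distinct V" using ids by (metis distinct_map distinct_upt)
  have inj: "inj_on idn (set V)" using ids by (metis distinct_map distinct_upt)
  have idn_nth: "idn (V ! i) = i" if "i < ?n" for i
    using arg_cong[OF ids, of "\<lambda>l. l ! i"] that by simp
  have idn_less: "idn y < ?n" if "y \<in> set V" for y
    using that idn_nth by (auto simp: in_set_conv_nth)
  have nth_idn: "V ! idn y = y" if "y \<in> set V" for y
    using that idn_nth by (auto simp: in_set_conv_nth)
  have injW: "inj_on idn (set X)" if "set X \<subseteq> set V" for X using inj that by (rule inj_on_subset)
  have el: "edge_list ?n (layer_edges idn lay X)" if "set X \<subseteq> set V" "distinct X" for X
    unfolding edge_list_def using distinct_layer_edges[OF that(2) injW[OF that(1)], of lay] idn_less that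
    by (fastforce simp: set_layer_edges)
  show "layered_instance idn lay V Ws L \<in> cc_instances"
    unfolding cc_instances_def layered_instance_def using el Ws dV by auto
  have E: "{u, v} \<in> ?E X \<longleftrightarrow> V ! u \<in> set X \<and> V ! v \<in> set X \<and>
     (lay (V ! v) = Suc (lay (V ! u)) \<or> lay (V ! u) = Suc (lay (V ! v)))"
    if X: "set X \<subseteq> set V" and uv: "u < ?n" "v < ?n" for X u v
  proof
    assume "{u, v} \<in> ?E X"
    then obtain y z where yz: "{u, v} = {idn y, idn z}" "y \<in> set X" "z \<in> set X"
       "lay z = Suc (lay y) \<or> lay y = Suc (lay z)"
      unfolding edge_set_layer_edges[OF injW[OF X]] by blast
    then have "V ! idn y = y" "V ! idn z = z" using nth_idn X by auto
    with yz show "V ! u \<in> set X \<and> V ! v \<in> set X \<and>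
     (lay (V ! v) = Suc (lay (V ! u)) \<or> lay (V ! u) = Suc (lay (V ! v)))"
      by (auto simp: doubleton_eq_iff)
  next
    assume "V ! u \<in> set X \<and> V ! v \<in> set X \<and>
     (lay (V ! v) = Suc (lay (V ! u)) \<or> lay (V ! u) = Suc (lay (V ! v)))"
    then show "{u, v} \<in> ?E X"
      unfolding edge_set_layer_edges[OF injW[OF X]] using idn_nth[OF uv(1)] idn_nth[OF uv(2)]
      by (smt (verit) mem_Collect_eq)
  qed
  show "(\<exists>F. cc_solution (layered_instance idn lay V Ws L) F) \<longleftrightarrow>
      (\<exists>c. (\<forall>s\<le>L. c s \<in> set V \<and> lay (c s) = s) \<and> (\<forall>X\<in>set Ws. \<exists>s\<le>L. c s \<notin> set X))"
  proof
    assume "\<exists>F. cc_solution (layered_instance idn lay V Ws L) F"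
    then obtain F where F: "card F = L" "forms_path {..<?n} (?E V) F"
      "\<And>X. X \<in> set Ws \<Longrightarrow> \<not> forms_path {..<?n} (?E X) F"
      unfolding layered_instance_def by (auto simp: path_consistent_def)
    obtain p where p: "F \<subseteq> ?E V" "p \<noteq> []" "distinct p" "set p \<subseteq> {..<?n}" "F = path_edges p"
      using F(2) unfolding forms_path_def by blast
    have len: "length p = Suc L" using card_path_edges[OF p(3)] F(1) p(2,5) by (cases p) auto
    have pn: "p ! i < ?n" if "i \<le> L" for i using p(4) len that by (metis lessThan_iff less_Suc_eq_le nth_mem subsetD)
    have pV: "V ! (p ! i) \<in> set V" if "i \<le> L" for i using pn[OF that] by simp
    define a where "a i = lay (V ! (p ! i))" for i
    have step: "a (Suc i) = Suc (a i) \<or> a i = Suc (a (Suc i))" if "i < L" for i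
    proof -
      have "{p ! i, p ! Suc i} \<in> ?E V" using p(1,5) that len unfolding path_edges_def by auto
      then show ?thesis using E[of V "p ! i" "p ! Suc i"] pn that by (auto simp: a_def)
    qed
    have leave: "\<exists>i\<le>L. V ! (p ! i) \<notin> set X" if X: "X \<in> set Ws" for X
    proof (rule ccontr)
      assume "\<not> ?thesis"
      then have in_W: "V ! (p ! i) \<in> set X" if "i \<le> L" for i using that by blast
      have "F \<subseteq> ?E X"
      proof
        fix e assume "e \<in> F"
        then obtain i where i: "e = {p ! i, p ! Suc i}" "Suc i \<le> L"
          unfolding p(5) path_edges_def using len by auto
        then show "e \<in> ?E X"
          using E[of X "p ! i" "p ! Suc i"] Ws[OF X] pn[of i] pn[of "Suc i"] in_W[of i] in_W[of "Suc i"] step[of i]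
          by (auto simp: a_def)
      qed
      then show False using F(3)[OF X] p unfolding forms_path_def by blast
    qed
    \<comment> \<open>Leaving the set of all vertices outside layer 0 means to visit layer 0, and
      likewise for layer \<open>L\<close>.\<close>
    obtain i where i: "i \<le> L" "a i = 0" using leave[OF first] pV by (auto simp: a_def)
    obtain j where j: "j \<le> L" "a j = L" using leave[OF last] pV by (auto simp: a_def)
    from unit_steps_end_to_end[of L a, OF step i j]
    show "\<exists>c. (\<forall>s\<le>L. c s \<in> set V \<and> lay (c s) = s) \<and> (\<forall>X\<in>set Ws. \<exists>s\<le>L. c s \<notin> set X)"
    proof
      assume "\<forall>s\<le>L. a s = s"
      then show ?thesis using pV leave by (intro exI[of _ "\<lambda>s. V ! (p ! s)"]) (auto simp: a_def)
    next
      \<comment> \<open>The path runs from the last layer to the first, so it is read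
        backwards.\<close>
      assume "\<forall>s\<le>L. a (L - s) = s"
      moreover have "\<exists>s\<le>L. V ! (p ! (L - s)) \<notin> set X" if "X \<in> set Ws" for X
        using leave[OF that] by (metis diff_diff_cancel diff_le_self)
      ultimately show ?thesis using pV by (intro exI[of _ "\<lambda>s. V ! (p ! (L - s))"]) (auto simp: a_def)
    qed
  next
    assume "\<exists>c. (\<forall>s\<le>L. c s \<in> set V \<and> lay (c s) = s) \<and> (\<forall>X\<in>set Ws. \<exists>s\<le>L. c s \<notin> set X)"
    then obtain c where c: "\<And>s. s \<le> L \<Longrightarrow> c s \<in> set V" "\<And>s. s \<le> L \<Longrightarrow> lay (c s) = s"
      "\<And>X. X \<in> set Ws \<Longrightarrow> \<exists>s\<le>L. c s \<notin> set X" by blast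
    define p where "p = map (\<lambda>s. idn (c s)) [0..<Suc L]"
    have len: "length p = Suc L" by (simp add: p_def)
    have nth: "p ! s = idn (c s)" if "s \<le> L" for s using that by (simp add: p_def del: upt_Suc)
    have Vp: "V ! (p ! s) = c s" if "s \<le> L" for s using nth[OF that] nth_idn c(1) that by simp
    have "inj_on (\<lambda>s. idn (c s)) {0..<Suc L}"
      by (rule inj_onI) (metis atLeastLessThan_iff c(1,2) less_Suc_eq_le nth_idn)
    then have dp: "distinct p" by (simp add: p_def distinct_map del: upt_Suc)
    have sp: "set p \<subseteq> {..<?n}" using idn_less c(1) by (auto simp: p_def less_Suc_eq_le simp del: upt_Suc)
    have pn: "p ! i < ?n" if "i \<le> L" for i using nth[OF that] c(1)[OF that] idn_less by simp
    have pne: "p ! i \<noteq> p ! Suc i" if "Suc i \<le> L" for i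
      using dp len that by (simp add: nth_eq_iff_index_eq)
    have sub: "path_edges p \<subseteq> ?E V"
    proof
      fix e assume "e \<in> path_edges p"
      then obtain i where i: "e = {p ! i, p ! Suc i}" "Suc i \<le> L"
        unfolding path_edges_def using len by auto
      then show "e \<in> ?E V"
        using E[of V "p ! i" "p ! Suc i"] pn[of i] pn[of "Suc i"] Vp[of i] Vp[of "Suc i"] c(1)[of i] c(1)[of "Suc i"] c(2)[of i] c(2)[of "Suc i"]
        by auto
    qed
    have pos: "forms_path {..<?n} (?E V) (path_edges p)"
      unfolding forms_path_def using sub dp sp len by (intro conjI exI[of _ p]) auto
    have neg: "\<not> forms_path {..<?n} (?E X) (path_edges p)" if X: "X \<in> set Ws" for X
    proof
      assume "forms_path {..<?n} (?E X) (path_edges p)"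
      then have sW: "path_edges p \<subseteq> ?E X" unfolding forms_path_def by blast
      obtain s where s: "s \<le> L" "c s \<notin> set X" using c(3)[OF X] by blast
      \<comment> \<open>The edge that starts at the vertex in layer \<open>s\<close>, or the
        preceding edge if \<open>s\<close> is the last layer.\<close>
      define i where "i = (if s = L then s - 1 else s)"
      have i: "Suc i \<le> L" "s = i \<or> s = Suc i" using s L by (auto simp: i_def)
      then have "{p ! i, p ! Suc i} \<in> ?E X" using sW len unfolding path_edges_def by (auto simp: less_eq_Suc_le)
      then have "V ! (p ! i) \<in> set X \<and> V ! (p ! Suc i) \<in> set X"
        using E[of X "p ! i" "p ! Suc i"] Ws[OF X] pn[of i] pn[of "Suc i"] i by auto
      then show False using s i Vp[of i] Vp[of "Suc i"] by auto
    qed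
    have "path_edges p \<subseteq> {e. e \<subseteq> {..<?n} \<and> card e = 2}"
      using pn pne len by (auto simp: path_edges_def less_Suc_eq_le)
    moreover have "card (path_edges p) = L" using card_path_edges[OF dp] len by simp
    ultimately show "\<exists>F. cc_solution (layered_instance idn lay V Ws L) F"
      using pos neg by (intro exI[of _ "path_edges p"]) (auto simp: layered_instance_def path_consistent_def)
  qed
qed

section \<open>Circuits of bounded weft and depth\<close>

text \<open>A formula of level \<open>l\<close> is a nested list of depth \<open>l\<close>; lists at odd levels are conjunctions and
  lists at even levels disjunctions.  A literal is its sign paired with the index of an input gate.\<close>

primrec hold :: "nat set \<Rightarrow> nat \<Rightarrow> val \<Rightarrow> bool" where
  "hold A 0 v \<longleftrightarrow> (num (tl_val v) \<in> A) = (hd_val v \<noteq> Atom)"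
| "hold A (Suc l) v \<longleftrightarrow>
     (if odd (Suc l) then \<forall>x\<in>set (elems v). hold A l x else \<exists>x\<in>set (elems v). hold A l x)"

text \<open>Only the innermost lists, the terms, are limited by \<open>m\<close>, because a term has
  to be witnessed by a single vertex. The lengths of the other lists are controlled by the running
  time alone.\<close>

primrec bounded_formula :: "nat \<Rightarrow> nat \<Rightarrow> nat \<Rightarrow> val \<Rightarrow> bool" where
  "bounded_formula m n 0 v \<longleftrightarrow> (\<exists>i<n. tl_val v = nat_val i)"
| "bounded_formula m n (Suc l) v \<longleftrightarrow>
     (l = 0 \<longrightarrow> length (elems v) \<le> m) \<and> (\<forall>x\<in>set (elems v). bounded_formula m n l x)"

text \<open>A singleton list is a conjunction and a disjunction alike, so a literal can be lifted to
  any level.\<close>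

primrec wrap :: "nat \<Rightarrow> val \<Rightarrow> val" where
  "wrap 0 v = v"
| "wrap (Suc l) v = Cell (wrap l v) Atom"

text \<open>The distributive law for the two outermost levels.\<close>

definition vprod :: "val \<Rightarrow> val \<Rightarrow> val" where
  "vprod a b = vbind a (\<lambda>x. vmap (vappend x) b)"

text \<open>A gate whose connective is that of the outermost list at level \<open>l\<close> concatenates the formulas
  of its predecessors.  For the other connective a small gate multiplies out, while a large gate goes
  down by one level; hence the number of levels needed is governed by the weft.\<close>

primrec gate_formula :: "nat \<Rightarrow> nat \<Rightarrow> bool \<Rightarrow> val \<Rightarrow> val \<Rightarrow> val" where
  "gate_formula 0 l b C i = wrap l (Cell (bool_val b) i)"
| "gate_formula (Suc d) l b C i =
     (let g = vnth C i; js = tl_val g in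
      if hd_val g = Atom then wrap l (Cell (bool_val b) i)
      else if hd_val g = nat_val 1 then gate_formula d l (\<not> b) C js
      else if (hd_val g = nat_val 2) = (b = odd l) then vbind js (gate_formula d l b C)
      else if tl_val (tl_val js) \<noteq> Atom then Cell (vbind js (gate_formula d (l - 1) b C)) Atom
      else if tl_val js = Atom then gate_formula d l b C (hd_val js)
      else vprod (gate_formula d l b C (hd_val js)) (gate_formula d l b C (hd_val (tl_val js))))"

lemma polytime_iff:
  "polytime (\<lambda>x. bool_val (P x)) \<Longrightarrow> polytime (\<lambda>x. bool_val (Q x)) \<Longrightarrow> polytime (\<lambda>x. bool_val (P x = Q x))"
  using polytime_eq[of "\<lambda>x. bool_val (P x)" "\<lambda>x. bool_val (Q x)"] by simp

lemma polytime_vprod: "polytime f \<Longrightarrow> polytime g \<Longrightarrow> polytime (\<lambda>x. vprod (f x) (g x))"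
  unfolding vprod_def by (rule polytime2) (intro polytime_intros)

lemma polytime_wrap: "polytime f \<Longrightarrow> polytime (\<lambda>x. wrap l (f x))"
  by (induction l) (auto intro: polytime_intros)

text \<open>The recursion is on \<open>d\<close>, a constant of the reduction, so the degree of the
  polynomial may grow with every step.\<close>

lemma polytime_gate_formula: "polytime f \<Longrightarrow> polytime g \<Longrightarrow> polytime (\<lambda>x. gate_formula d l b (f x) (g x))"
proof (induction d arbitrary: l b f g)
  case 0
  then show ?case by (auto intro!: polytime_wrap polytime_intros)
next
  case (Suc d)
  show ?case
    by (rule polytime2[OF _ Suc.prems], unfold gate_formula.simps Let_def)
      (intro polytime_intros polytime_wrap polytime_iff polytime_vprod Suc.IH)
qed

lemma hold_wrap [simp]: "hold A l (wrap l v) = hold A 0 v"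
  by (induction l) auto

lemma bounded_formula_wrap [simp]: "0 < m \<Longrightarrow> bounded_formula m n l (wrap l v) = bounded_formula m n 0 v"
  by (induction l) auto

lemma hold_vbind:
  "hold A (Suc l) (vbind v f) \<longleftrightarrow>
    (if odd (Suc l) then \<forall>j\<in>set (elems v). hold A (Suc l) (f j) else \<exists>j\<in>set (elems v). hold A (Suc l) (f j))"
  by auto

lemma hold_singleton: "hold A (Suc l) (Cell x Atom) = hold A l x"
  by simp

lemma hold_vprod:
  "hold A (Suc (Suc l)) (vprod x y) \<longleftrightarrow>
    (if odd (Suc (Suc l)) then hold A (Suc (Suc l)) x \<or> hold A (Suc (Suc l)) y
     else hold A (Suc (Suc l)) x \<and> hold A (Suc (Suc l)) y)"
  by (auto simp: vprod_def) blast+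

lemma bounded_formula_mono: "bounded_formula m n l v \<Longrightarrow> m \<le> m' \<Longrightarrow> bounded_formula m' n l v"
  by (induction l arbitrary: v) auto

lemma bounded_formula_vbind:
  "0 < l \<Longrightarrow> (\<And>j. j \<in> set (elems v) \<Longrightarrow> bounded_formula m n (Suc l) (f j)) \<Longrightarrow> bounded_formula m n (Suc l) (vbind v f)"
  by auto

text \<open>At level 2 the merged lists are terms, whose lengths add up. At higher levels the merged
  lists are not terms, and the terms inside them are unchanged.\<close>

lemma bounded_formula_vprod:
  assumes "bounded_formula m n (Suc (Suc l)) x" "bounded_formula m n (Suc (Suc l)) y"
  shows "bounded_formula (2 * m) n (Suc (Suc l)) (vprod x y)"
  using assms by (fastforce simp: vprod_def intro: bounded_formula_mono)

text \<open>Bounds on depth and weft of the part of the circuit below gate \<open>i\<close>, in a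
  recursive form that matches \<open>gate_formula\<close>.\<close>

primrec shallow :: "circuit \<Rightarrow> nat \<Rightarrow> nat \<Rightarrow> nat \<Rightarrow> bool" where
  "shallow C 0 w i \<longleftrightarrow> C ! i = Input"
| "shallow C (Suc d) w i \<longleftrightarrow> C ! i = Input \<or>
     (if large (C ! i) then 0 < w \<and> (\<forall>j\<in>set (preds (C ! i)). shallow C d (w - 1) j)
      else \<forall>j\<in>set (preds (C ! i)). shallow C d w j)"

definition path_to :: "circuit \<Rightarrow> nat \<Rightarrow> nat list \<Rightarrow> bool" where
  "path_to C i p \<longleftrightarrow> p \<noteq> [] \<and> set p \<subseteq> {..<length C} \<and> hd p \<in> input_gates C \<and> last p = i \<and>
     (\<forall>i. Suc i < length p \<longrightarrow> p ! i \<in> set (preds (C ! (p ! Suc i))))"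

lemma path_to_snoc:
  assumes "path_to C j p" "j \<in> set (preds (C ! i))" "i < length C"
  shows "path_to C i (p @ [i])"
proof -
  have "(p @ [i]) ! k \<in> set (preds (C ! ((p @ [i]) ! Suc k)))" if k: "Suc k < length (p @ [i])" for k
  proof (cases "Suc k < length p")
    case True
    then show ?thesis using assms(1) by (simp add: path_to_def nth_append)
  next
    case False
    then have "k = length p - 1" "p \<noteq> []" using k assms(1) by (auto simp: path_to_def)
    then show ?thesis using assms(1,2) by (simp add: path_to_def nth_append last_conv_nth)
  qed
  then show ?thesis using assms(1,3) by (auto simp: path_to_def)
qed

lemma ex_path_to:
  assumes "circuit C" shows "i < length C \<Longrightarrow> \<exists>p. path_to C i p"
proof (induction i rule: less_induct)
  case (less i)
  show ?case
  proof (cases "C ! i = Input")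
    case True
    then show ?thesis using less.prems by (intro exI[of _ "[i]"]) (simp add: path_to_def input_gates_def)
  next
    case False
    then obtain j where j: "j \<in> set (preds (C ! i))" using assms less.prems unfolding circuit_def
      by (meson last_in_set)
    then have "j < i" using assms less.prems unfolding circuit_def by blast
    with less j path_to_snoc show ?thesis by (meson order_less_trans)
  qed
qed

text \<open>Every gate other than an input has a predecessor, so a descent that violates a bound can
  be continued to an input gate and yields a path of the kind that
  \<open>weft_depth_circuits\<close> restricts.\<close>

lemma not_shallow_path:
  assumes C: "circuit C"
  shows "i < length C \<Longrightarrow> \<not> shallow C d w i \<Longrightarrow>
    \<exists>p. path_to C i p \<and> (w < length (filter (\<lambda>i. large (C ! i)) p) \<or> d < length p - 1)"
proof (induction d arbitrary: w i)
  case 0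
  then have "C ! i \<noteq> Input" by simp
  then obtain j where j: "j \<in> set (preds (C ! i))" using C 0 unfolding circuit_def by (meson last_in_set)
  then have "j < i" using C 0 unfolding circuit_def by blast
  then obtain p where p: "path_to C j p" using ex_path_to[OF C] 0 by (meson order_less_trans)
  then have "p \<noteq> []" by (simp add: path_to_def)
  then show ?case using path_to_snoc[OF p j 0(1)] by (intro exI[of _ "p @ [i]"]) auto
next
  case (Suc d)
  have ni: "C ! i \<noteq> Input" using Suc.prems by simp
  have less: "j < length C" if "j \<in> set (preds (C ! i))" for j
    using C Suc.prems(1) that unfolding circuit_def by (meson order_less_trans)
  show ?case
  proof (cases "large (C ! i) \<and> w = 0")
    case True
    obtain j where j: "j \<in> set (preds (C ! i))" using C Suc.prems ni unfolding circuit_def by (meson last_in_set)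
    obtain p where p: "path_to C j p" using ex_path_to[OF C less[OF j]] by blast
    show ?thesis using path_to_snoc[OF p j Suc.prems(1)] True by (intro exI[of _ "p @ [i]"]) auto
  next
    case False
    define w' where "w' = (if large (C ! i) then w - 1 else w)"
    obtain j where j: "j \<in> set (preds (C ! i))" "\<not> shallow C d w' j"
      using Suc.prems False by (auto simp: w'_def split: if_splits)
    obtain p where p: "path_to C j p" "w' < length (filter (\<lambda>i. large (C ! i)) p) \<or> d < length p - 1"
      using Suc.IH[OF less[OF j(1)] j(2)] by blast
    then show ?thesis using path_to_snoc[OF p(1) j(1) Suc.prems(1)] False
      by (intro exI[of _ "p @ [i]"]) (auto simp: w'_def split: if_splits)
  qed
qed

lemma shallow_output:
  assumes "C \<in> weft_depth_circuits w d" shows "shallow C d w (length C - 1)"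
proof (rule ccontr)
  assume *: "\<not> ?thesis"
  have C: "circuit C" using assms by (simp add: weft_depth_circuits_def)
  then have "length C - 1 < length C" by (simp add: circuit_def)
  from not_shallow_path[OF C this *] obtain p where
    "path_to C (length C - 1) p" "w < length (filter (\<lambda>i. large (C ! i)) p) \<or> d < length p - 1" by blast
  moreover from this(1) have "circuit_path C p" unfolding path_to_def circuit_path_def .
  ultimately show False using assms by (auto simp: weft_depth_circuits_def)
qed

definition circuit_val :: "circuit \<Rightarrow> val" where
  "circuit_val C = list_val (map gate_code C)"

lemma vnth_circuit_val: "i < length C \<Longrightarrow> vnth (circuit_val C) (nat_val i) = gate_code (C ! i)"
  by (simp add: circuit_val_def vnth_eq)

text \<open>\<open>b\<close> is the truth value asked for: a negation flips it, so negations end up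
  in the literals. Products need two levels, and a large gate of the other connective uses up one
  more, hence level \<open>w + 2\<close>. One product per unit of depth at most doubles the length
  of the terms, hence \<open>2 ^ d\<close>.\<close>

lemma gate_formula_correct:
  assumes C: "circuit C"
  shows "i < length C \<Longrightarrow> shallow C d w i \<Longrightarrow>
    (hold A (w + 2) (gate_formula d (w + 2) b (circuit_val C) (nat_val i)) \<longleftrightarrow> gate_value C A i = b) \<and>
    bounded_formula (2 ^ d) (length C) (w + 2) (gate_formula d (w + 2) b (circuit_val C) (nat_val i))"
proof (induction d arbitrary: i w b)
  case 0
  then have "gate_value C A i \<longleftrightarrow> i \<in> A" by (simp add: gate_value.simps[of C A i])
  then show ?case using 0 by (auto simp: bool_val_def)
next
  case (Suc d)
  let ?F = "\<lambda>l b v. gate_formula d l b (circuit_val C) v"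
  let ?B = "bounded_formula (2 ^ d) (length C)"
  have less: "j < i" "j < length C" if "j \<in> set (preds (C ! i))" for j
    using C Suc.prems(1) that unfolding circuit_def by (meson order_less_trans)+
  have mono: "bounded_formula (2 ^ Suc d) (length C) l v" if "?B l v" for l v
    using bounded_formula_mono[OF that] by simp
  have lev: "w + 2 = Suc (Suc w)" by simp
  show ?case
  proof (cases "C ! i = Input")
    case True
    then have "gate_value C A i \<longleftrightarrow> i \<in> A" by (simp add: gate_value.simps[of C A i])
    then show ?thesis using True Suc.prems by (auto simp: vnth_circuit_val bool_val_def)
  next
    case ni: False
    show ?thesis
    proof (cases "\<exists>j. C ! i = NotG j")
      case True
      then obtain j where g: "C ! i = NotG j" by blast
      then have j: "j < i" "j < length C" using less[of j] by auto
      have "shallow C d w j" using Suc.prems(2) g by (simp add: large_def)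
      moreover have "gate_value C A i \<longleftrightarrow> \<not> gate_value C A j" using g j by (simp add: gate_value.simps[of C A i])
      ultimately show ?thesis using Suc.IH[OF j(2), of w "\<not> b"] Suc.prems(1) g mono
        by (auto simp: vnth_circuit_val Let_def nat_val_Suc)
    next
      case False
      then obtain js where js: "C ! i = AndG js \<or> C ! i = OrG js" using ni by (cases "C ! i") auto
      define isand where "isand \<longleftrightarrow> C ! i = AndG js"
      \<comment> \<open>The connective of the gate, dualised if \<open>b\<close> is false, is that
        of the outermost list.\<close>
      define dom where "dom \<longleftrightarrow> isand = (b = odd (w + 2))"
      have js_ne: "js \<noteq> []" using C Suc.prems(1) js unfolding circuit_def by auto
      have jl: "j < i" "j < length C" if "j \<in> set js" for j using less[of j] that js by auto
      have pj: "preds (C ! i) = js" using js by auto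
      have val: "gate_value C A i = b \<longleftrightarrow>
         (if isand = b then \<forall>j\<in>set js. gate_value C A j = b else \<exists>j\<in>set js. gate_value C A j = b)"
      proof -
        have "gate_value C A i \<longleftrightarrow> (if isand then \<forall>j\<in>set js. gate_value C A j else \<exists>j\<in>set js. gate_value C A j)"
          using js jl by (auto simp: gate_value.simps[of C A i] isand_def)
        then show ?thesis by (cases b; cases isand) auto
      qed
      have code: "gate_code (C ! i) = Cell (nat_val (if isand then 2 else 3)) (list_val (map nat_val js))"
        using js by (auto simp: isand_def)
      have F: "gate_formula (Suc d) (w + 2) b (circuit_val C) (nat_val i) =
        (if dom then vbind (list_val (map nat_val js)) (?F (w + 2) b)
         else if length js > 2 then Cell (vbind (list_val (map nat_val js)) (?F (Suc w) b)) Atom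
         else if length js = 1 then ?F (w + 2) b (nat_val (js ! 0))
         else vprod (?F (w + 2) b (nat_val (js ! 0))) (?F (w + 2) b (nat_val (js ! 1))))"
        using js_ne unfolding gate_formula.simps Let_def vnth_circuit_val[OF Suc.prems(1)] code dom_def
        by (cases js; cases "tl js"; cases "tl (tl js)") (auto simp: eval_nat_numeral nat_val_Suc)
      show ?thesis
      proof (cases "length js > 2")
        case True
        then have lg: "large (C ! i)" by (simp add: large_def pj)
        then obtain w' where w: "w = Suc w'" using Suc.prems(2) ni by (cases w) auto
        have sh: "shallow C d w' j" if "j \<in> set js" for j using Suc.prems(2) ni lg w that pj by simp
        \<comment> \<open>With the matching connective a large gate keeps its level, so the weft
          bound \<open>w'\<close> of its predecessors is weakened to \<open>w\<close>.\<close>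
        have sh': "shallow C d w j" if "j \<in> set js" for j
        proof -
          have "shallow C d u k \<Longrightarrow> shallow C d (Suc u) k" for d u k
            by (induction d arbitrary: u k) (auto split: if_splits simp: gr0_conv_Suc)
          then show ?thesis using sh[OF that] w by simp
        qed
        show ?thesis
        proof (cases dom)
          case True
          have IH: "hold A (w + 2) (?F (w + 2) b (nat_val j)) \<longleftrightarrow> gate_value C A j = b"
            "?B (w + 2) (?F (w + 2) b (nat_val j))" if "j \<in> set js" for j
            using Suc.IH[OF jl(2) sh', of j b] that by auto
          have "hold A (w + 2) (gate_formula (Suc d) (w + 2) b (circuit_val C) (nat_val i)) \<longleftrightarrow>
            (if odd (w + 2) then \<forall>j\<in>set js. gate_value C A j = b else \<exists>j\<in>set js. gate_value C A j = b)"
            unfolding F using True IH by (simp only: lev hold_vbind if_True) (simp del: hold.simps)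
          moreover have "?B (w + 2) (gate_formula (Suc d) (w + 2) b (circuit_val C) (nat_val i))"
            unfolding F using True IH unfolding lev
            by (simp only: if_True, intro bounded_formula_vbind) auto
          ultimately show ?thesis using val True mono unfolding dom_def by auto
        next
          case False
          \<comment> \<open>One level down the connectives are exchanged and the list matches the
            gate; \<open>Suc w\<close> is \<open>w' + 2\<close>, the level belonging to the smaller
            weft bound.\<close>
          have IH: "hold A (Suc w) (?F (Suc w) b (nat_val j)) \<longleftrightarrow> gate_value C A j = b"
            "?B (Suc w) (?F (Suc w) b (nat_val j))" if "j \<in> set js" for j
            using Suc.IH[OF jl(2) sh, of j b] that w by auto
          have "hold A (w + 2) (gate_formula (Suc d) (w + 2) b (circuit_val C) (nat_val i)) \<longleftrightarrow>
            (if odd (Suc w) then \<forall>j\<in>set js. gate_value C A j = b else \<exists>j\<in>set js. gate_value C A j = b)"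
            unfolding F using False True IH by (simp only: lev hold_vbind hold_singleton if_True if_False) (simp del: hold.simps)
          moreover have "?B (Suc w) (vbind (list_val (map nat_val js)) (?F (Suc w) b))"
            by (rule bounded_formula_vbind) (use IH w in auto)
          then have "?B (w + 2) (gate_formula (Suc d) (w + 2) b (circuit_val C) (nat_val i))"
            unfolding F using False True by (simp del: bounded_formula.simps(2) add: bounded_formula.simps(2)[of _ _ "Suc w"])
          ultimately show ?thesis using val False mono unfolding dom_def by auto
        qed
      next
        case small: False
        then have sm: "\<not> large (C ! i)" by (simp add: large_def pj)
        have sh: "shallow C d w j" if "j \<in> set js" for j using Suc.prems(2) ni sm that pj by simp
        have IH: "hold A (w + 2) (?F (w + 2) b (nat_val j)) \<longleftrightarrow> gate_value C A j = b"
          "?B (w + 2) (?F (w + 2) b (nat_val j))" if "j \<in> set js" for j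
          using Suc.IH[OF jl(2) sh, of j b] that by auto
        show ?thesis
        proof (cases dom)
          case True
          have "hold A (w + 2) (gate_formula (Suc d) (w + 2) b (circuit_val C) (nat_val i)) \<longleftrightarrow>
            (if odd (w + 2) then \<forall>j\<in>set js. gate_value C A j = b else \<exists>j\<in>set js. gate_value C A j = b)"
            unfolding F using True IH by (simp only: lev hold_vbind if_True) (simp del: hold.simps)
          moreover have "?B (w + 2) (gate_formula (Suc d) (w + 2) b (circuit_val C) (nat_val i))"
            unfolding F using True IH unfolding lev
            by (simp only: if_True, intro bounded_formula_vbind) auto
          ultimately show ?thesis using val True mono unfolding dom_def by auto
        next
          case nd: False
          show ?thesis
          proof (cases "length js = 1")
            case True
            then obtain j where j: "js = [j]" by (auto simp: length_Suc_conv)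
            then have "j \<in> set js" by simp
            with IH[of j] mono[OF IH(2)[of j]] show ?thesis unfolding F using nd val j
              by (simp del: hold.simps bounded_formula.simps)
          next
            case False
            then obtain j k where jk: "js = [j, k]" using small js_ne
              by (cases js; cases "tl js"; cases "tl (tl js)") auto
            have 1: "gate_formula (Suc d) (w + 2) b (circuit_val C) (nat_val i) =
               vprod (?F (w + 2) b (nat_val j)) (?F (w + 2) b (nat_val k))"
              unfolding F using nd jk by simp
            have "hold A (w + 2) (gate_formula (Suc d) (w + 2) b (circuit_val C) (nat_val i)) \<longleftrightarrow>
              (if odd (w + 2) then gate_value C A j = b \<or> gate_value C A k = b else gate_value C A j = b \<and> gate_value C A k = b)"
              unfolding 1 using IH[of j] IH[of k] jk by (simp only: lev hold_vprod list.set insert_iff) (simp del: hold.simps)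
            moreover have "bounded_formula (2 ^ Suc d) (length C) (w + 2) (gate_formula (Suc d) (w + 2) b (circuit_val C) (nat_val i))"
              unfolding 1 unfolding power_Suc lev
              by (rule bounded_formula_vprod) (use IH(2)[of j] IH(2)[of k] jk in \<open>simp_all del: bounded_formula.simps\<close>)
            ultimately show ?thesis using val nd unfolding dom_def jk by auto
          qed
        qed
      qed
    qed
  qed
qed

section \<open>Choosing an assignment by its gaps\<close>

text \<open>A gap \<open>(j, u, w)\<close> says that the \<open>j\<close>-th and the next true variable are \<open>u\<close> and \<open>w\<close>.
  Gate \<open>i\<close> is represented by the point \<open>i + 1\<close>; the points \<open>0\<close> and \<open>n + 1\<close> delimit the first and the last
  gap.  Both signs of a literal are then witnessed by a single gap, and a term of at most \<open>m\<close> literals by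
  \<open>m\<close> gaps.\<close>

definition gap :: "(nat \<Rightarrow> nat) \<Rightarrow> nat \<Rightarrow> val" where
  "gap U j = Cell (nat_val j) (Cell (nat_val (U j)) (nat_val (U (Suc j))))"

text \<open>A variable is true if its point is the left end of a gap and false if its point lies
  strictly inside one. \<open>Cell Atom\<close> is the successor on numerals, which turns the index
  of a gate into its point.\<close>

definition gap_witness :: "val \<Rightarrow> val \<Rightarrow> bool" where
  "gap_witness g l \<longleftrightarrow>
     (if hd_val l = Atom
      then num (hd_val (tl_val g)) < num (Cell Atom (tl_val l)) \<and> num (Cell Atom (tl_val l)) < num (tl_val (tl_val g))
      else hd_val (tl_val g) = Cell Atom (tl_val l))"

text \<open>If no clash occurs among gaps at all positions \<open>0\<close> to \<open>k\<close>,
  each also compared with itself, they fit together into one increasing chain from \<open>0\<close>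
  to \<open>hi\<close>.\<close>

definition gap_clash :: "val \<Rightarrow> val \<Rightarrow> val \<Rightarrow> val \<Rightarrow> bool" where
  "gap_clash k hi a b \<longleftrightarrow>
     \<not> num (hd_val (tl_val a)) < num (tl_val (tl_val a)) \<or>
     hd_val a = Atom \<and> hd_val (tl_val a) \<noteq> Atom \<or>
     hd_val a = k \<and> tl_val (tl_val a) \<noteq> hi \<or>
     hd_val a = hd_val b \<and> tl_val a \<noteq> tl_val b \<or>
     hd_val b = Cell Atom (hd_val a) \<and> tl_val (tl_val a) \<noteq> hd_val (tl_val b)"

definition vlen :: "val \<Rightarrow> val" where "vlen l = vmap (\<lambda>_. Atom) l"

text \<open>The tag of an input gate is the numeral 0, that is, \<open>Atom\<close>. Apart from the
  two delimiters only input gates become points, so a chain cannot choose any other gate.\<close>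

definition points :: "val \<Rightarrow> val" where
  "points C = Cell Atom (vappend
     (vbind (venum C) (\<lambda>q. if hd_val (tl_val q) = Atom then Cell (Cell Atom (hd_val q)) Atom else Atom))
     (Cell (Cell Atom (vlen C)) Atom))"

text \<open>The positions \<open>0\<close> to \<open>k\<close>, obtained as the indices in an
  enumeration of the numeral \<open>k + 1\<close>.\<close>

definition slots :: "val \<Rightarrow> val" where "slots k = vmap hd_val (venum (Cell Atom k))"

primrec tuples :: "nat \<Rightarrow> val \<Rightarrow> val" where
  "tuples 0 S = Cell Atom Atom"
| "tuples (Suc m) S = vbind S (\<lambda>j. vmap (Cell j) (tuples m S))"

primrec gap_lists :: "nat \<Rightarrow> val \<Rightarrow> val \<Rightarrow> val" where
  "gap_lists 0 X js = Cell Atom Atom"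
| "gap_lists (Suc m) X js = (if js = Atom then Cell Atom Atom else
     vbind X (\<lambda>u. vbind X (\<lambda>w. vmap (Cell (Cell (hd_val js) (Cell u w))) (gap_lists m X (tl_val js)))))"

text \<open>The empty tuple is an extra layer which ensures that there are at least two layers.\<close>

definition layers :: "nat \<Rightarrow> val \<Rightarrow> val" where
  "layers m k = vappend (tuples m (slots k)) (Cell Atom Atom)"

text \<open>The outer enumeration numbers the vertices by their positions, as the vertex set
  \<open>{..<n}\<close> of an instance requires. An entry consists of identifier, layer and
  gaps.\<close>

definition vertices :: "nat \<Rightarrow> val \<Rightarrow> val \<Rightarrow> val" where
  "vertices m X T = venum (vbind (venum T) (\<lambda>q. vmap (Cell (hd_val q)) (gap_lists m X (tl_val q))))"

definition vertex_id :: "val \<Rightarrow> nat" where "vertex_id y = num (hd_val y)"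
definition vertex_layer :: "val \<Rightarrow> nat" where "vertex_layer y = num (hd_val (tl_val y))"
definition vertex_gaps :: "val \<Rightarrow> val" where "vertex_gaps y = tl_val (tl_val y)"

definition vertex_satisfies :: "val \<Rightarrow> val \<Rightarrow> bool" where
  "vertex_satisfies D y \<longleftrightarrow> (\<exists>t\<in>set (elems D). \<forall>l\<in>set (elems t). \<exists>g\<in>set (elems (vertex_gaps y)). gap_witness g l)"

text \<open>The sets that the path has to leave. The set for a clashing pair \<open>t\<close>,
  \<open>t'\<close> is everything except their competitors in their own layers; as each layer is met
  once, a path stays inside it exactly if it uses both \<open>t\<close> and
  \<open>t'\<close>.\<close>

definition avoided :: "val \<Rightarrow> val \<Rightarrow> val \<Rightarrow> val \<Rightarrow> val \<Rightarrow> val" where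
  "avoided V k hi L \<Phi> =
     Cell (vfilter (\<lambda>y. hd_val (tl_val y) \<noteq> Atom) V) (Cell (vfilter (\<lambda>y. hd_val (tl_val y) \<noteq> L) V)
       (vappend (vmap (\<lambda>D. vfilter (\<lambda>y. \<not> vertex_satisfies D y) V) \<Phi>)
          (vbind V (\<lambda>t. vbind V (\<lambda>t'.
             if \<exists>a\<in>set (elems (vertex_gaps t)). \<exists>b\<in>set (elems (vertex_gaps t')). gap_clash k hi a b
             then Cell (vfilter (\<lambda>y. (hd_val (tl_val y) = hd_val (tl_val t) \<longrightarrow> y = t) \<and>
                                     (hd_val (tl_val y) = hd_val (tl_val t') \<longrightarrow> y = t')) V) Atom
             else Atom)))))"

lemma elems_venum: "elems (venum l) = map (\<lambda>i. Cell (nat_val i) (elems l ! i)) [0..<num l]"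
  by (rule nth_equalityI) (auto simp: num_def nth_enumerate_eq)

lemma vlen_eq: "vlen l = nat_val (num l)"
  by (simp add: vlen_def vmap_def nat_val_def num_def map_replicate_const)

lemma set_points:
  "set (elems (points (circuit_val C))) = {nat_val 0, nat_val (Suc (length C))} \<union> (\<lambda>i. nat_val (Suc i)) ` input_gates C"
proof -
  have "hd_val (gate_code g) = Atom \<longleftrightarrow> g = Input" for g
    by (cases g) (auto simp: eval_nat_numeral nat_val_Suc)
  moreover have "set (elems (points (circuit_val C))) = {nat_val 0, nat_val (Suc (length C))} \<union>
     {nat_val (Suc i) | i. i < length C \<and> hd_val (gate_code (C ! i)) = Atom}"
    by (auto simp: points_def vlen_eq num_def circuit_val_def elems_venum nat_val_Suc
        split: if_splits simp del: elems_ops(6))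
  ultimately show ?thesis unfolding input_gates_def by auto
qed

lemma elems_slots: "elems (slots (nat_val k)) = map nat_val [0..<Suc k]"
  using num_nat_val[of "Suc k"]
  by (simp add: slots_def elems_venum nat_val_Suc comp_def del: elems_ops(6) upt_Suc)

lemma set_tuples: "set (elems (tuples m S)) = {t. num t = m \<and> set (elems t) \<subseteq> set (elems S)}"
proof (induction m)
  case 0
  then show ?case by (auto simp: num_def)
next
  case (Suc m)
  show ?case
  proof (intro set_eqI iffI)
    fix t assume "t \<in> set (elems (tuples (Suc m) S))"
    then show "t \<in> {t. num t = Suc m \<and> set (elems t) \<subseteq> set (elems S)}" using Suc by (auto simp: num_def)
  next
    fix t assume "t \<in> {t. num t = Suc m \<and> set (elems t) \<subseteq> set (elems S)}"
    then show "t \<in> set (elems (tuples (Suc m) S))" using Suc by (cases t) (auto simp: num_def)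
  qed
qed

lemma num_tuples: "num (tuples m S) = num S ^ m"
proof (induction m)
  case (Suc m)
  have "length (concat (map (\<lambda>j. map (f j) l) l')) = length l' * length l" for f :: "val \<Rightarrow> val \<Rightarrow> val" and l l'
    by (induction l') auto
  with Suc show ?case by (simp add: num_def)
qed (simp add: num_def)

lemma set_gap_lists:
  "num js \<le> m \<Longrightarrow> set (elems (gap_lists m X js)) = {r. map hd_val (elems r) = elems js \<and>
     (\<forall>g\<in>set (elems r). \<exists>u\<in>set (elems X). \<exists>w\<in>set (elems X). g = Cell (hd_val g) (Cell u w))}"
proof (induction m arbitrary: js)
  case 0
  then show ?case by (auto simp: num_def)
next
  case (Suc m)
  show ?case
  proof (cases js)
    case Atom
    then show ?thesis by auto
  next
    case (Cell j js')
    then have IH: "set (elems (gap_lists m X js')) = {r. map hd_val (elems r) = elems js' \<and>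
     (\<forall>g\<in>set (elems r). \<exists>u\<in>set (elems X). \<exists>w\<in>set (elems X). g = Cell (hd_val g) (Cell u w))}"
      using Suc by (simp add: num_def)
    show ?thesis
    proof (intro set_eqI iffI)
      fix r assume "r \<in> set (elems (gap_lists (Suc m) X js))"
      then show "r \<in> {r. map hd_val (elems r) = elems js \<and>
         (\<forall>g\<in>set (elems r). \<exists>u\<in>set (elems X). \<exists>w\<in>set (elems X). g = Cell (hd_val g) (Cell u w))}"
        using Cell IH by auto
    next
      fix r assume r: "r \<in> {r. map hd_val (elems r) = elems js \<and>
         (\<forall>g\<in>set (elems r). \<exists>u\<in>set (elems X). \<exists>w\<in>set (elems X). g = Cell (hd_val g) (Cell u w))}"
      then obtain g r' where r': "r = Cell g r'" using Cell by (cases r) auto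
      then obtain u w where "u \<in> set (elems X)" "w \<in> set (elems X)" "g = Cell j (Cell u w)"
        using r Cell by force
      moreover have "r' \<in> set (elems (gap_lists m X js'))" using r r' Cell IH by auto
      ultimately show "r \<in> set (elems (gap_lists (Suc m) X js))" using Cell r' by auto
    qed
  qed
qed

lemma vertices_cases:
  assumes "y \<in> set (elems (vertices m X T))"
  obtains i s r where "y = Cell (nat_val i) (Cell (nat_val s) r)" "s < num T"
    "r \<in> set (elems (gap_lists m X (elems T ! s)))"
proof -
  let ?l = "vbind (venum T) (\<lambda>q. vmap (Cell (hd_val q)) (gap_lists m X (tl_val q)))"
  obtain i where i: "i < num ?l" "y = Cell (nat_val i) (elems ?l ! i)"
    using assms unfolding vertices_def elems_venum by (auto simp del: elems_ops)
  have "elems ?l ! i \<in> set (elems ?l)" using i(1) by (simp add: num_def del: elems_ops)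
  then obtain s r where "elems ?l ! i = Cell (nat_val s) r" "s < num T"
    "r \<in> set (elems (gap_lists m X (elems T ! s)))"
    by (auto simp: elems_venum simp del: elems_ops(6))
  with i(2) that show thesis by simp
qed

lemma vertices_ex:
  assumes "s < num T" "r \<in> set (elems (gap_lists m X (elems T ! s)))"
  shows "\<exists>i. Cell (nat_val i) (Cell (nat_val s) r) \<in> set (elems (vertices m X T))"
proof -
  let ?l = "vbind (venum T) (\<lambda>q. vmap (Cell (hd_val q)) (gap_lists m X (tl_val q)))"
  have "Cell (nat_val s) (elems T ! s) \<in> set (elems (venum T))"
    using assms(1) by (simp add: elems_venum del: elems_ops(6))
  then have "Cell (nat_val s) r \<in> set (elems ?l)"
    using assms(2) by (force simp del: elems_ops(6))
  then obtain i where "i < num ?l" "elems ?l ! i = Cell (nat_val s) r"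
    by (auto simp: in_set_conv_nth num_def simp del: elems_ops)
  then have "Cell (nat_val i) (Cell (nat_val s) r) \<in> set (elems (venum ?l))"
    by (auto simp: elems_venum image_iff simp del: elems_ops)
  then show ?thesis unfolding vertices_def by blast
qed

lemma vertex_ids: "map vertex_id (elems (vertices m X T)) = [0..<num (vertices m X T)]"
proof -
  have "num (venum l) = num l" for l by (simp add: num_def)
  then show ?thesis unfolding vertices_def by (simp add: elems_venum vertex_id_def comp_def del: elems_ops)
qed

section \<open>Chains of gaps and the assignments they describe\<close>

locale gap_chain =
  fixes U :: "nat \<Rightarrow> nat" and k n :: nat
  assumes first: "U 0 = 0" and last: "U (Suc k) = Suc n" and less: "j \<le> k \<Longrightarrow> U j < U (Suc j)"
begin

lemma strict: "i < j \<Longrightarrow> j \<le> Suc k \<Longrightarrow> U i < U j"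
proof (induction j)
  case (Suc j)
  then show ?case using less[of j] by (cases "i = j") auto
qed simp

definition chosen :: "nat set" where
  "chosen = {i. \<exists>j\<in>{1..k}. U j = Suc i}"

lemma card_chosen: "card chosen = k"
proof -
  have pos: "0 < U j" if "j \<in> {1..k}" for j using strict[of 0 j] that first by simp
  have "chosen = (\<lambda>j. U j - 1) ` {1..k}"
    using pos by (force simp: chosen_def image_iff)
  moreover have "inj_on (\<lambda>j. U j - 1) {1..k}"
  proof (rule inj_onI)
    fix i j assume ij: "i \<in> {1..k}" "j \<in> {1..k}" "U i - 1 = U j - 1"
    then have "U i = U j" using pos[of i] pos[of j] by simp
    then show "i = j" using strict[of i j] strict[of j i] ij by (cases i j rule: linorder_cases) auto
  qed
  ultimately show ?thesis by (simp add: card_image)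
qed

text \<open>The point of a gate lies strictly between the delimiters, so it is either a point of the
  chain or strictly inside one of its gaps, and not both.\<close>

lemma gap_witness_iff:
  assumes l: "tl_val l = nat_val i" "i < n"
  shows "hold chosen 0 l \<longleftrightarrow> (\<exists>j\<le>k. gap_witness (gap U j) l)"
proof (cases "hd_val l = Atom")
  case False
  have "(\<exists>j\<le>k. U j = Suc i) \<longleftrightarrow> i \<in> chosen"
  proof
    assume "\<exists>j\<le>k. U j = Suc i"
    then obtain j where j: "j \<le> k" "U j = Suc i" by blast
    then have "j \<noteq> 0" using first by (metis Zero_not_Suc)
    with j show "i \<in> chosen" unfolding chosen_def by auto
  qed (auto simp: chosen_def)
  then show ?thesis using False l by (simp add: gap_witness_def gap_def nat_val_Suc[symmetric])
next
  case True
  have "(\<exists>j\<le>k. U j < Suc i \<and> Suc i < U (Suc j)) \<longleftrightarrow> i \<notin> chosen"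
  proof
    assume "\<exists>j\<le>k. U j < Suc i \<and> Suc i < U (Suc j)"
    then obtain j where j: "j \<le> k" "U j < Suc i" "Suc i < U (Suc j)" by blast
    show "i \<notin> chosen"
    proof
      assume "i \<in> chosen"
      then obtain j' where j': "j' \<le> k" "U j' = Suc i" unfolding chosen_def by auto
      have "j < j'" using strict[of j' j] j j' by (cases j j' rule: linorder_cases) auto
      moreover have "j' < Suc j" using strict[of "Suc j" j'] j j' by (cases "Suc j" j' rule: linorder_cases) auto
      ultimately show False by simp
    qed
  next
    assume i: "i \<notin> chosen"
    \<comment> \<open>The gap around \<open>Suc i\<close> starts at the last point of the chain
      below it.\<close>
    define j where "j = Max {j. j \<le> k \<and> U j < Suc i}"
    have fin: "finite {j. j \<le> k \<and> U j < Suc i}" by simp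
    have "0 \<in> {j. j \<le> k \<and> U j < Suc i}" using first by simp
    then have j: "j \<le> k" "U j < Suc i" using Max_in[OF fin] unfolding j_def by blast+
    have "Suc i < U (Suc j)"
    proof (cases "j = k")
      case True
      then show ?thesis using last l by simp
    next
      case False
      then have "\<not> U (Suc j) < Suc i"
        using Max_ge[OF fin, of "Suc j"] j unfolding j_def[symmetric] by auto
      moreover have "U (Suc j) \<noteq> Suc i" using i False j unfolding chosen_def by auto
      ultimately show ?thesis by simp
    qed
    with j show "\<exists>j\<le>k. U j < Suc i \<and> Suc i < U (Suc j)" by blast
  qed
  moreover have "gap_witness (gap U j) l \<longleftrightarrow> U j < Suc i \<and> Suc i < U (Suc j)" for j
    using True l by (simp add: gap_witness_def gap_def nat_val_Suc[symmetric])
  ultimately show ?thesis using True l by simp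
qed

text \<open>In a true term, one witnessing position per literal gives a tuple of length at most
  \<open>m\<close>, and the vertex in the layer of this tuple carries all the witnesses. Conversely,
  every gap at a vertex \<open>c s\<close> belongs to the chain, so the literals it witnesses are
  true.\<close>

lemma hold_dnf_iff:
  assumes D: "bounded_formula m n 2 D"
    and c: "\<And>s. s < num (layers m (nat_val k)) \<Longrightarrow>
      elems (vertex_gaps (c s)) = map (\<lambda>j. gap U (num j)) (elems (elems (layers m (nat_val k)) ! s))"
  shows "hold chosen 2 D \<longleftrightarrow> (\<exists>s<num (layers m (nat_val k)). vertex_satisfies D (c s))"
proof -
  let ?T = "layers m (nat_val k)"
  have hold2: "hold chosen 2 D \<longleftrightarrow> (\<exists>t\<in>set (elems D). \<forall>l\<in>set (elems t). hold chosen 0 l)"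
    by (simp only: numeral_2_eq_2 hold.simps(2)) simp
  have lit: "hold chosen 0 l \<longleftrightarrow> (\<exists>j\<le>k. gap_witness (gap U j) l)" if tl: "t \<in> set (elems D)" "l \<in> set (elems t)" for t l
  proof -
    obtain i where "i < n" "tl_val l = nat_val i" using D tl by (auto simp: numeral_2_eq_2)
    then show ?thesis using gap_witness_iff by blast
  qed
  have width: "length (elems t) \<le> m" if "t \<in> set (elems D)" for t
    using D that by (auto simp: numeral_2_eq_2)
  have slots: "set (elems (slots (nat_val k))) = nat_val ` {..k}"
    unfolding elems_slots by (auto simp: image_iff less_Suc_eq_le)
  show ?thesis
  proof
    assume "hold chosen 2 D"
    then obtain t where t: "t \<in> set (elems D)" "\<And>l. l \<in> set (elems t) \<Longrightarrow> \<exists>j\<le>k. gap_witness (gap U j) l"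
      unfolding hold2 using lit by blast
    then obtain f where f: "\<And>l. l \<in> set (elems t) \<Longrightarrow> f l \<le> k \<and> gap_witness (gap U (f l)) l" by metis
    \<comment> \<open>Short terms are padded with position 0, which is always a slot.\<close>
    define \<tau> where "\<tau> = list_val (map (\<lambda>l. nat_val (f l)) (elems t) @ replicate (m - length (elems t)) (nat_val 0))"
    have "\<tau> \<in> set (elems (tuples m (slots (nat_val k))))"
      unfolding set_tuples slots using width[OF t(1)] f
      by (auto simp: \<tau>_def num_def intro!: image_eqI[of Atom nat_val 0])
    then have "\<tau> \<in> set (elems ?T)" by (simp add: layers_def)
    then obtain s where s: "s < num ?T" "elems ?T ! s = \<tau>" by (auto simp: in_set_conv_nth num_def)
    have "\<exists>g\<in>set (elems (vertex_gaps (c s))). gap_witness g l" if "l \<in> set (elems t)" for l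
      using f[OF that] that c[OF s(1)] s(2) by (intro bexI[of _ "gap U (f l)"]) (auto simp: \<tau>_def)
    then show "\<exists>s<num ?T. vertex_satisfies D (c s)"
      unfolding vertex_satisfies_def using t(1) s(1) by blast
  next
    assume "\<exists>s<num ?T. vertex_satisfies D (c s)"
    then obtain s t where st: "s < num ?T" "t \<in> set (elems D)"
      "\<And>l. l \<in> set (elems t) \<Longrightarrow> \<exists>g\<in>set (elems (vertex_gaps (c s))). gap_witness g l"
      unfolding vertex_satisfies_def by blast
    have "elems ?T ! s \<in> set (elems ?T)" using st(1) by (simp add: num_def)
    then have "set (elems (elems ?T ! s)) \<subseteq> nat_val ` {..k}"
      unfolding layers_def using slots by (auto simp: set_tuples)
    then have "\<exists>j\<le>k. gap_witness (gap U j) l" if "l \<in> set (elems t)" for l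
      using st(3)[OF that] c[OF st(1)] by fastforce
    then show "hold chosen 2 D" unfolding hold2 using lit st(2) by blast
  qed
qed

end

section \<open>Choosing one vertex in each layer\<close>

lemma set_elems_layers:
  assumes "js \<in> set (elems (layers m (nat_val k)))"
  shows "num js \<le> m" "set (elems js) \<subseteq> nat_val ` {..k}"
  using assms by (auto simp: layers_def set_tuples elems_slots num_def less_Suc_eq_le)

lemma num_layers: "num (layers m (nat_val k)) = Suc (Suc k ^ m)"
  using num_tuples[of m "slots (nat_val k)"] elems_slots[of k] by (simp add: layers_def num_def)

definition clashing :: "val \<Rightarrow> val \<Rightarrow> val \<Rightarrow> val \<Rightarrow> bool" where
  "clashing k hi t t' \<longleftrightarrow>
     (\<exists>a\<in>set (elems (vertex_gaps t)). \<exists>b\<in>set (elems (vertex_gaps t')). gap_clash k hi a b)"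

text \<open>The first two sets are left by any choice of one vertex per layer. The remaining ones
  state satisfaction and the absence of clashes.\<close>

lemma avoided_iff:
  assumes V: "\<And>y. y \<in> set (elems V) \<Longrightarrow> hd_val (tl_val y) = nat_val (vertex_layer y)"
    and c: "\<And>s. s \<le> N \<Longrightarrow> c s \<in> set (elems V)" "\<And>s. s \<le> N \<Longrightarrow> vertex_layer (c s) = s"
    and le: "\<And>y. y \<in> set (elems V) \<Longrightarrow> vertex_layer y \<le> N"
  shows "(\<forall>X\<in>set (elems (avoided V k hi (nat_val N) \<Phi>)). \<exists>s\<le>N. c s \<notin> set (elems X)) \<longleftrightarrow>
    (\<forall>D\<in>set (elems \<Phi>). \<exists>s\<le>N. vertex_satisfies D (c s)) \<and> (\<forall>s\<le>N. \<forall>s'\<le>N. \<not> clashing k hi (c s) (c s'))"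
proof -
  have lay: "hd_val (tl_val (c s)) = nat_val s" if "s \<le> N" for s using V c that by simp
  let ?W = "\<lambda>t t'. filter (\<lambda>y. (hd_val (tl_val y) = hd_val (tl_val t) \<longrightarrow> y = t) \<and>
              (hd_val (tl_val y) = hd_val (tl_val t') \<longrightarrow> y = t')) (elems V)"
  have av: "elems ` set (elems (avoided V k hi (nat_val N) \<Phi>)) =
     {filter (\<lambda>y. hd_val (tl_val y) \<noteq> Atom) (elems V), filter (\<lambda>y. hd_val (tl_val y) \<noteq> nat_val N) (elems V)} \<union>
     (\<lambda>D. filter (\<lambda>y. \<not> vertex_satisfies D y) (elems V)) ` set (elems \<Phi>) \<union>
     {?W t t' | t t'. t \<in> set (elems V) \<and> t' \<in> set (elems V) \<and> clashing k hi t t'}" (is "_ = ?R")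
    unfolding avoided_def clashing_def by (auto simp: image_Un image_image split: if_splits) force+
  have "(\<forall>X\<in>set (elems (avoided V k hi (nat_val N) \<Phi>)). \<exists>s\<le>N. c s \<notin> set (elems X)) \<longleftrightarrow>
     (\<forall>l\<in>elems ` set (elems (avoided V k hi (nat_val N) \<Phi>)). \<exists>s\<le>N. c s \<notin> set l)" by simp
  also have "\<dots> \<longleftrightarrow> (\<forall>D\<in>set (elems \<Phi>). \<exists>s\<le>N. c s \<notin> set (filter (\<lambda>y. \<not> vertex_satisfies D y) (elems V))) \<and>
     (\<forall>t\<in>set (elems V). \<forall>t'\<in>set (elems V). clashing k hi t t' \<longrightarrow> (\<exists>s\<le>N. c s \<notin> set (?W t t')))"
  proof -
    have "\<exists>s\<le>N. c s \<notin> set (filter (\<lambda>y. hd_val (tl_val y) \<noteq> Atom) (elems V))"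
      using lay[of 0] by (intro exI[of _ 0]) simp
    moreover have "\<exists>s\<le>N. c s \<notin> set (filter (\<lambda>y. hd_val (tl_val y) \<noteq> nat_val N) (elems V))"
      using lay[of N] by (intro exI[of _ N]) simp
    ultimately show ?thesis unfolding av by blast
  qed
  also have "(\<forall>D\<in>set (elems \<Phi>). \<exists>s\<le>N. c s \<notin> set (filter (\<lambda>y. \<not> vertex_satisfies D y) (elems V))) \<longleftrightarrow>
     (\<forall>D\<in>set (elems \<Phi>). \<exists>s\<le>N. vertex_satisfies D (c s))" using c(1) by auto
  also have "(\<forall>t\<in>set (elems V). \<forall>t'\<in>set (elems V). clashing k hi t t' \<longrightarrow> (\<exists>s\<le>N. c s \<notin> set (?W t t'))) \<longleftrightarrow>
     (\<forall>s\<le>N. \<forall>s'\<le>N. \<not> clashing k hi (c s) (c s'))"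
  proof (intro iffI allI impI ballI notI)
    fix s s' assume *: "\<forall>t\<in>set (elems V). \<forall>t'\<in>set (elems V). clashing k hi t t' \<longrightarrow> (\<exists>s\<le>N. c s \<notin> set (?W t t'))"
      and s: "s \<le> N" "s' \<le> N" "clashing k hi (c s) (c s')"
    then obtain r where r: "r \<le> N" "c r \<notin> set (?W (c s) (c s'))" using c(1) by blast
    then show False using c(1)[OF r(1)] lay[OF r(1)] lay[OF s(1)] lay[OF s(2)] by auto
  next
    fix t t' assume *: "\<forall>s\<le>N. \<forall>s'\<le>N. \<not> clashing k hi (c s) (c s')"
      and t: "t \<in> set (elems V)" "t' \<in> set (elems V)" "clashing k hi t t'"
    \<comment> \<open>The two are not both chosen, and in the layer of the missing one the chosen
      vertex is outside the set.\<close>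
    then have "c (vertex_layer t) \<noteq> t \<or> c (vertex_layer t') \<noteq> t'" using le by metis
    then show "\<exists>s\<le>N. c s \<notin> set (?W t t')"
    proof
      assume "c (vertex_layer t) \<noteq> t"
      then show ?thesis using lay[OF le[OF t(1)]] V[OF t(1)] le[OF t(1)] by (intro exI[of _ "vertex_layer t"]) auto
    next
      assume "c (vertex_layer t') \<noteq> t'"
      then show ?thesis using lay[OF le[OF t(2)]] V[OF t(2)] le[OF t(2)] by (intro exI[of _ "vertex_layer t'"]) auto
    qed
  qed
  finally show ?thesis .
qed

text \<open>A choice without clashes determines a chain of gaps. Conversely, the sorted true
  variables of an assignment form a chain, and in each layer the vertex with the gaps at the
  positions of its tuple is taken.\<close>

lemma choice_iff:
  fixes C k m
  defines "V \<equiv> vertices m (points (circuit_val C)) (layers m (nat_val k))"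
  assumes m: "0 < m" and \<Phi>: "bounded_formula m (length C) 3 \<Phi>"
  shows "(\<exists>c. (\<forall>s\<le>Suc k ^ m. c s \<in> set (elems V) \<and> vertex_layer (c s) = s) \<and>
      (\<forall>X\<in>set (elems (avoided V (nat_val k) (nat_val (Suc (length C))) (nat_val (Suc k ^ m)) \<Phi>)).
         \<exists>s\<le>Suc k ^ m. c s \<notin> set (elems X))) \<longleftrightarrow>
    (\<exists>A\<subseteq>input_gates C. card A = k \<and> hold A 3 \<Phi>)"
proof -
  let ?T = "layers m (nat_val k)" and ?N = "Suc k ^ m" and ?n = "length C"
  let ?X = "points (circuit_val C)" and ?hi = "nat_val (Suc (length C))"
  have Tmem: "elems ?T ! s \<in> set (elems ?T)" if "s \<le> ?N" for s
    using num_layers[of m k] that by (simp add: num_def)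
  have Vcases: "hd_val (tl_val y) = nat_val (vertex_layer y)" "vertex_layer y \<le> ?N"
    "vertex_gaps y \<in> set (elems (gap_lists m ?X (elems ?T ! vertex_layer y)))" if "y \<in> set (elems V)" for y
    using that unfolding V_def
    by (auto elim!: vertices_cases simp: vertex_layer_def vertex_gaps_def num_layers)
  have Vgaps: "map hd_val (elems (vertex_gaps y)) = elems (elems ?T ! vertex_layer y)"
    "\<And>g. g \<in> set (elems (vertex_gaps y)) \<Longrightarrow> \<exists>u\<in>set (elems ?X). \<exists>w\<in>set (elems ?X). g = Cell (hd_val g) (Cell u w)"
    if "y \<in> set (elems V)" for y
    using Vcases(3)[OF that] set_elems_layers(1)[OF Tmem[OF Vcases(2)[OF that]]] by (auto simp: set_gap_lists)
  have D2: "bounded_formula m ?n 2 D" if "D \<in> set (elems \<Phi>)" for D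
    using \<Phi> that by (simp add: numeral_3_eq_3 numeral_2_eq_2)
  have hold3: "hold A 3 \<Phi> \<longleftrightarrow> (\<forall>D\<in>set (elems \<Phi>). hold A 2 D)" for A
    using hold.simps(2)[of A 2 \<Phi>] by simp
  have main: "(\<forall>X\<in>set (elems (avoided V (nat_val k) ?hi (nat_val ?N) \<Phi>)). \<exists>s\<le>?N. c s \<notin> set (elems X)) \<longleftrightarrow>
    (\<forall>D\<in>set (elems \<Phi>). \<exists>s\<le>?N. vertex_satisfies D (c s)) \<and> (\<forall>s\<le>?N. \<forall>s'\<le>?N. \<not> clashing (nat_val k) ?hi (c s) (c s'))"
    if "\<forall>s\<le>?N. c s \<in> set (elems V) \<and> vertex_layer (c s) = s" for c
    using that Vcases by (intro avoided_iff) auto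
  show ?thesis
  proof
    assume "\<exists>c. (\<forall>s\<le>?N. c s \<in> set (elems V) \<and> vertex_layer (c s) = s) \<and>
      (\<forall>X\<in>set (elems (avoided V (nat_val k) ?hi (nat_val ?N) \<Phi>)). \<exists>s\<le>?N. c s \<notin> set (elems X))"
    then obtain c where c0: "\<forall>s\<le>?N. c s \<in> set (elems V) \<and> vertex_layer (c s) = s"
      and av: "\<forall>X\<in>set (elems (avoided V (nat_val k) ?hi (nat_val ?N) \<Phi>)). \<exists>s\<le>?N. c s \<notin> set (elems X)" by blast
    have c: "\<And>s. s \<le> ?N \<Longrightarrow> c s \<in> set (elems V)" "\<And>s. s \<le> ?N \<Longrightarrow> vertex_layer (c s) = s"
      using c0 by auto
    note cons = main[OF c0, THEN iffD1, OF av]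
    have sat: "\<exists>s\<le>?N. vertex_satisfies D (c s)" if "D \<in> set (elems \<Phi>)" for D
      using cons that by blast
    have cl: "\<not> clashing (nat_val k) ?hi (c s) (c s')" if "s \<le> ?N" "s' \<le> ?N" for s s'
      using cons that by blast
    define G where "G = (\<Union>s\<in>{..?N}. set (elems (vertex_gaps (c s))))"
    have noclash: "\<not> gap_clash (nat_val k) ?hi a b" if "a \<in> G" "b \<in> G" for a b
      using that cl unfolding G_def clashing_def by blast
    have ex: "\<exists>g\<in>G. hd_val g = nat_val j" if j: "j \<le> k" for j
    proof -
      \<comment> \<open>The layer of the constant tuple provides a gap at position \<open>j\<close>,
        because \<open>0 < m\<close>.\<close>
      have "list_val (replicate m (nat_val j)) \<in> set (elems ?T)"
        using j by (auto simp: layers_def set_tuples elems_slots num_def set_replicate_conv_if)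
      then obtain s where s: "s < num ?T" "elems ?T ! s = list_val (replicate m (nat_val j))"
        by (auto simp: in_set_conv_nth num_def)
      then have sN: "s \<le> ?N" by (simp add: num_layers)
      then have "map hd_val (elems (vertex_gaps (c s))) = replicate m (nat_val j)"
        using Vgaps(1)[OF c(1)[OF sN]] c(2)[OF sN] s(2) by simp
      then have "nat_val j \<in> hd_val ` set (elems (vertex_gaps (c s)))"
        using m by (metis in_set_replicate list.set_map neq0_conv)
      then show ?thesis using sN unfolding G_def by fastforce
    qed
    then obtain f where f: "\<And>j. j \<le> k \<Longrightarrow> f j \<in> G \<and> hd_val (f j) = nat_val j" by metis
    have GX: "\<exists>u\<in>set (elems ?X). \<exists>w\<in>set (elems ?X). g = Cell (hd_val g) (Cell u w)" if "g \<in> G" for g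
      using that Vgaps(2) c(1) unfolding G_def by blast
    have Xnat: "nat_val (num u) = u" if "u \<in> set (elems ?X)" for u
      using that by (auto simp: set_points num_nat_val simp flip: nat_val_0)
    \<comment> \<open>Up to \<open>k\<close> the left end of the gap found at that position; beyond
      \<open>k\<close> the upper delimiter, where the gap at position \<open>k\<close> has to
      end.\<close>
    define U where "U j = (if j \<le> k then num (hd_val (tl_val (f j))) else Suc ?n)" for j
    have fU: "f j = gap U j" if j: "j \<le> k" for j
    proof -
      obtain u w where uw: "u \<in> set (elems ?X)" "w \<in> set (elems ?X)" "f j = Cell (nat_val j) (Cell u w)"
        using GX f[OF j] by metis
      have "u = nat_val (U j)" using Xnat[OF uw(1)] uw(3) j by (simp add: U_def)
      moreover have "w = nat_val (U (Suc j))"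
      proof (cases "j = k")
        case True
        then show ?thesis using noclash[of "f j" "f j"] f[OF j] uw(3) by (auto simp: gap_clash_def U_def)
      next
        case False
        then have j': "Suc j \<le> k" using j by simp
        have "w = hd_val (tl_val (f (Suc j)))"
          using noclash[of "f j" "f (Suc j)"] f[OF j] f[OF j'] uw(3) by (auto simp: gap_clash_def nat_val_Suc)
        then show ?thesis using Xnat[OF uw(2)] j' by (simp add: U_def)
      qed
      ultimately show ?thesis using uw(3) by (simp add: gap_def)
    qed
    have GU: "g = gap U j" if g: "g \<in> G" "hd_val g = nat_val j" "j \<le> k" for g j
    proof -
      have "tl_val g = tl_val (f j)" using noclash[of g "f j"] f[OF g(3)] g by (auto simp: gap_clash_def)
      moreover obtain u w where "g = Cell (nat_val j) (Cell u w)" using GX[OF g(1)] g(2) by metis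
      ultimately show ?thesis using fU[OF g(3)] by (simp add: gap_def)
    qed
    interpret gap_chain U k ?n
    proof
      show "U 0 = 0" using noclash[of "f 0" "f 0"] f[of 0] by (auto simp: gap_clash_def U_def num_def)
      show "U (Suc k) = Suc ?n" by (simp add: U_def)
      show "U j < U (Suc j)" if "j \<le> k" for j
        using noclash[of "f j" "f j"] f[OF that] fU[OF that] by (auto simp: gap_clash_def gap_def)
    qed
    have gaps: "elems (vertex_gaps (c s)) = map (\<lambda>j. gap U (num j)) (elems (elems ?T ! s))" if s: "s < num ?T" for s
    proof -
      have sN: "s \<le> ?N" using s by (simp add: num_layers)
      have h: "map hd_val (elems (vertex_gaps (c s))) = elems (elems ?T ! s)"
        using Vgaps(1)[OF c(1)[OF sN]] c(2)[OF sN] by simp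
      have "gap U (num (hd_val g)) = g" if g: "g \<in> set (elems (vertex_gaps (c s)))" for g
      proof -
        have "hd_val g \<in> set (elems (elems ?T ! s))" using g h by (metis image_eqI list.set_map)
        then obtain j where "hd_val g = nat_val j" "j \<le> k" using set_elems_layers(2)[OF Tmem[OF sN]] by auto
        moreover have "g \<in> G" using g sN unfolding G_def by auto
        ultimately show ?thesis using GU by simp
      qed
      then show ?thesis unfolding h[symmetric] by (simp add: map_idI)
    qed
    have "chosen \<subseteq> input_gates C"
    proof
      fix i assume "i \<in> chosen"
      then obtain j where j: "1 \<le> j" "j \<le> k" "U j = Suc i" unfolding chosen_def by auto
      obtain u w where u: "u \<in> set (elems ?X)" "f j = Cell (nat_val j) (Cell u w)"
        using GX f[OF j(2)] by metis
      then have "nat_val (Suc i) \<in> set (elems ?X)" using fU[OF j(2)] j(3) by (simp add: gap_def)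
      \<comment> \<open>This excludes the upper delimiter, so \<open>Suc i\<close> is the point of
        an input gate.\<close>
      moreover have "Suc i < Suc ?n" using strict[of j "Suc k"] last j by simp
      ultimately show "i \<in> input_gates C" unfolding set_points by (auto simp del: nat_val_0)
    qed
    moreover have "hold chosen 2 D \<longleftrightarrow> (\<exists>s<num ?T. vertex_satisfies D (c s))" if "D \<in> set (elems \<Phi>)" for D
      by (rule hold_dnf_iff[OF D2[OF that]]) (rule gaps)
    then have "hold chosen 3 \<Phi>" unfolding hold3 using sat by (simp add: num_layers less_Suc_eq_le)
    ultimately show "\<exists>A\<subseteq>input_gates C. card A = k \<and> hold A 3 \<Phi>" using card_chosen by blast
  next
    assume "\<exists>A\<subseteq>input_gates C. card A = k \<and> hold A 3 \<Phi>"
    then obtain A where A: "A \<subseteq> input_gates C" "card A = k" "hold A 3 \<Phi>" by blast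
    have fin: "finite A" using A(1) by (rule finite_subset) (simp add: input_gates_def)
    define xs where "xs = sorted_list_of_set A"
    have xs: "set xs = A" "length xs = k" "sorted_wrt (<) xs"
      using fin A(2) by (auto simp: xs_def)
    \<comment> \<open>Entries of \<open>xs\<close> are counted from 0 whereas inner points of the
      chain are counted from 1, and the outer \<open>Suc\<close> turns a gate into its
      point.\<close>
    define U where "U j = (if j = 0 then 0 else if j \<le> k then Suc (xs ! (j - 1)) else Suc ?n)" for j
    have An: "a < ?n" if "a \<in> A" for a using A(1) that by (auto simp: input_gates_def)
    interpret gap_chain U k ?n
    proof
      show "U 0 = 0" "U (Suc k) = Suc ?n" by (simp_all add: U_def)
      show "U j < U (Suc j)" if "j \<le> k" for j
        using that xs An[of "xs ! (j - 1)"] nth_mem[of "j - 1" xs] sorted_wrt_nth_less[OF xs(3), of "j - 1" j]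
        by (auto simp: U_def)
    qed
    have ch: "chosen = A"
      unfolding chosen_def image_Suc_lessThan[symmetric] using xs(2)
      by (auto simp: U_def xs(1)[symmetric] in_set_conv_nth)
    have "xs ! (j - 1) \<in> input_gates C" if "0 < j" "j \<le> k" for j
      using xs A(1) nth_mem[of "j - 1" xs] that by auto
    then have UX: "nat_val (U j) \<in> set (elems ?X)" if "j \<le> Suc k" for j
      using that unfolding set_points U_def by (auto simp: le_Suc_eq)
    have "\<exists>y\<in>set (elems V). vertex_layer y = s \<and>
       elems (vertex_gaps y) = map (\<lambda>j. gap U (num j)) (elems (elems ?T ! s))" if s: "s \<le> ?N" for s
    proof -
      let ?r = "list_val (map (\<lambda>j. gap U (num j)) (elems (elems ?T ! s)))"
      have j: "\<exists>i\<le>k. j = nat_val i" if "j \<in> set (elems (elems ?T ! s))" for j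
        using set_elems_layers(2)[OF Tmem[OF s]] that by auto
      have "?r \<in> set (elems (gap_lists m ?X (elems ?T ! s)))"
        unfolding set_gap_lists[OF set_elems_layers(1)[OF Tmem[OF s]]]
        using j UX by (auto simp: gap_def intro!: map_idI) fastforce+
      then obtain i where "Cell (nat_val i) (Cell (nat_val s) ?r) \<in> set (elems V)"
        using vertices_ex[of s ?T ?r m ?X] s unfolding V_def num_layers by auto
      then show ?thesis by (intro bexI) (auto simp: vertex_layer_def vertex_gaps_def)
    qed
    then obtain c where c: "\<And>s. s \<le> ?N \<Longrightarrow> c s \<in> set (elems V) \<and> vertex_layer (c s) = s \<and>
       elems (vertex_gaps (c s)) = map (\<lambda>j. gap U (num j)) (elems (elems ?T ! s))" by metis
    have gaps: "elems (vertex_gaps (c s)) = map (\<lambda>j. gap U (num j)) (elems (elems ?T ! s))" if "s < num ?T" for s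
      using that c by (simp add: num_layers)
    have nc: "\<not> clashing (nat_val k) ?hi (c s) (c s')" if s: "s \<le> ?N" "s' \<le> ?N" for s s'
    proof -
      have "\<exists>j\<le>k. g = gap U j" if "r \<le> ?N" "g \<in> set (elems (vertex_gaps (c r)))" for r g
        using that c set_elems_layers(2)[OF Tmem[OF that(1)]] by fastforce
      moreover have "\<not> gap_clash (nat_val k) ?hi (gap U i) (gap U j)" if "i \<le> k" "j \<le> k" for i j
      proof -
        have "nat_val u = Atom \<longleftrightarrow> u = 0" "nat_val v = Cell Atom (nat_val u) \<longleftrightarrow> v = Suc u" for u v
          by (simp_all flip: nat_val_0 nat_val_Suc) (metis nat_val_Suc nat_val_0 nat_val_eq_iff)
        then show ?thesis using less[OF that(1)] first last by (auto simp: gap_clash_def gap_def intro!: gr0I)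
      qed
      ultimately show ?thesis unfolding clashing_def using s by blast
    qed
    have sat: "\<exists>s\<le>?N. vertex_satisfies D (c s)" if D: "D \<in> set (elems \<Phi>)" for D
    proof -
      have "hold chosen 2 D \<longleftrightarrow> (\<exists>s<num ?T. vertex_satisfies D (c s))"
        by (rule hold_dnf_iff[OF D2[OF D]]) (rule gaps)
      then show ?thesis using A(3) D by (simp add: hold3 ch num_layers less_Suc_eq_le)
    qed
    show "\<exists>c. (\<forall>s\<le>?N. c s \<in> set (elems V) \<and> vertex_layer (c s) = s) \<and>
      (\<forall>X\<in>set (elems (avoided V (nat_val k) ?hi (nat_val ?N) \<Phi>)). \<exists>s\<le>?N. c s \<notin> set (elems X))"
    proof (intro exI conjI)
      show 1: "\<forall>s\<le>?N. c s \<in> set (elems V) \<and> vertex_layer (c s) = s" using c by blast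
      show "\<forall>X\<in>set (elems (avoided V (nat_val k) ?hi (nat_val ?N) \<Phi>)). \<exists>s\<le>?N. c s \<notin> set (elems X)"
        unfolding main[OF 1] using nc sat by blast
    qed
  qed
qed

section \<open>The reduction\<close>

lemma polytime_vlen: "polytime f \<Longrightarrow> polytime (\<lambda>x. vlen (f x))"
  unfolding vlen_def by (intro polytime_intros)

lemma polytime_points: "polytime f \<Longrightarrow> polytime (\<lambda>x. points (f x))"
  unfolding points_def by (intro polytime_intros polytime_vlen)

lemma polytime_slots: "polytime f \<Longrightarrow> polytime (\<lambda>x. slots (f x))"
  unfolding slots_def by (intro polytime_intros)

lemma polytime_tuples: "polytime f \<Longrightarrow> polytime (\<lambda>x. tuples m (f x))"
proof (induction m arbitrary: f)
  case 0
  then show ?case by (simp add: polytime_const)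
next
  case (Suc m)
  have "polytime (tuples (Suc m))" unfolding tuples.simps by (intro polytime_intros Suc.IH)
  from polytime_comp[OF Suc.prems this] show ?case .
qed

lemma polytime_gap_lists: "polytime f \<Longrightarrow> polytime g \<Longrightarrow> polytime (\<lambda>x. gap_lists m (f x) (g x))"
proof (induction m arbitrary: f g)
  case 0
  then show ?case by (simp add: polytime_const)
next
  case (Suc m)
  show ?case by (rule polytime2[OF _ Suc.prems], unfold gap_lists.simps) (intro polytime_intros Suc.IH)
qed

lemma polytime_layers: "polytime f \<Longrightarrow> polytime (\<lambda>x. layers m (f x))"
  unfolding layers_def by (intro polytime_intros polytime_tuples polytime_slots)

lemma polytime_vertices: "polytime f \<Longrightarrow> polytime g \<Longrightarrow> polytime (\<lambda>x. vertices m (f x) (g x))"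
  by (rule polytime2, unfold vertices_def) (intro polytime_intros polytime_gap_lists)

lemma polytime_gap_clash:
  assumes "polytime k" "polytime h" "polytime f" "polytime g"
  shows "polytime (\<lambda>x. bool_val (gap_clash (k x) (h x) (f x) (g x)))"
  unfolding gap_clash_def by (intro polytime_intros assms)

lemma polytime_vertex_satisfies:
  assumes "polytime f" "polytime g"
  shows "polytime (\<lambda>x. bool_val (vertex_satisfies (f x) (g x)))"
proof -
  have w: "polytime (\<lambda>x. bool_val (gap_witness (f x) (g x)))" if "polytime f" "polytime g" for f g
  proof -
    have "polytime (\<lambda>x. if hd_val (g x) = Atom
      then bool_val (num (hd_val (tl_val (f x))) < num (Cell Atom (tl_val (g x))) \<and> num (Cell Atom (tl_val (g x))) < num (tl_val (tl_val (f x))))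
      else bool_val (hd_val (tl_val (f x)) = Cell Atom (tl_val (g x))))"
      by (intro polytime_intros that)
    then show ?thesis by (rule back_subst[where P = polytime]) (auto simp: gap_witness_def fun_eq_iff)
  qed
  show ?thesis
    by (rule polytime2[OF _ assms], unfold vertex_satisfies_def vertex_gaps_def) (intro polytime_intros w)
qed

lemma polytime_avoided:
  assumes "polytime v" "polytime k" "polytime h" "polytime l" "polytime f"
  shows "polytime (\<lambda>x. avoided (v x) (k x) (h x) (l x) (f x))"
proof -
  have "polytime (\<lambda>p. avoided (hd_val p) (hd_val (tl_val p)) (hd_val (tl_val (tl_val p)))
     (hd_val (tl_val (tl_val (tl_val p)))) (tl_val (tl_val (tl_val (tl_val p)))))"
    unfolding avoided_def vertex_gaps_def
    by (intro polytime_intros polytime_gap_clash polytime_vertex_satisfies)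
  from polytime_comp[OF polytime_Cell[OF assms(1) polytime_Cell[OF assms(2) polytime_Cell[OF assms(3)
      polytime_Cell[OF assms(4,5)]]]] this] show ?thesis by simp
qed

text \<open>Every value is a list, so its prefix code can be written down list by list; \<open>d\<close> bounds the nesting.\<close>

primrec encode :: "nat \<Rightarrow> val \<Rightarrow> val" where
  "encode 0 v = Cell Atom Atom"
| "encode (Suc d) v = vappend (vbind v (\<lambda>y. Cell (bool_val True) (encode d y))) (Cell Atom Atom)"

fun nesting :: "val \<Rightarrow> nat" where
  "nesting Atom = 0"
| "nesting (Cell a b) = max (Suc (nesting a)) (nesting b)"

lemma nesting_list_val: "nesting (list_val vs) \<le> Suc d \<longleftrightarrow> (\<forall>v\<in>set vs. nesting v \<le> d)"
  by (induction vs) auto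

lemma encode_eq: "nesting v \<le> d \<Longrightarrow> encode d v = word_val (val_word v)"
proof (induction d arbitrary: v)
  case 0
  then show ?case by (cases v) (auto simp: word_val_def bool_val_def)
next
  case (Suc d)
  have "list_val (concat (map (\<lambda>y. bool_val True # elems (encode d y)) (elems v)) @ [Atom]) = word_val (val_word v)"
    using Suc.prems
  proof (induction v)
    case Atom
    then show ?case by (simp add: word_val_def bool_val_def)
  next
    case (Cell a b)
    then have "elems (encode d a) = map bool_val (val_word a)" using Suc.IH[of a] by (simp add: word_val_def)
    moreover have "concat (map (\<lambda>y. bool_val True # elems (encode d y)) (elems b)) @ [Atom] = map bool_val (val_word b)"
      using Cell by (simp add: word_val_def)
    ultimately show ?case by (simp add: word_val_def)
  qed
  then show ?case by (simp add: vappend_def)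
qed

lemma polytime_encode: "polytime f \<Longrightarrow> polytime (\<lambda>x. encode d (f x))"
proof (induction d arbitrary: f)
  case 0
  then show ?case by (simp add: polytime_const)
next
  case (Suc d)
  have "polytime (encode (Suc d))" unfolding encode.simps by (intro polytime_intros Suc.IH)
  from polytime_comp[OF Suc.prems this] show ?case .
qed

text \<open>Reading a prefix code backwards with a stack of trees.\<close>

definition decode_step :: "val \<Rightarrow> val \<Rightarrow> val" where
  "decode_step b s = (if b = Atom then Cell Atom s else Cell (Cell (hd_val s) (hd_val (tl_val s))) (tl_val (tl_val s)))"

definition decode :: "val \<Rightarrow> val" where
  "decode w = hd_val (fold decode_step (elems (vrev w)) Atom)"

lemma decode_word: "decode (word_val (val_word v)) = v"
proof -
  have "foldr decode_step (map bool_val (val_word v)) s = Cell v s" for s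
    by (induction v arbitrary: s) (auto simp: decode_step_def bool_val_def)
  then show ?thesis by (simp add: decode_def word_val_def foldr_conv_fold rev_map)
qed

lemma polytime_decode: "polytime f \<Longrightarrow> polytime (\<lambda>x. decode (f x))"
proof -
  assume f: "polytime f"
  have "polytime (\<lambda>x. fold ((\<lambda>_. decode_step) x) (elems (vrev (f x))) Atom)"
  proof (rule polytime_fold[where e = 4 and d = 1])
    show "polytime (\<lambda>p. decode_step (hd_val (tl_val p)) (tl_val (tl_val p)))"
      unfolding decode_step_def by (intro polytime_intros)
    show "val_size (decode_step y s) \<le> val_size s + (val_size x + val_size y + 4) ^ 1" for x y s
      by (cases s; cases "tl_val s") (auto simp: decode_step_def)
  qed (intro polytime_intros f)+
  then show ?thesis unfolding decode_def by (intro polytime_hd)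
qed

section \<open>Queries to the path algorithm as values\<close>

definition edges_val :: "val \<Rightarrow> val" where
  "edges_val X = vbind X (\<lambda>y. vmap (\<lambda>z. Cell (hd_val y) (hd_val z))
     (vfilter (\<lambda>z. num (hd_val y) < num (hd_val z) \<and>
        (hd_val (tl_val z) = Cell Atom (hd_val (tl_val y)) \<or> hd_val (tl_val y) = Cell Atom (hd_val (tl_val z)))) X))"

lemma polytime_edges_val:
  assumes "polytime f" shows "polytime (\<lambda>x. edges_val (f x))"
proof -
  have "polytime edges_val" unfolding edges_val_def by (intro polytime_intros)
  from polytime_comp[OF assms this] show ?thesis .
qed

lemma edges_val_eq:
  assumes X: "\<And>y. y \<in> set (elems X) \<Longrightarrow> hd_val y = nat_val (vertex_id y)"
    "\<And>y. y \<in> set (elems X) \<Longrightarrow> hd_val (tl_val y) = nat_val (vertex_layer y)"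
  shows "edges_val X = edge_list_val (layer_edges vertex_id vertex_layer (elems X))"
proof -
  let ?P = "\<lambda>y z. num (hd_val y) < num (hd_val z) \<and>
     (hd_val (tl_val z) = Cell Atom (hd_val (tl_val y)) \<or> hd_val (tl_val y) = Cell Atom (hd_val (tl_val z)))"
  let ?Q = "\<lambda>y z. vertex_id y < vertex_id z \<and>
     (vertex_layer z = Suc (vertex_layer y) \<or> vertex_layer y = Suc (vertex_layer z))"
  have *: "map (\<lambda>z. Cell (hd_val y) (hd_val z)) (filter (?P y) (elems X)) =
     map (\<lambda>z. Cell (nat_val (vertex_id y)) (nat_val (vertex_id z))) (filter (?Q y) (elems X))"
    if y: "y \<in> set (elems X)" for y
  proof (rule map_cong)
    have "?P y z = ?Q y z" if z: "z \<in> set (elems X)" for z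
      unfolding X(1)[OF y] X(1)[OF z] X(2)[OF y] X(2)[OF z] nat_val_Suc[symmetric] by simp
    then show "filter (?P y) (elems X) = filter (?Q y) (elems X)" by (rule filter_cong[OF refl])
  qed (use X(1) y in simp)
  show ?thesis
    unfolding edges_val_def vbind_def edge_list_val_def layer_edges_def map_concat elems_ops map_map comp_def prod.case
    by (rule arg_cong[of _ _ list_val], rule arg_cong[of _ _ concat], rule map_cong[OF refl], rule *)
qed

text \<open>\<open>L\<close> is the number of tuples. Together with the extra layer there are
  \<open>L + 1\<close> layers, so a path through all of them has \<open>L\<close> edges.\<close>

definition path_query :: "nat \<Rightarrow> val \<Rightarrow> val \<Rightarrow> val \<Rightarrow> val" where
  "path_query m C k \<Phi> =
     (let V = vertices m (points C) (layers m k);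
          L = vlen (tuples m (slots k));
          S = Cell (Cell (edges_val V) (bool_val True))
                (vmap (\<lambda>X. Cell (edges_val X) (bool_val False)) (avoided V k (Cell Atom (vlen C)) L \<Phi>))
      in Cell (encode 5 (Cell (vlen V) S)) L)"

lemma polytime_path_query:
  assumes "polytime f" "polytime g" "polytime h"
  shows "polytime (\<lambda>x. path_query m (f x) (g x) (h x))"
proof -
  have "polytime (\<lambda>p. path_query m (hd_val p) (hd_val (tl_val p)) (tl_val (tl_val p)))"
    unfolding path_query_def Let_def
    by (intro polytime_intros polytime_encode polytime_vlen polytime_edges_val polytime_avoided
        polytime_vertices polytime_points polytime_layers polytime_tuples polytime_slots)
  from polytime3[OF this assms] show ?thesis .
qed

lemma path_query_correct:
  assumes m: "0 < m" and \<Phi>: "bounded_formula m (length C) 3 \<Phi>"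
  obtains i where "path_query m (circuit_val C) (nat_val k) \<Phi> = instance_val (cc_code i) (cc_par i)"
    "i \<in> cc_instances" "cc_par i = Suc k ^ m"
    "(\<exists>F. cc_solution i F) \<longleftrightarrow> (\<exists>A\<subseteq>input_gates C. card A = k \<and> hold A 3 \<Phi>)"
proof -
  define V where "V = vertices m (points (circuit_val C)) (layers m (nat_val k))"
  define N where "N = Suc k ^ m"
  define Ws where "Ws = avoided V (nat_val k) (nat_val (Suc (length C))) (nat_val N) \<Phi>"
  define i where "i = layered_instance vertex_id vertex_layer (elems V) (map elems (elems Ws)) N"
  have Vy: "hd_val y = nat_val (vertex_id y)" "hd_val (tl_val y) = nat_val (vertex_layer y)" if "y \<in> set (elems V)" for y
    using that unfolding V_def by (auto elim!: vertices_cases simp: vertex_id_def vertex_layer_def)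
  have ids: "map vertex_id (elems V) = [0..<length (elems V)]"
    using vertex_ids[of m] unfolding V_def num_def .
  have dV: "distinct (elems V)" using ids by (metis distinct_map distinct_upt)
  have Ws: "set (elems X) \<subseteq> set (elems V) \<and> distinct (elems X)" if "X \<in> set (elems Ws)" for X
    using that dV unfolding Ws_def avoided_def by (auto split: if_splits)
  have first: "filter (\<lambda>y. vertex_layer y \<noteq> 0) (elems V) \<in> set (map elems (elems Ws))"
  proof -
    have "filter (\<lambda>y. vertex_layer y \<noteq> 0) (elems V) = filter (\<lambda>y. hd_val (tl_val y) \<noteq> Atom) (elems V)"
      by (rule filter_cong) (auto simp: Vy simp flip: nat_val_0)
    then show ?thesis by (simp add: Ws_def avoided_def)
  qed
  have last: "filter (\<lambda>y. vertex_layer y \<noteq> N) (elems V) \<in> set (map elems (elems Ws))"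
  proof -
    have "filter (\<lambda>y. vertex_layer y \<noteq> N) (elems V) = filter (\<lambda>y. hd_val (tl_val y) \<noteq> nat_val N) (elems V)"
      by (rule filter_cong) (auto simp: Vy)
    then show ?thesis by (simp add: Ws_def avoided_def)
  qed
  have "0 < N" by (simp add: N_def)
  note inst = layered_instance[OF ids this _ first last]
  have i1: "i \<in> cc_instances" unfolding i_def by (rule inst(1)) (use Ws in auto)
  have "(\<exists>F. cc_solution i F) \<longleftrightarrow> (\<exists>c. (\<forall>s\<le>N. c s \<in> set (elems V) \<and> vertex_layer (c s) = s) \<and>
      (\<forall>X\<in>set (map elems (elems Ws)). \<exists>s\<le>N. c s \<notin> set X))"
    unfolding i_def by (rule inst(2)) (use Ws in auto)
  also have "\<dots> \<longleftrightarrow> (\<exists>A\<subseteq>input_gates C. card A = k \<and> hold A 3 \<Phi>)"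
    using choice_iff[OF m \<Phi>, of k] unfolding V_def[symmetric] N_def[symmetric] Ws_def[symmetric] by simp
  finally have i2: "(\<exists>F. cc_solution i F) \<longleftrightarrow> (\<exists>A\<subseteq>input_gates C. card A = k \<and> hold A 3 \<Phi>)" .
  have L: "vlen (tuples m (slots (nat_val k))) = nat_val N"
    using num_tuples[of m "slots (nat_val k)"] elems_slots[of k] by (simp add: vlen_eq num_def N_def)
  have hi: "Cell Atom (vlen (circuit_val C)) = nat_val (Suc (length C))"
    by (simp add: vlen_eq num_def circuit_val_def nat_val_Suc)
  let ?e = "\<lambda>X. edge_list_val (layer_edges vertex_id vertex_layer X)"
  let ?S = "Cell (nat_val (length (elems V))) (Cell (Cell (?e (elems V)) (bool_val True))
       (list_val (map (\<lambda>X. Cell (?e (elems X)) (bool_val False)) (elems Ws))))"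
  have e: "edges_val X = ?e (elems X)" if "set (elems X) \<subseteq> set (elems V)" for X
    by (rule edges_val_eq) (use that Vy in blast)+
  have "vmap (\<lambda>X. Cell (edges_val X) (bool_val False)) Ws = list_val (map (\<lambda>X. Cell (?e (elems X)) (bool_val False)) (elems Ws))"
    unfolding vmap_def using e Ws by (simp cong: map_cong)
  then have q: "path_query m (circuit_val C) (nat_val k) \<Phi> = Cell (encode 5 ?S) (nat_val N)"
    unfolding path_query_def Let_def V_def[symmetric] L hi Ws_def[symmetric] using e[of V]
    by (simp add: vlen_eq num_def)
  \<comment> \<open>The nesting is 1 for a numeral, 2 for an edge, 3 for a list of edges, 4 for a
    sample, and 5 for the list that starts with the number of vertices and continues with the
    samples.\<close>
  have nat: "nesting (nat_val n) \<le> 1" for n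
    using nesting_list_val[of "replicate n Atom" 0] by (auto simp: nat_val_def)
  have "nesting (Cell (nat_val u) (nat_val v)) \<le> 2" for u v
    using nat[of u] nat[of v] by simp
  then have nest_e: "nesting (?e X) \<le> Suc 2" for X
    unfolding edge_list_val_def by (subst nesting_list_val) auto
  have "nesting (Cell (?e X) (bool_val b)) \<le> 4" for X b
    using nest_e[of X] by (simp add: bool_val_def)
  then have "nesting ?S \<le> 5"
    using nat[of "length (elems V)"]
      nesting_list_val[of "Cell (?e (elems V)) (bool_val True) # map (\<lambda>X. Cell (?e (elems X)) (bool_val False)) (elems Ws)" 4]
    by auto
  then have "encode 5 ?S = word_val (val_word ?S)" by (rule encode_eq)
  moreover have "val_word ?S = cc_code i"
    by (simp add: i_def layered_instance_def comp_def)
  ultimately have "path_query m (circuit_val C) (nat_val k) \<Phi> = instance_val (cc_code i) (cc_par i)"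
    unfolding q instance_val_def by (simp add: i_def layered_instance_def)
  moreover have "cc_par i = Suc k ^ m" by (simp add: i_def layered_instance_def N_def)
  ultimately show thesis using that i1 i2 by blast
qed

text \<open>Level 4 is the weft 2 plus 2: the entries of the resulting list are conjunctions of
  disjunctions of terms, and each becomes one query. The tail of the unary length of
  \<open>C\<close> is the index of its last gate, the output.\<close>

definition reduction :: "nat \<Rightarrow> val \<Rightarrow> val" where
  "reduction d x = (let C = decode (hd_val x) in
     vmap (path_query (2 ^ d) C (tl_val x)) (gate_formula d 4 True C (tl_val (vlen C))))"

lemma polytime_reduction: "polytime (reduction d)"
  unfolding reduction_def Let_def
  by (intro polytime_intros polytime_path_query polytime_gate_formula polytime_decode polytime_vlen)

lemma reduction_correct:
  assumes "C \<in> weft_depth_circuits 2 d"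
  obtains Is where "elems (reduction d (instance_val (circuit_code C) k)) = map (\<lambda>i. instance_val (cc_code i) (cc_par i)) Is"
    "\<And>i. i \<in> set Is \<Longrightarrow> i \<in> cc_instances \<and> cc_par i = Suc k ^ (2 ^ d)"
    "weighted_satisfiable C k \<longleftrightarrow> (\<exists>i\<in>set Is. \<exists>F. cc_solution i F)"
proof -
  have C: "circuit C" using assms by (simp add: weft_depth_circuits_def)
  then have ne: "C \<noteq> []" by (simp add: circuit_def)
  define z where "z = length C - 1"
  define G where "G = gate_formula d 4 True (circuit_val C) (nat_val z)"
  have dec: "decode (word_val (circuit_code C)) = circuit_val C"
    unfolding circuit_code_def circuit_val_def by (rule decode_word)
  have out: "tl_val (vlen (circuit_val C)) = nat_val z"
    using ne by (cases C) (auto simp: vlen_eq num_def circuit_val_def z_def nat_val_Suc)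
  have red: "elems (reduction d (instance_val (circuit_code C) k)) =
     map (path_query (2 ^ d) (circuit_val C) (nat_val k)) (elems G)"
    by (simp add: reduction_def instance_val_def dec out G_def Let_def)
  have lo: "z < length C" using ne by (simp add: z_def)
  have G: "hold A 4 G \<longleftrightarrow> gate_value C A z" "bounded_formula (2 ^ d) (length C) 4 G" for A
    using gate_formula_correct[OF C lo shallow_output[OF assms, folded z_def], of A True] by (auto simp: G_def)
  have G3: "bounded_formula (2 ^ d) (length C) 3 \<Phi>" if "\<Phi> \<in> set (elems G)" for \<Phi>
    using G(2) that bounded_formula.simps(2)[of "2 ^ d" "length C" 3 G] by simp
  have "\<exists>i. path_query (2 ^ d) (circuit_val C) (nat_val k) \<Phi> = instance_val (cc_code i) (cc_par i) \<and>
    i \<in> cc_instances \<and> cc_par i = Suc k ^ (2 ^ d) \<and>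
    ((\<exists>F. cc_solution i F) \<longleftrightarrow> (\<exists>A\<subseteq>input_gates C. card A = k \<and> hold A 3 \<Phi>))" if "\<Phi> \<in> set (elems G)" for \<Phi>
    using path_query_correct[OF _ G3[OF that], of k] by (metis zero_less_numeral zero_less_power)
  then obtain I where I: "\<And>\<Phi>. \<Phi> \<in> set (elems G) \<Longrightarrow>
    path_query (2 ^ d) (circuit_val C) (nat_val k) \<Phi> = instance_val (cc_code (I \<Phi>)) (cc_par (I \<Phi>)) \<and>
    I \<Phi> \<in> cc_instances \<and> cc_par (I \<Phi>) = Suc k ^ (2 ^ d) \<and>
    ((\<exists>F. cc_solution (I \<Phi>) F) \<longleftrightarrow> (\<exists>A\<subseteq>input_gates C. card A = k \<and> hold A 3 \<Phi>))" by metis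
  show thesis
  proof (rule that[of "map I (elems G)"])
    show "elems (reduction d (instance_val (circuit_code C) k)) = map (\<lambda>i. instance_val (cc_code i) (cc_par i)) (map I (elems G))"
      unfolding red using I by simp
    show "i \<in> cc_instances \<and> cc_par i = Suc k ^ (2 ^ d)" if "i \<in> set (map I (elems G))" for i
      using that I by auto
    \<comment> \<open>The outermost disjunction and the choice of the assignment are both
      existential, so they commute and every formula can be treated on its own.\<close>
    have "weighted_satisfiable C k \<longleftrightarrow> (\<exists>A\<subseteq>input_gates C. card A = k \<and> (\<exists>\<Phi>\<in>set (elems G). hold A 3 \<Phi>))"
      unfolding weighted_satisfiable_def z_def[symmetric] G(1)[symmetric] using hold.simps(2)[of _ 3 G] by simp
    then show "weighted_satisfiable C k \<longleftrightarrow> (\<exists>i\<in>set (map I (elems G)). \<exists>F. cc_solution i F)"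
      using I by auto
  qed
qed

section \<open>Using a program as an oracle\<close>

text \<open>Junk unless the program halts on \<open>v\<close>.\<close>

definition result :: "cmd \<Rightarrow> val \<Rightarrow> val" where "result P v = (THE w. \<exists>t. runs P v t w)"
definition steps :: "cmd \<Rightarrow> val \<Rightarrow> nat" where "steps P v = (THE t. \<exists>w. runs P v t w)"

lemma runs_result:
  assumes "runs P v t w" shows "result P v = w" "steps P v = t"
proof -
  have "u = t \<and> z = w" if "runs P v u z" for u z
    using assms that exec_deterministic unfolding runs_def by blast
  note unique = this
  show "result P v = w" unfolding result_def by (rule the_equality) (use assms unique in blast)+
  show "steps P v = t" unfolding steps_def by (rule the_equality) (use assms unique in blast)+
qed

text \<open>The overhead \<open>a\<close> pays for clearing the registers.\<close>

lemma timed_result: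
  obtains a where "timed {v. \<exists>t w. runs P v t w} (result P) (\<lambda>v. steps P v + a)"
proof -
  obtain Q M a where Q: "0 < M" "\<And>v t w. runs P v t w \<Longrightarrow> computes Q M v (t + a) w"
    using runs_computes by metis
  have "timed {v. \<exists>t w. runs P v t w} (result P) (\<lambda>v. steps P v + a)"
    unfolding timed_def
  proof (intro exI conjI ballI)
    show "0 < M" by (rule Q(1))
    fix v assume "v \<in> {v. \<exists>t w. runs P v t w}"
    then obtain t w where "runs P v t w" by blast
    then show "computes Q M v (steps P v + a) (result P v)" using Q(2) runs_result by simp
  qed
  then show thesis using that by blast
qed

text \<open>\<open>\<mu>\<close> may be any measure of the input, in particular one that includes
  the running times of oracle programs.\<close>

lemma timed_poly_bounded:
  assumes "timed D f T" "poly_bounded p" "\<And>v. v \<in> D \<Longrightarrow> T v \<le> p (\<mu> v)"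
  obtains e where "timed D f (\<lambda>v. (\<mu> v + 2) ^ e)"
proof -
  obtain e where "\<And>n. p n \<le> (n + 2) ^ e" using assms(2) unfolding poly_bounded_def by blast
  then have "timed D f (\<lambda>v. (\<mu> v + 2) ^ e)"
    by (intro timed_mono[OF assms(1) order_refl refl] order_trans[OF assms(3)])
  then show thesis using that by blast
qed

text \<open>The body of the loop over the queries, with its argument laid out as in
  \<open>timed_fold\<close>: the accumulator becomes true as soon as one query has a positive
  answer.\<close>

lemma timed_oracle_test:
  obtains e where "timed {p. \<exists>t w. runs P (hd_val (tl_val p)) t w}
    (\<lambda>p. if result P (hd_val (tl_val p)) \<noteq> Atom then Cell Atom Atom else tl_val (tl_val p))
    (\<lambda>p. (val_size p + steps P (hd_val (tl_val p)) + 2) ^ e)"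
proof -
  let ?D = "{p. \<exists>t w. runs P (hd_val (tl_val p)) t w}"
  obtain a where a: "timed {v. \<exists>t w. runs P v t w} (result P) (\<lambda>v. steps P v + a)" using timed_result .
  have "timed ?D (\<lambda>p. hd_val (tl_val p)) (\<lambda>p. Suc (val_size (hd_val (tl_val p))))"
    by (rule timed_expr[of "Hd (Tl (Var 0))"]) simp
  from timed_comp[OF this a] have
    1: "timed ?D (\<lambda>p. result P (hd_val (tl_val p))) (\<lambda>p. Suc (val_size (hd_val (tl_val p))) + (steps P (hd_val (tl_val p)) + a))"
    by simp
  have 2: "timed ?D (\<lambda>p. p) (\<lambda>p. Suc (val_size p))" by (rule timed_expr[of "Var 0"]) simp
  have "polytime (\<lambda>q. if \<not> hd_val q = Atom then Cell Atom Atom else tl_val (tl_val (tl_val q)))"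
    by (intro polytime_intros)
  then obtain b where 3: "timed UNIV (\<lambda>q. if \<not> hd_val q = Atom then Cell Atom Atom else tl_val (tl_val (tl_val q)))
     (\<lambda>v. (val_size v + 2) ^ b)" using polytimeE by metis
  define q where "q n = 5 * ((Suc n + (n + a)) + Suc n + n + 2) + ((Suc n + (n + a)) + n + n + 3) ^ b" for n
  have le: "val_size (hd_val (tl_val p)) \<le> val_size p" for p
    using hd_val_size tl_val_size order_trans by metis
  show thesis
  proof (rule timed_poly_bounded[OF timed_comp[OF timed_pair[OF 1 2] 3], where p = q
        and \<mu> = "\<lambda>p. val_size p + steps P (hd_val (tl_val p))"])
    show "poly_bounded q" unfolding q_def by (intro poly_bounded_intros)
    fix p assume p: "p \<in> ?D"
    let ?n = "val_size p + steps P (hd_val (tl_val p))"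
    have "val_size (result P (hd_val (tl_val p))) \<le> val_size p + (Suc (val_size (hd_val (tl_val p))) + (steps P (hd_val (tl_val p)) + a))"
      using timed_size[OF 1 p] .
    then have "(val_size (Cell (result P (hd_val (tl_val p))) p) + 2) ^ b \<le> ((Suc ?n + (?n + a)) + ?n + ?n + 3) ^ b"
      using le[of p] by (intro power_mono) auto
    then show "5 * (Suc (val_size (hd_val (tl_val p))) + (steps P (hd_val (tl_val p)) + a) + Suc (val_size p) + val_size p + 2) +
         (val_size (Cell (result P (hd_val (tl_val p))) p) + 2) ^ b \<le> q ?n"
      using le[of p] unfolding q_def by (intro add_mono) simp_all
  next
    fix e assume "timed ?D (\<lambda>v. if \<not> hd_val (Cell (result P (hd_val (tl_val v))) v) = Atom then Cell Atom Atom
        else tl_val (tl_val (tl_val (Cell (result P (hd_val (tl_val v))) v))))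
        (\<lambda>v. (val_size v + steps P (hd_val (tl_val v)) + 2) ^ e)"
    then show thesis unfolding hd_val.simps tl_val.simps by (rule that)
  qed (rule UNIV_I)
qed

text \<open>The program runs \<open>P\<close>, computes a list of queries from its output by
  \<open>r\<close>, and runs \<open>Q\<close> on each. The size of an output is bounded by input
  size and running time, so the total time is polynomial in the input size and the running times of
  \<open>P\<close> and of all calls of \<open>Q\<close>.\<close>

lemma timed_oracle_loop:
  assumes r: "polytime r"
    and D1: "\<And>v. v \<in> D \<Longrightarrow> \<exists>t w. runs P v t w"
    and D2: "\<And>v y. v \<in> D \<Longrightarrow> y \<in> set (elems (r (result P v))) \<Longrightarrow> \<exists>t w. runs Q y t w"
  obtains e where "timed D (\<lambda>v. bool_val (\<exists>y\<in>set (elems (r (result P v))). result Q y \<noteq> Atom))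
    (\<lambda>v. (val_size v + steps P v + (\<Sum>y\<leftarrow>elems (r (result P v)). steps Q y) + 2) ^ e)"
proof -
  define L where "L v = r (result P v)" for v
  define \<mu> where "\<mu> v = val_size v + steps P v + (\<Sum>y\<leftarrow>elems (L v). steps Q y)" for v
  obtain a where "timed {v. \<exists>t w. runs P v t w} (result P) (\<lambda>v. steps P v + a)" using timed_result .
  then have a: "timed D (result P) (\<lambda>v. steps P v + a)" by (rule timed_mono) (use D1 in auto)
  obtain b where b: "timed UNIV r (\<lambda>v. (val_size v + 2) ^ b)" "\<And>v. val_size (r v) \<le> (val_size v + 2) ^ Suc b"
    using polytimeE[OF r] by blast
  have L: "timed D L (\<lambda>v. steps P v + a + (val_size (result P v) + 2) ^ b)"
    unfolding L_def by (rule timed_comp[OF a b(1)]) simp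
  have S: "timed D (\<lambda>_. Atom) (\<lambda>_. 2)"
    by (rule timed_mono[OF timed_expr[of "Const Atom" "\<lambda>_. Atom"]]) auto
  define f where "f x y s = (if result Q y \<noteq> Atom then Cell Atom Atom else s)" for x y s :: val
  obtain c where c: "timed {p. \<exists>t w. runs Q (hd_val (tl_val p)) t w}
    (\<lambda>p. f (hd_val p) (hd_val (tl_val p)) (tl_val (tl_val p)))
    (\<lambda>p. (val_size p + steps Q (hd_val (tl_val p)) + 2) ^ c)"
    unfolding f_def using timed_oracle_test[of Q] by blast
  have f: "fold (f x) ys Atom = bool_val (\<exists>y\<in>set ys. result Q y \<noteq> Atom)" for x ys
    by (induction ys rule: rev_induct) (auto simp: f_def bool_val_def)
  have size_bool: "val_size (bool_val z) \<le> 3" for z by (simp add: bool_val_def)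
  define B where "B n = n + (n + a + (n + a + 2) ^ b) + (n + a + 2) ^ Suc b + (2 * n + (n + a + 2) ^ Suc b + 7) ^ c + 3" for n
  have res: "val_size (result P v) \<le> \<mu> v + a" if "v \<in> D" for v
    using timed_size[OF a that] by (simp add: \<mu>_def)
  have Lsize: "val_size (L v) \<le> (\<mu> v + a + 2) ^ Suc b" if "v \<in> D" for v
    using b(2)[of "result P v"] power_mono[of "val_size (result P v) + 2" "\<mu> v + a + 2" "Suc b"] res[OF that]
    unfolding L_def by linarith
  have "timed D (\<lambda>v. fold (f v) (elems (L v)) Atom) (\<lambda>v. 1000 * Suc (B (\<mu> v)) ^ 2)"
  proof (rule timed_fold[OF c L S])
    fix v i assume v: "v \<in> D" and i: "i < length (elems (L v))"
    let ?y = "elems (L v) ! i" and ?s = "fold (f v) (take i (elems (L v))) Atom"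
    have y: "?y \<in> set (elems (L v))" using i by simp
    have "steps Q ?y \<le> \<mu> v"
      using member_le_sum_list[of "steps Q ?y" "map (steps Q) (elems (L v))"] y by (simp add: \<mu>_def)
    moreover have "val_size ?y \<le> (\<mu> v + a + 2) ^ Suc b" using val_size_elem[OF y] Lsize[OF v] by linarith
    moreover have "val_size ?s \<le> 3" unfolding f by (rule size_bool)
    moreover have "val_size v \<le> \<mu> v" by (simp add: \<mu>_def)
    ultimately have "(val_size (Cell v (Cell ?y ?s)) + steps Q ?y + 2) ^ c \<le> (2 * \<mu> v + (\<mu> v + a + 2) ^ Suc b + 7) ^ c"
      by (intro power_mono) (simp_all del: power_Suc)
    then show "Cell v (Cell ?y ?s) \<in> {p. \<exists>t w. runs Q (hd_val (tl_val p)) t w} \<and>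
       (val_size (Cell v (Cell ?y ?s)) + steps Q (hd_val (tl_val (Cell v (Cell ?y ?s)))) + 2) ^ c \<le> B (\<mu> v)"
      using D2[OF v, of ?y] y unfolding B_def L_def[symmetric] by (simp del: power_Suc)
  next
    fix v assume v: "v \<in> D"
    have "(val_size (result P v) + 2) ^ b \<le> (\<mu> v + a + 2) ^ b" using res[OF v] by (intro power_mono) auto
    then show "val_size v \<le> B (\<mu> v) \<and> val_size (L v) \<le> B (\<mu> v) \<and>
       steps P v + a + (val_size (result P v) + 2) ^ b \<le> B (\<mu> v) \<and> 2 \<le> B (\<mu> v)"
      using Lsize[OF v] unfolding B_def by (auto simp: \<mu>_def simp del: power_Suc)
    fix i
    show "val_size (fold (f v) (take i (elems (L v))) Atom) \<le> B (\<mu> v)"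
      unfolding f B_def using size_bool by (simp add: trans_le_add2)
  qed
  moreover have "poly_bounded (\<lambda>n. 1000 * Suc (B n) ^ 2)" unfolding B_def by (intro poly_bounded_intros)
  ultimately obtain e where "timed D (\<lambda>v. fold (f v) (elems (L v)) Atom) (\<lambda>v. (\<mu> v + 2) ^ e)"
    by (rule timed_poly_bounded) auto
  then show thesis using that unfolding f \<mu>_def L_def by blast
qed

section \<open>Consistency checking and the class W[2]\<close>

text \<open>The reduction decides \<open>L\<close> itself and encodes the answer in the weight: a
  circuit consisting of one input gate is satisfied with weight 1, whereas weight 2 exceeds the
  number of inputs.\<close>

lemma FPT_subset_W2: "FPT \<subseteq> W 2"
proof
  fix L assume "L \<in> FPT"
  then obtain P f c where f: "computable f"
    and P: "\<And>i. \<exists>t output. runs P (instance_val (fst i) (snd i)) t output \<and>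
       t \<le> f (snd i) * Suc (length (fst i)) ^ c \<and> (output \<noteq> Atom \<longleftrightarrow> i \<in> L)"
    unfolding FPT_def fpt_computable_def mem_Collect_eq by blast
  define v where "v k = instance_val (circuit_code [Input]) k" for k
  define Q where "Q = Seq P (Cond (Var 0) (Assign 0 (Const (v 1))) (Assign 0 (Const (v 2))))"
  define K where "K = 2 + val_size (v 1) + val_size (v 2)"
  have path: "p = [0]" if "circuit_path [Input] p" for p
  proof -
    have "\<not> Suc 0 < length p"
    proof
      assume l: "Suc 0 < length p"
      then have "p ! Suc 0 \<in> set p" by simp
      then have "p ! Suc 0 = 0" using that unfolding circuit_path_def by auto
      then show False using that l unfolding circuit_path_def by (auto dest!: spec[of _ 0])
    qed
    with that show ?thesis unfolding circuit_path_def by (cases p) auto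
  qed
  have C: "[Input] \<in> weft_depth_circuits 2 1"
    unfolding weft_depth_circuits_def by (auto simp: circuit_def large_def dest!: path)
  have inp: "input_gates [Input] = {0}" by (auto simp: input_gates_def)
  have 1: "weighted_satisfiable [Input] 1"
    unfolding weighted_satisfiable_def inp by (intro exI[of _ "{0}"]) (simp add: gate_value.simps[of "[Input]" "{0}" 0])
  have 2: "\<not> weighted_satisfiable [Input] 2"
  proof
    assume "weighted_satisfiable [Input] 2"
    then obtain A where "A \<subseteq> {0::nat}" "card A = 2" unfolding weighted_satisfiable_def inp by blast
    then show False using card_mono[of "{0::nat}" A] by simp
  qed
  have Q: "\<exists>t output. runs Q (instance_val (fst i) (snd i)) t output \<and>
      t \<le> (f (snd i) + K) * Suc (length (fst i)) ^ c \<and>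
      (\<exists>C k'. output = instance_val (circuit_code C) k' \<and> C \<in> weft_depth_circuits 2 1 \<and>
        k' \<le> 2 \<and> (i \<in> L \<longleftrightarrow> weighted_satisfiable C k'))" for i
  proof -
    obtain t w where t: "runs P (instance_val (fst i) (snd i)) t w"
      "t \<le> f (snd i) * Suc (length (fst i)) ^ c" "w \<noteq> Atom \<longleftrightarrow> i \<in> L" using P by blast
    obtain s where s: "exec P ((\<lambda>_. Atom)(0 := instance_val (fst i) (snd i))) t s" "s 0 = w"
      using t(1) unfolding runs_def by blast
    define k' :: nat where "k' = (if i \<in> L then 1 else 2)"
    have "exec (Cond (Var 0) (Assign 0 (Const (v 1))) (Assign 0 (Const (v 2)))) s (Suc (Suc (val_size (v k')))) (s(0 := v k'))"
    proof (cases "i \<in> L")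
      case True
      then have "eval (Var 0) s \<noteq> Atom" using s(2) t(3) by simp
      from exec.CondTrue[OF this exec.Assign[of 0 "Const (v 1)" s]] True show ?thesis by (simp add: k'_def)
    next
      case False
      then have "eval (Var 0) s = Atom" using s(2) t(3) by simp
      from exec.CondFalse[OF this exec.Assign[of 0 "Const (v 2)" s]] False show ?thesis by (simp add: k'_def)
    qed
    from exec.Seq[OF s(1) this] have "runs Q (instance_val (fst i) (snd i)) (t + Suc (Suc (val_size (v k')))) (v k')"
      unfolding runs_def Q_def by (intro exI[of _ "s(0 := v k')"] conjI) (assumption, simp)
    moreover have "t + Suc (Suc (val_size (v k'))) \<le> (f (snd i) + K) * Suc (length (fst i)) ^ c"
    proof -
      have "Suc (Suc (val_size (v k'))) \<le> K * 1" by (simp add: K_def k'_def)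
      also have "\<dots> \<le> K * Suc (length (fst i)) ^ c" by (intro mult_left_mono) auto
      finally show ?thesis using t(2) by (simp add: add_mult_distrib)
    qed
    moreover have "\<exists>C l. v k' = instance_val (circuit_code C) l \<and> C \<in> weft_depth_circuits 2 1 \<and>
        l \<le> 2 \<and> (i \<in> L \<longleftrightarrow> weighted_satisfiable C l)"
    proof (rule exI[of _ "[Input]"], rule exI[of _ k'], intro conjI)
      show "i \<in> L \<longleftrightarrow> weighted_satisfiable [Input] k'" using 1 2 by (simp add: k'_def)
    qed (use C in \<open>simp_all add: v_def k'_def\<close>)
    ultimately show ?thesis by blast
  qed
  have "\<exists>Q f c. computable f \<and> (\<forall>i\<in>UNIV. \<exists>t output. runs Q (instance_val (fst i) (snd i)) t output \<and>
      t \<le> f (snd i) * Suc (length (fst i)) ^ c \<and>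
      (\<exists>C k'. output = instance_val (circuit_code C) k' \<and> C \<in> weft_depth_circuits 2 1 \<and>
        k' \<le> 2 \<and> (i \<in> L \<longleftrightarrow> weighted_satisfiable C k')))"
    by (rule exI[of _ Q], rule exI[of _ "\<lambda>k. f k + K"], rule exI[of _ c])
      (intro conjI ballI computable_add f computable_const Q)
  then have "fpt_computable UNIV fst snd
          (\<lambda>i output. \<exists>C k'. output = instance_val (circuit_code C) k' \<and> C \<in> weft_depth_circuits 2 1 \<and>
             k' \<le> 2 \<and> (i \<in> L \<longleftrightarrow> weighted_satisfiable C k'))"
    unfolding fpt_computable_def .
  then have "fpt_reducible_WCS L (weft_depth_circuits 2 1)"
    unfolding fpt_reducible_WCS_def by (intro exI[of _ "\<lambda>_. 2"] conjI computable_const)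
  then show "L \<in> W 2" unfolding W_def by blast
qed

text \<open>The path algorithm returns a solution, but of its answer only the existence of one is
  used.\<close>

lemma cc_correct_Atom: "cc_correct i output \<Longrightarrow> output \<noteq> Atom \<longleftrightarrow> (\<exists>F. cc_solution i F)"
  unfolding cc_correct_def by (auto split: if_splits)

lemma val_size_instance_val: "val_size (instance_val x k) \<le> 4 * length x + 2 * k + 3"
proof -
  have "val_size (word_val x) \<le> 4 * length x + 1"
    unfolding word_val_def by (induction x) (auto simp: bool_val_def)
  then show ?thesis by (simp add: instance_val_def val_size_nat_val)
qed

lemma length_less_val_size_instance_val: "length x < val_size (instance_val x k)"
  using length_elems_less[of "word_val x"] by (simp add: instance_val_def word_val_def)

text \<open>The given reduction to circuits is followed by \<open>reduction d\<close> and by the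
  path algorithm on every query. Number and lengths of the queries are polynomial in
  \<open>u v\<close>, and their common parameter \<open>Suc k' ^ (2 ^ d)\<close> is bounded in terms
  of \<open>k\<close>, since \<open>k' \<le> g k\<close>.\<close>

lemma W2_subset_FPT:
  assumes cc: "fpt_computable cc_instances cc_code cc_par cc_correct"
  shows "W 2 \<subseteq> FPT"
proof
  fix L assume "L \<in> W 2"
  then obtain d g where g: "computable g"
    and red: "fpt_computable UNIV fst snd
          (\<lambda>i output. \<exists>C k'. output = instance_val (circuit_code C) k' \<and> C \<in> weft_depth_circuits 2 d \<and>
             k' \<le> g (snd i) \<and> (i \<in> L \<longleftrightarrow> weighted_satisfiable C k'))"
    unfolding W_def fpt_reducible_WCS_def by blast
  obtain P f1 c1 where f1: "computable f1"
    and P: "\<And>i. \<exists>t output. runs P (instance_val (fst i) (snd i)) t output \<and>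
       t \<le> f1 (snd i) * Suc (length (fst i)) ^ c1 \<and> (\<exists>C k'. output = instance_val (circuit_code C) k' \<and>
         C \<in> weft_depth_circuits 2 d \<and> k' \<le> g (snd i) \<and> (i \<in> L \<longleftrightarrow> weighted_satisfiable C k'))"
    using red unfolding fpt_computable_def by blast
  obtain Q f2 c2 where f2: "computable f2"
    and Q: "\<And>i. i \<in> cc_instances \<Longrightarrow> \<exists>t output. runs Q (instance_val (cc_code i) (cc_par i)) t output \<and>
       t \<le> f2 (cc_par i) * Suc (length (cc_code i)) ^ c2 \<and> cc_correct i output"
    using cc unfolding fpt_computable_def by blast
  \<comment> \<open>Of \<open>k'\<close> only the bound \<open>g k\<close> is known, and
    \<open>f2\<close> need not be monotone, so its values for all candidates are added up.\<close>
  define H where "H k = (\<Sum>j<Suc (g k). f2 (Suc j ^ (2 ^ d)))" for k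
  have H: "computable H"
  proof -
    have "computable (\<lambda>j. f2 (Suc j ^ (2 ^ d)))"
      using computable_comp[OF computable_power[OF computable_add[OF computable_const[of 1] computable_id]] f2] by simp
    from computable_comp[OF computable_add[OF computable_const[of 1] g] computable_sum[OF this]]
    show ?thesis unfolding H_def by simp
  qed
  obtain b where b: "\<And>v. val_size (reduction d v) \<le> (val_size v + 2) ^ b"
    using polytimeE[OF polytime_reduction[of d]] by metis
  \<comment> \<open>By \<open>exec_size\<close> this also bounds the size of the output of
    \<open>P\<close>.\<close>
  define u where "u v = val_size v + steps P v" for v
  define I where "I = range (\<lambda>(x, k). instance_val x k)"
  have key: "(\<exists>t w. runs P v t w) \<and> steps P v \<le> f1 k * Suc (length x) ^ c1 \<and>
     (\<forall>y\<in>set (elems (reduction d (result P v))). \<exists>t w. runs Q y t w) \<and>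
     ((\<exists>y\<in>set (elems (reduction d (result P v))). result Q y \<noteq> Atom) \<longleftrightarrow> (x, k) \<in> L) \<and>
     (\<Sum>y\<leftarrow>elems (reduction d (result P v)). steps Q y) \<le> H k * (u v + 2) ^ (b + b * c2)"
    if v: "v = instance_val x k" for v x k
  proof -
    obtain t C k' where t: "runs P v t (instance_val (circuit_code C) k')" "t \<le> f1 k * Suc (length x) ^ c1"
      and C: "C \<in> weft_depth_circuits 2 d" "k' \<le> g k" "(x, k) \<in> L \<longleftrightarrow> weighted_satisfiable C k'"
      using P[of "(x, k)"] unfolding v by auto
    obtain Is where Is: "elems (reduction d (instance_val (circuit_code C) k')) = map (\<lambda>i. instance_val (cc_code i) (cc_par i)) Is"
      "\<And>i. i \<in> set Is \<Longrightarrow> i \<in> cc_instances \<and> cc_par i = Suc k' ^ (2 ^ d)"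
      "weighted_satisfiable C k' \<longleftrightarrow> (\<exists>i\<in>set Is. \<exists>F. cc_solution i F)"
      by (rule reduction_correct[OF C(1), of k'], rule that)
    have rP: "result P v = instance_val (circuit_code C) k'" "steps P v = t" using runs_result[OF t(1)] by auto
    let ?R = "reduction d (result P v)"
    have el: "elems ?R = map (\<lambda>i. instance_val (cc_code i) (cc_par i)) Is" using Is(1) rP by simp
    have q: "(result Q (instance_val (cc_code i) (cc_par i)) \<noteq> Atom \<longleftrightarrow> (\<exists>F. cc_solution i F)) \<and>
       steps Q (instance_val (cc_code i) (cc_par i)) \<le> H k * (u v + 2) ^ (b * c2)" if i: "i \<in> set Is" for i
    proof -
      obtain s w where s: "runs Q (instance_val (cc_code i) (cc_par i)) s w"
        "s \<le> f2 (cc_par i) * Suc (length (cc_code i)) ^ c2" "cc_correct i w"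
        using Q Is(2)[OF i] by blast
      have "f2 (cc_par i) \<le> H k"
      proof -
        have "f2 (Suc k' ^ 2 ^ d) \<le> (\<Sum>j<Suc (g k). f2 (Suc j ^ (2 ^ d)))"
          using C(2) by (intro member_le_sum[of k' _ "\<lambda>j. f2 (Suc j ^ 2 ^ d)"]) auto
        then show ?thesis using Is(2)[OF i] by (simp add: H_def)
      qed
      moreover have "Suc (length (cc_code i)) \<le> (u v + 2) ^ b"
      proof -
        have "length (cc_code i) < val_size (instance_val (cc_code i) (cc_par i))"
          by (rule length_less_val_size_instance_val)
        also have "\<dots> < val_size ?R" by (rule val_size_elem) (use el i in auto)
        also have "\<dots> \<le> (val_size (result P v) + 2) ^ b" by (rule b)
        also have "\<dots> \<le> (u v + 2) ^ b"
        proof (intro power_mono add_mono order_refl)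
          obtain s where "exec P ((\<lambda>_. Atom)(0 := v)) t s" "s 0 = result P v"
            using t(1) rP unfolding runs_def by auto
          then show "val_size (result P v) \<le> u v"
            using exec_size[of P "(\<lambda>_. Atom)(0 := v)" t s 0] rP by (auto simp: u_def)
        qed simp
        finally show ?thesis by simp
      qed
      then have "Suc (length (cc_code i)) ^ c2 \<le> (u v + 2) ^ (b * c2)"
        unfolding power_mult by (intro power_mono) auto
      ultimately have "s \<le> H k * (u v + 2) ^ (b * c2)" using s(2) by (meson mult_le_mono order_trans)
      then show ?thesis using runs_result[OF s(1)] cc_correct_Atom[OF s(3)] by simp
    qed
    have "(\<Sum>y\<leftarrow>elems ?R. steps Q y) \<le> (\<Sum>y\<leftarrow>elems ?R. H k * (u v + 2) ^ (b * c2))"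
      by (rule sum_list_mono) (use q el in auto)
    also have "\<dots> = length (elems ?R) * (H k * (u v + 2) ^ (b * c2))" by (simp only: sum_list_triv) simp
    also have "\<dots> \<le> (u v + 2) ^ b * (H k * (u v + 2) ^ (b * c2))"
    proof (rule mult_right_mono)
      obtain s where "exec P ((\<lambda>_. Atom)(0 := v)) t s" "s 0 = result P v"
        using t(1) rP unfolding runs_def by auto
      then have "val_size (result P v) \<le> u v"
        using exec_size[of P "(\<lambda>_. Atom)(0 := v)" t s 0] rP by (auto simp: u_def)
      then have "(val_size (result P v) + 2) ^ b \<le> (u v + 2) ^ b" by (intro power_mono) auto
      then show "length (elems ?R) \<le> (u v + 2) ^ b" using length_elems_less[of ?R] b[of "result P v"] by linarith
    qed simp
    also have "\<dots> = H k * (u v + 2) ^ (b + b * c2)" by (simp add: power_add)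
    finally have sum: "(\<Sum>y\<leftarrow>elems ?R. steps Q y) \<le> H k * (u v + 2) ^ (b + b * c2)" .
    have ex: "\<exists>t w. runs Q y t w" if "y \<in> set (elems ?R)" for y
      using that el Is(2) Q by fastforce
    have "(\<exists>y\<in>set (elems ?R). result Q y \<noteq> Atom) \<longleftrightarrow> (x, k) \<in> L"
      using el q C(3) Is(3) by auto
    then show ?thesis using t rP(2) ex sum by (intro conjI ballI) (blast | simp)+
  qed
  obtain e where e: "timed I (\<lambda>v. bool_val (\<exists>y\<in>set (elems (reduction d (result P v))). result Q y \<noteq> Atom))
    (\<lambda>v. (val_size v + steps P v + (\<Sum>y\<leftarrow>elems (reduction d (result P v)). steps Q y) + 2) ^ e)"
  proof (rule timed_oracle_loop[OF polytime_reduction])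
    show "\<exists>t w. runs P v t w" if v: "v \<in> I" for v
    proof -
      obtain x k where "v = instance_val x k" using v unfolding I_def by auto
      from key[OF this] show ?thesis by (rule conjunct1)
    qed
    show "\<exists>t w. runs Q y t w" if v: "v \<in> I" "y \<in> set (elems (reduction d (result P v)))" for v y
    proof -
      obtain x k where "v = instance_val x k" using v(1) unfolding I_def by auto
      from key[OF this] v(2) show ?thesis by (elim conjE) (erule bspec)
    qed
  qed
  \<comment> \<open>One exponent that dominates both the total time of the queries and the summand
    \<open>u v + 2\<close>.\<close>
  define h where "h = Suc (b + b * c2)"
  define F where "F k = ((H k + 1) * (f1 k + 2 * k + 9) ^ h) ^ e" for k
  have F: "computable F"
    unfolding F_def by (intro computable_power computable_mult computable_add H f1 computable_const computable_id)
  have bound: "(val_size v + steps P v + (\<Sum>y\<leftarrow>elems (reduction d (result P v)). steps Q y) + 2) ^ e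
      \<le> F k * Suc (length x) ^ (Suc c1 * h * e)" if v: "v = instance_val x k" for v x k
  proof -
    let ?n = "Suc (length x)"
    have pow: "(u v + 2) ^ (b + b * c2) \<le> (u v + 2) ^ h" "u v + 2 \<le> (u v + 2) ^ h"
      using power_increasing[of "b + b * c2" h "u v + 2"] power_increasing[of 1 h "u v + 2"] by (auto simp: h_def)
    have "u v + (\<Sum>y\<leftarrow>elems (reduction d (result P v)). steps Q y) + 2 \<le> (u v + 2) ^ h + H k * (u v + 2) ^ h"
      using key[OF v] pow mult_left_mono[OF pow(1), of "H k"] by linarith
    also have "\<dots> = (H k + 1) * (u v + 2) ^ h" by (simp add: algebra_simps)
    also have "\<dots> \<le> (H k + 1) * ((f1 k + 2 * k + 9) * ?n ^ Suc c1) ^ h"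
    proof (intro mult_left_mono power_mono)
      \<comment> \<open>The size bound \<open>4 * length x + 2 * k + 3\<close> of the input,
        increased by 2, yields the constants 4 and 5 that make up the 9 in \<open>F\<close>.\<close>
      have "u v + 2 \<le> 4 * length x + (2 * k + 5) + f1 k * ?n ^ c1"
        using val_size_instance_val[of x k] key[OF v] by (simp add: u_def v)
      also have "\<dots> \<le> 4 * ?n ^ Suc c1 + (2 * k + 5) * ?n ^ Suc c1 + f1 k * ?n ^ Suc c1"
      proof (intro add_mono)
        show "4 * length x \<le> 4 * ?n ^ Suc c1" using power_increasing[of 1 "Suc c1" ?n] by simp
        show "2 * k + 5 \<le> (2 * k + 5) * ?n ^ Suc c1" using mult_le_mono2[OF one_le_power[of ?n "Suc c1"], of "2 * k + 5"] by (simp del: power_Suc)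
        show "f1 k * ?n ^ c1 \<le> f1 k * ?n ^ Suc c1" by (intro mult_left_mono) auto
      qed
      also have "\<dots> = (f1 k + 2 * k + 9) * ?n ^ Suc c1" by (simp add: algebra_simps)
      finally show "u v + 2 \<le> (f1 k + 2 * k + 9) * ?n ^ Suc c1" .
    qed simp_all
    also have "\<dots> = (H k + 1) * (f1 k + 2 * k + 9) ^ h * ?n ^ (Suc c1 * h)"
      by (simp only: power_mult_distrib power_mult mult.assoc)
    finally have "(u v + (\<Sum>y\<leftarrow>elems (reduction d (result P v)). steps Q y) + 2) ^ e \<le>
       ((H k + 1) * (f1 k + 2 * k + 9) ^ h * ?n ^ (Suc c1 * h)) ^ e" by (rule power_mono) simp
    also have "\<dots> = F k * ?n ^ (Suc c1 * h * e)" by (simp only: F_def power_mult_distrib power_mult)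
    finally show ?thesis by (simp add: u_def)
  qed
  obtain R N where R: "\<And>v. v \<in> I \<Longrightarrow> computes R N v
      ((val_size v + steps P v + (\<Sum>y\<leftarrow>elems (reduction d (result P v)). steps Q y) + 2) ^ e)
      (bool_val (\<exists>y\<in>set (elems (reduction d (result P v))). result Q y \<noteq> Atom))"
    using e unfolding timed_def by blast
  have R: "\<exists>t output. runs R (instance_val (fst i) (snd i)) t output \<and>
      t \<le> F (snd i) * Suc (length (fst i)) ^ (Suc c1 * h * e) \<and> (output \<noteq> Atom \<longleftrightarrow> i \<in> L)" for i
  proof -
    obtain x k where i: "i = (x, k)" by (cases i)
    let ?v = "instance_val x k"
    have "?v \<in> I" unfolding I_def by auto
    from computes_runs[OF R[OF this]] bound[OF refl, of x k] obtain t where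
      "t \<le> F k * Suc (length x) ^ (Suc c1 * h * e)"
      "runs R ?v t (bool_val (\<exists>y\<in>set (elems (reduction d (result P ?v))). result Q y \<noteq> Atom))"
      by (meson order_trans)
    moreover have "bool_val (\<exists>y\<in>set (elems (reduction d (result P ?v))). result Q y \<noteq> Atom) \<noteq> Atom \<longleftrightarrow> (x, k) \<in> L"
      using key[OF refl, of x k] by (simp add: bool_val_def)
    ultimately show ?thesis unfolding i by auto
  qed
  show "L \<in> FPT" unfolding FPT_def fpt_computable_def mem_Collect_eq
    by (rule exI[of _ R], rule exI[of _ F], rule exI[of _ "Suc c1 * h * e"]) (intro conjI ballI F R)
qed

theorem theorem7:
  assumes "FPT \<noteq> W 2"
  shows "\<not> fpt_computable cc_instances cc_code cc_par cc_correct"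
  using assms FPT_subset_W2 W2_subset_FPT by blast

end
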